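(* There is an algorithm that, on input a domain $D\subseteq\{0,1\}^n$ (given as the list of its elements), halts in time $O(|D|^2n^2)$ and either returns that $D$ is not a possibility domain, or outputs a possibility integrity constraint $\phi$ containing $O(|D|n)$ clauses whose set of satisfying truth assignments is $D$.
   Context: Standing assumption: domains are non-degenerate (projection onto each coordinate is $\{0,1\}$). A $k$-ary aggregator for $D$ ($k\ge2$) is an $n$-tuple $(f_1,\ldots,f_n)$ of unanimous functions $f_j:\{0,1\}^k\to\{0,1\}$ such that whenever $x^1,\ldots,x^k\in D$, $(f_1(x^1_1,\ldots,x^k_1),\ldots,f_n(x^1_n,\ldots,x^k_n))\in D$; it is dictatorial if $f_1=\cdots=f_n={\rm pr}^k_d$ for some $d$. $D$ is a possibility domain if it admits a non-dictatorial aggregator of some arity. A possibility integrity constraint is a formula that is separable (variables partitionable into two non-empty sets with no clause containing variables from both), or affine (conjunction of exclusive-OR clauses of literals), or renamable partially Horn (after swapping $x\leftrightarrow\neg x$ for the variables of some subset, there is a non-empty variable set $V_0$ such that clauses with variables only from $V_0$ have at most one positive literal and variables of $V_0$ appear only negatively in clauses also containing other variables). *)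

theory Defs
  imports Main
begin

section \<open>Domains and aggregators\<close>

text \<open>A vector of \<open>{0,1}\<^sup>n\<close> is a \<^typ>\<open>bool list\<close> of length \<open>n\<close>; issues and variables are
  numbered \<open>0, \<dots>, n - 1\<close>.\<close>

definition domain :: "nat \<Rightarrow> bool list set \<Rightarrow> bool" where
  "domain n D \<longleftrightarrow> (\<forall>x\<in>D. length x = n) \<and> (\<forall>j<n. (\<lambda>x. x ! j) ` D = {False, True})"

definition unanimous :: "nat \<Rightarrow> (bool list \<Rightarrow> bool) \<Rightarrow> bool" where
  "unanimous k g \<longleftrightarrow> (\<forall>b. g (replicate k b) = b)"

text \<open>Only the components \<open>f 0, \<dots>, f (n - 1)\<close> matter, and only their values on lists of
  length \<open>k\<close>.\<close>

definition aggregator :: "nat \<Rightarrow> nat \<Rightarrow> bool list set \<Rightarrow> (nat \<Rightarrow> bool list \<Rightarrow> bool) \<Rightarrow> bool" where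
  "aggregator k n D f \<longleftrightarrow>
     2 \<le> k \<and> (\<forall>j<n. unanimous k (f j)) \<and>
     (\<forall>X. length X = k \<and> set X \<subseteq> D \<longrightarrow>
        map (\<lambda>j. f j (map (\<lambda>x. x ! j) X)) [0..<n] \<in> D)"

definition dictatorial :: "nat \<Rightarrow> nat \<Rightarrow> (nat \<Rightarrow> bool list \<Rightarrow> bool) \<Rightarrow> bool" where
  "dictatorial k n f \<longleftrightarrow> (\<exists>d<k. \<forall>j<n. \<forall>y. length y = k \<longrightarrow> f j y = y ! d)"

definition possibility_domain :: "nat \<Rightarrow> bool list set \<Rightarrow> bool" where
  "possibility_domain n D \<longleftrightarrow> (\<exists>k f. aggregator k n D f \<and> \<not> dictatorial k n f)"


section \<open>Integrity constraints\<close>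

text \<open>The literal \<open>(i, True)\<close> is \<open>x\<^sub>i\<close> and \<open>(i, False)\<close> is its negation. The clauses of a formula
  are either all disjunctions (\<open>CNF\<close>) or all exclusive disjunctions (\<open>XNF\<close>) of literals.\<close>

type_synonym literal = "nat \<times> bool"
type_synonym clause = "literal list"

datatype formula = CNF (clauses: "clause list") | XNF (clauses: "clause list")

definition vars :: "clause \<Rightarrow> nat set" where
  "vars c = fst ` set c"

definition lit_true :: "bool list \<Rightarrow> literal \<Rightarrow> bool" where
  "lit_true x l \<longleftrightarrow> x ! fst l = snd l"

fun satisfies :: "bool list \<Rightarrow> formula \<Rightarrow> bool" where
  "satisfies x (CNF cs) \<longleftrightarrow> (\<forall>c\<in>set cs. \<exists>l\<in>set c. lit_true x l)"
| "satisfies x (XNF cs) \<longleftrightarrow> (\<forall>c\<in>set cs. odd (length (filter (lit_true x) c)))"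

text \<open>The variables of a formula are all of \<open>x\<^sub>0, \<dots>, x\<^bsub>n-1\<^esub>\<close>, whether or not they occur in it.\<close>

definition formula_over :: "nat \<Rightarrow> formula \<Rightarrow> bool" where
  "formula_over n \<phi> \<longleftrightarrow> (\<forall>c\<in>set (clauses \<phi>). vars c \<subseteq> {..<n})"

definition models :: "nat \<Rightarrow> formula \<Rightarrow> bool list set" where
  "models n \<phi> = {x. length x = n \<and> satisfies x \<phi>}"

definition separable :: "nat \<Rightarrow> formula \<Rightarrow> bool" where
  "separable n \<phi> \<longleftrightarrow>
     (\<exists>V W. V \<noteq> {} \<and> W \<noteq> {} \<and> V \<inter> W = {} \<and> V \<union> W = {..<n} \<and>
        (\<forall>c\<in>set (clauses \<phi>). \<not> (vars c \<inter> V \<noteq> {} \<and> vars c \<inter> W \<noteq> {})))"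

definition affine :: "formula \<Rightarrow> bool" where
  "affine \<phi> \<longleftrightarrow> (\<exists>cs. \<phi> = XNF cs)"

definition partially_Horn :: "nat \<Rightarrow> clause list \<Rightarrow> bool" where
  "partially_Horn n cs \<longleftrightarrow>
     (\<exists>V0. V0 \<noteq> {} \<and> V0 \<subseteq> {..<n} \<and>
        (\<forall>c\<in>set cs.
           (vars c \<subseteq> V0 \<longrightarrow> length (filter snd c) \<le> 1) \<and>
           (\<not> vars c \<subseteq> V0 \<longrightarrow> (\<forall>(i, b)\<in>set c. i \<in> V0 \<longrightarrow> \<not> b))))"

definition rename_clause :: "nat set \<Rightarrow> clause \<Rightarrow> clause" where
  "rename_clause S c = map (\<lambda>(i, b). (i, if i \<in> S then \<not> b else b)) c"

definition renamable_partially_Horn :: "nat \<Rightarrow> formula \<Rightarrow> bool" where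
  "renamable_partially_Horn n \<phi> \<longleftrightarrow>
     (\<exists>cs S. \<phi> = CNF cs \<and> S \<subseteq> {..<n} \<and> partially_Horn n (map (rename_clause S) cs))"

definition possibility_integrity_constraint :: "nat \<Rightarrow> formula \<Rightarrow> bool" where
  "possibility_integrity_constraint n \<phi> \<longleftrightarrow>
     formula_over n \<phi> \<and> (separable n \<phi> \<or> affine \<phi> \<or> renamable_partially_Horn n \<phi>)"


section \<open>Algorithms: a random access machine with uniform cost\<close>

text \<open>Programs are structured RAM programs over named registers and named random access
  arrays of natural numbers, with a write-only output tape. The only arithmetic is addition and
  (truncated) subtraction, as usual for uniform cost: there is no multiplication. Every evaluated
  operand, operator, memory access, test and command costs one time unit.\<close>

type_synonym name = string

datatype aexp = N nat | V name | Sel name aexp | Plus aexp aexp | Minus aexp aexp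

datatype bexp = Eq aexp aexp | Less aexp aexp | Not bexp | And bexp bexp

datatype com =
    Skip
  | Assign name aexp
  | Store name aexp aexp  \<comment> \<open>array, index, value\<close>
  | Write aexp
  | Seq com com
  | If bexp com com
  | While bexp com

record state =
  reg :: "name \<Rightarrow> nat"
  arr :: "name \<Rightarrow> nat \<Rightarrow> nat"
  out :: "nat list"

fun aval :: "aexp \<Rightarrow> state \<Rightarrow> nat" where
  "aval (N k) s = k"
| "aval (V x) s = reg s x"
| "aval (Sel a e) s = arr s a (aval e s)"
| "aval (Plus e1 e2) s = aval e1 s + aval e2 s"
| "aval (Minus e1 e2) s = aval e1 s - aval e2 s"

fun acost :: "aexp \<Rightarrow> nat" where
  "acost (N k) = 1"
| "acost (V x) = 1"
| "acost (Sel a e) = 1 + acost e"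
| "acost (Plus e1 e2) = 1 + acost e1 + acost e2"
| "acost (Minus e1 e2) = 1 + acost e1 + acost e2"

fun bval :: "bexp \<Rightarrow> state \<Rightarrow> bool" where
  "bval (Eq e1 e2) s \<longleftrightarrow> aval e1 s = aval e2 s"
| "bval (Less e1 e2) s \<longleftrightarrow> aval e1 s < aval e2 s"
| "bval (Not b) s \<longleftrightarrow> \<not> bval b s"
| "bval (And b1 b2) s \<longleftrightarrow> bval b1 s \<and> bval b2 s"

fun bcost :: "bexp \<Rightarrow> nat" where
  "bcost (Eq e1 e2) = 1 + acost e1 + acost e2"
| "bcost (Less e1 e2) = 1 + acost e1 + acost e2"
| "bcost (Not b) = 1 + bcost b"
| "bcost (And b1 b2) = 1 + bcost b1 + bcost b2"

text \<open>\<open>exec p s t s'\<close>: started in \<open>s\<close>, the program \<open>p\<close> halts after exactly \<open>t\<close> time units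
  in \<open>s'\<close>.\<close>

inductive exec :: "com \<Rightarrow> state \<Rightarrow> nat \<Rightarrow> state \<Rightarrow> bool" where
  Skip: "exec Skip s 1 s"
| Assign: "exec (Assign x e) s (1 + acost e) (s\<lparr>reg := (reg s)(x := aval e s)\<rparr>)"
| Store: "exec (Store a i e) s (1 + acost i + acost e)
            (s\<lparr>arr := (arr s)(a := (arr s a)(aval i s := aval e s))\<rparr>)"
| Write: "exec (Write e) s (1 + acost e) (s\<lparr>out := out s @ [aval e s]\<rparr>)"
| Seq: "exec p s t1 s' \<Longrightarrow> exec q s' t2 s'' \<Longrightarrow> exec (Seq p q) s (1 + t1 + t2) s''"
| IfTrue: "bval b s \<Longrightarrow> exec p s t s' \<Longrightarrow> exec (If b p q) s (1 + bcost b + t) s'"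
| IfFalse: "\<not> bval b s \<Longrightarrow> exec q s t s' \<Longrightarrow> exec (If b p q) s (1 + bcost b + t) s'"
| WhileFalse: "\<not> bval b s \<Longrightarrow> exec (While b p) s (1 + bcost b) s"
| WhileTrue: "bval b s \<Longrightarrow> exec p s t1 s' \<Longrightarrow> exec (While b p) s' t2 s'' \<Longrightarrow>
    exec (While b p) s (1 + bcost b + t1 + t2) s''"

inductive_cases SkipE: "exec Skip s t s'"
inductive_cases AssignE: "exec (Assign x e) s t s'"
inductive_cases StoreE: "exec (Store a i e) s t s'"
inductive_cases WriteE: "exec (Write e) s t s'"
inductive_cases SeqE: "exec (Seq p q) s t s'"
inductive_cases IfE: "exec (If b p q) s t s'"
inductive_cases WhileE: "exec (While b p) s t s'"

lemma exec_deterministic: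
  "exec p s t s' \<Longrightarrow> exec p s u s'' \<Longrightarrow> u = t \<and> s'' = s'"
proof (induction arbitrary: u s'' rule: exec.induct)
  case (Skip s)
  then show ?case by (rule SkipE) simp
next
  case (Assign x e s)
  then show ?case by (rule AssignE) simp
next
  case (Store a i e s)
  then show ?case by (rule StoreE) simp
next
  case (Write e s)
  then show ?case by (rule WriteE) simp
next
  case (Seq p s t1 s' q t2 s1)
  from Seq.prems show ?case
  proof (rule SeqE)
    fix v1 r v2
    assume *: "u = Suc (v1 + v2)" "exec p s v1 r" "exec q r v2 s''"
    from Seq.IH(1)[OF *(2)] *(3) have "exec q s' v2 s''" by simp
    from Seq.IH(2)[OF this] Seq.IH(1)[OF *(2)] *(1) show ?thesis by simp
  qed
next
  case (IfTrue b s p t s' q)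
  from IfTrue.prems show ?case by (rule IfE) (use IfTrue.hyps in \<open>simp_all add: IfTrue.IH\<close>)
next
  case (IfFalse b s q t s' p)
  from IfFalse.prems show ?case by (rule IfE) (use IfFalse.hyps in \<open>simp_all add: IfFalse.IH\<close>)
next
  case (WhileFalse b s p)
  from WhileFalse.prems show ?case by (rule WhileE) (use WhileFalse.hyps in simp_all)
next
  case (WhileTrue b s p t1 s' t2 s1)
  from WhileTrue.prems show ?case
  proof (rule WhileE)
    fix v1 r v2
    assume *: "u = Suc (bcost b + v1 + v2)" "exec p s v1 r" "exec (While b p) r v2 s''"
    from WhileTrue.IH(1)[OF *(2)] *(3) have "exec (While b p) s' v2 s''" by simp
    from WhileTrue.IH(2)[OF this] WhileTrue.IH(1)[OF *(2)] *(1) show ?thesis by simp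
  next
    assume "\<not> bval b s"
    with WhileTrue.hyps(1) show ?thesis by simp
  qed
qed


section \<open>Input and output format\<close>

text \<open>The list of the elements of the domain is stored row by row, as bits, in the array
  \<open>in\<close>; all other memory is zero.\<close>

definition initial_state :: "nat \<Rightarrow> bool list list \<Rightarrow> state" where
  "initial_state n xs =
     \<lparr>reg = (\<lambda>_. 0)(''n'' := n, ''size'' := length xs),
      arr = (\<lambda>_ _. 0)(''in'' := (\<lambda>i. if i < length (concat xs) then of_bool (concat xs ! i) else 0)),
      out = []\<rparr>"

text \<open>The answer \<^const>\<open>None\<close> means ``not a possibility domain''. Each clause is terminated by 0,
  and literals are encoded by positive numbers.\<close>

fun encode_literal :: "literal \<Rightarrow> nat" where
  "encode_literal (i, b) = 2 * i + (if b then 2 else 1)"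

definition encode_clauses :: "clause list \<Rightarrow> nat list" where
  "encode_clauses cs = concat (map (\<lambda>c. map encode_literal c @ [0]) cs)"

fun encode_answer :: "formula option \<Rightarrow> nat list" where
  "encode_answer None = [0]"
| "encode_answer (Some (CNF cs)) = 1 # encode_clauses cs"
| "encode_answer (Some (XNF cs)) = 2 # encode_clauses cs"

lemma encode_literal_pos: "0 < encode_literal l"
  by (cases l) simp

lemma encode_literal_inj: "encode_literal l = encode_literal l' \<Longrightarrow> l = l'"
  by (cases l; cases l'; simp split: if_splits; presburger)

lemma encode_clause_inj:
  "map encode_literal c @ 0 # us = map encode_literal d @ 0 # vs \<Longrightarrow> c = d \<and> us = vs"
proof (induction c arbitrary: d)
  case Nil
  then show ?case
  proof (cases d)
    case (Cons l d')
    with Nil encode_literal_pos[of l] show ?thesis by simp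
  qed simp
next
  case (Cons l c)
  then show ?case
  proof (cases d)
    case Nil
    with Cons.prems encode_literal_pos[of l] show ?thesis by simp
  next
    case (Cons l' d')
    with Cons.prems Cons.IH[of d'] encode_literal_inj[of l l'] show ?thesis by simp
  qed
qed

lemma encode_clauses_inj: "encode_clauses cs = encode_clauses ds \<Longrightarrow> cs = ds"
proof (induction cs arbitrary: ds)
  case Nil
  then show ?case by (cases ds) (auto simp: encode_clauses_def)
next
  case (Cons c cs)
  then obtain d ds' where ds: "ds = d # ds'"
    by (cases ds) (auto simp: encode_clauses_def)
  with Cons.prems have "map encode_literal c @ 0 # encode_clauses cs
      = map encode_literal d @ 0 # encode_clauses ds'"
    by (simp add: encode_clauses_def)
  from encode_clause_inj[OF this] Cons.IH ds show ?case by blast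
qed

lemma encode_answer_inj: "encode_answer r = encode_answer r' \<Longrightarrow> r = r'"
  by (cases r rule: encode_answer.cases; cases r' rule: encode_answer.cases)
    (auto dest: encode_clauses_inj)

end

theory Submission
  imports Defs
begin

text \<open>Every non-dictatorial aggregator yields closure of \<open>D\<close> under \<open>x + y + z\<close> or a binary
  non-dictatorial aggregator: in one of minimal arity \<open>k \<ge> 3\<close> all identification minors are
  dictatorial, which forces all components to be one Boolean function whose minors are projections,
  and such a function is a projection unless \<open>k = 3\<close>. Then it is the minority function \<open>x + y + z\<close> or
  generates majority, which becomes a binary aggregator after fixing one argument in \<open>D\<close>.

  Let \<open>\<phi>\<close> consist of prime implicates of \<open>D\<close>, and consider the implications \<open>l \<longrightarrow> \<not> l'\<close> for distinct
  literals \<open>l\<close>, \<open>l'\<close> of a common clause. For a binary aggregator \<open>f\<close> the literals \<open>(j, b)\<close> with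
  \<open>f\<^sub>j(b, \<not> b) = \<not> b\<close> are closed under these implications, and they are neither none nor all of the
  literals unless \<open>f\<close> is dictatorial. Conversely, a non-trivial closed set of literals makes \<open>\<phi>\<close>
  separable or renamable partially Horn. So the decision is whether the implication graph is
  strongly connected; being skew-symmetric, it is so iff both literals of \<open>x\<^sub>0\<close> reach everything.

  A prime \<open>\<phi>\<close> with at most \<open>|D| n\<close> clauses comes from the clauses that forbid to leave the prefix tree
  of \<open>D\<close>; a count of the satisfied literals for every row lets each clause be minimized in time
  \<open>O(|D| n)\<close>. Closure under \<open>x + y + z\<close> is decided by computing the affine hull of \<open>D\<close>.\<close>

section \<open>Reduction to binary aggregators\<close>

text \<open>The bound O(|D|^2 n^2) leaves O(|D| n) for each of the |D| n candidate clauses. The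
  obstacle is the arrows: a clause may have n literals, hence about n^2 pairs, which exceeds |D| n
  when D is small. Primality is the way out. Each literal l of a prime clause has a row of D that
  satisfies l and no other literal; scanning the rows whose count of satisfied literals is 1, and
  drawing all arrows out of that one literal, finds every arrow in O(|D| n). The same rows justify
  the arrows: a binary aggregator applied to a row satisfying only l and a row satisfying only l'
  must keep one of the two literals. Strong connectivity excludes only binary aggregators, and x + y
  + z may preserve D without any of these, hence the separate affine test. It decides by counting:
  every pivot doubles the zero set, which stays inside each closed superset of D and in the end
  contains D, so D is closed exactly if the final size is |D|. The rest is cheaper: O(|D| n^2) for
  the hull, O(n^2) for the searches.\<close>

definition xor3 :: "bool list \<Rightarrow> bool list \<Rightarrow> bool list \<Rightarrow> bool list" where
  "xor3 x y z = map (\<lambda>j. (x ! j \<noteq> y ! j) \<noteq> z ! j) [0..<length x]"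

text \<open>For non-empty \<open>D\<close> this says that \<open>D\<close> is an affine subspace of
  the n-dimensional space over the two-element field.\<close>

definition xor3_closed :: "bool list set \<Rightarrow> bool" where
  "xor3_closed D \<longleftrightarrow> (\<forall>x\<in>D. \<forall>y\<in>D. \<forall>z\<in>D. xor3 x y z \<in> D)"

text \<open>The map \<sigma> selects, for each of the \<open>k\<close> arguments, one of the
  \<open>k'\<close> given vectors of \<open>D\<close>, so the result is again a value of
  \<open>f\<close> on vectors of \<open>D\<close>. It is applied to a \<sigma> that identifies two
  arguments.\<close>

lemma aggregator_minor:
  assumes f: "aggregator k n D f" and k': "2 \<le> k'" and \<sigma>: "\<And>i. i < k \<Longrightarrow> \<sigma> i < k'"
  shows "aggregator k' n D (\<lambda>j y. f j (map (\<lambda>i. y ! \<sigma> i) [0..<k]))"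
  unfolding aggregator_def
proof (intro conjI allI impI)
  fix j assume "j < n"
  moreover have "map (\<lambda>i. replicate k' b ! \<sigma> i) [0..<k] = replicate k b" for b
    using \<sigma> by (auto intro!: nth_equalityI)
  ultimately show "unanimous k' (\<lambda>y. f j (map (\<lambda>i. y ! \<sigma> i) [0..<k]))"
    using f unfolding aggregator_def unanimous_def by metis
next
  fix X assume X: "length X = k' \<and> set X \<subseteq> D"
  let ?Y = "map (\<lambda>i. X ! \<sigma> i) [0..<k]"
  have "set ?Y \<subseteq> D" using X \<sigma> by (force simp: set_conv_nth)
  then have "map (\<lambda>j. f j (map (\<lambda>x. x ! j) ?Y)) [0..<n] \<in> D"
    using f length_map[of _ "[0..<k]"] unfolding aggregator_def length_upt minus_nat.diff_0 by blast
  moreover have "map (\<lambda>x. x ! j) ?Y = map (\<lambda>i. map (\<lambda>x. x ! j) X ! \<sigma> i) [0..<k]" for j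
    using X \<sigma> by (auto intro!: nth_equalityI)
  ultimately show "map (\<lambda>j. f j (map (\<lambda>i. map (\<lambda>x. x ! j) X ! \<sigma> i) [0..<k])) [0..<n] \<in> D"
    by (simp only:)
qed (use k' in auto)

text \<open>Identifying arguments \<open>a\<close> and \<open>b\<close> lowers the arity to
  \<open>k - 1\<close>, where every aggregator is dictatorial. Read back, the dictator is a position
  \<open>d\<close> of \<open>f\<close> itself, valid on the arguments that agree at \<open>a\<close>
  and \<open>b\<close>, and the same \<open>d\<close> serves all components.\<close>

lemma minor_dictator:
  assumes f: "aggregator k n D f" and k: "3 \<le> k" and ab: "a < b" "b < k"
    and small: "\<And>g. aggregator (k - 1) n D g \<Longrightarrow> dictatorial (k - 1) n g"
  shows "\<exists>d<k. \<forall>j<n. \<forall>y. length y = k \<and> y ! a = y ! b \<longrightarrow> f j y = y ! d"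
proof -
  \<comment> \<open>\<open>?\<sigma>\<close> sends position \<open>b\<close> to \<open>a\<close> and
    closes the gap; \<open>?\<rho>\<close> is its right inverse that skips \<open>b\<close>. Hence
    \<open>y\<close> is recovered from its entries along \<open>?\<rho>\<close> whenever
    \<open>y ! a = y ! b\<close>.\<close>
  let ?\<sigma> = "\<lambda>i. if i < b then i else if i = b then a else i - 1"
  let ?\<rho> = "\<lambda>i. if i < b then i else i + 1"
  have "aggregator (k - 1) n D (\<lambda>j y. f j (map (\<lambda>i. y ! ?\<sigma> i) [0..<k]))"
    by (rule aggregator_minor[OF f]) (use k ab in \<open>auto split: if_splits\<close>)
  from small[OF this] obtain d where d: "d < k - 1"
    "\<And>j y. j < n \<Longrightarrow> length y = k - 1 \<Longrightarrow> f j (map (\<lambda>i. y ! ?\<sigma> i) [0..<k]) = y ! d"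
    unfolding dictatorial_def by blast
  have "f j y = y ! ?\<rho> d" if "j < n" "length y = k" "y ! a = y ! b" for j y
  proof -
    let ?z = "map (\<lambda>i. y ! ?\<rho> i) [0..<k - 1]"
    have "map (\<lambda>i. ?z ! ?\<sigma> i) [0..<k] = y"
      using that ab k by (intro nth_equalityI) (auto simp: nth_append)
    then show ?thesis using d(2)[of j ?z] d(1) that by simp
  qed
  moreover have "?\<rho> d < k" using d(1) by auto
  ultimately show ?thesis by blast
qed

section \<open>Boolean functions whose identification minors are projections\<close>

definition maj :: "bool \<Rightarrow> bool \<Rightarrow> bool \<Rightarrow> bool" where
  "maj a b c \<longleftrightarrow> a \<and> b \<or> a \<and> c \<or> b \<and> c"

text \<open>With the third argument fixed to \<open>z\<close>, component \<open>j\<close> is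
  conjunction if \<open>z ! j\<close> is false and disjunction if it is true. Neither is a
  projection.\<close>

lemma majority_aggregator:
  assumes n: "1 \<le> n" and D: "domain n D"
    and maj: "\<And>x y z. x \<in> D \<Longrightarrow> y \<in> D \<Longrightarrow> z \<in> D \<Longrightarrow>
      map (\<lambda>j. maj (x ! j) (y ! j) (z ! j)) [0..<n] \<in> D"
  shows "\<exists>f. aggregator 2 n D f \<and> \<not> dictatorial 2 n f"
proof -
  from n D have "(\<lambda>x. x ! 0) ` D = {False, True}" by (simp add: domain_def)
  then obtain z where z: "z \<in> D" by blast
  let ?f = "\<lambda>j y. maj (y ! 0) (y ! 1) (z ! j)"
  have "aggregator 2 n D ?f"
    unfolding aggregator_def
  proof (intro conjI allI impI)
    fix X assume X: "length X = 2 \<and> set X \<subseteq> D"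
    then obtain x y where "X = [x, y]" by (auto simp: numeral_2_eq_2 length_Suc_conv)
    with X maj[of x y z] z
    show "map (\<lambda>j. ?f j (map (\<lambda>x. x ! j) X)) [0..<n] \<in> D" by simp
  qed (auto simp: unanimous_def maj_def numeral_2_eq_2)
  moreover have "\<not> dictatorial 2 n ?f"
  proof
    assume "dictatorial 2 n ?f"
    then obtain d where d: "d < 2" "\<And>j y. j < n \<Longrightarrow> length y = 2 \<Longrightarrow> ?f j y = y ! d"
      unfolding dictatorial_def by blast
    from d(2)[of 0 "[True, False]"] d(2)[of 0 "[False, True]"] n d(1)
    show False by (auto simp: maj_def less_2_cases_iff)
  qed
  ultimately show ?thesis by blast
qed

text \<open>Unanimity and self-duality leave only the values \<open>p\<close>, \<open>q\<close>,
  \<open>r\<close> at the three unit vectors free. The eight functions are majority, minority, three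
  projections, and majority with one argument negated.\<close>

lemma ternary_aggregator_cases:
  fixes g :: "bool list \<Rightarrow> bool"
  assumes n: "1 \<le> n" and D: "domain n D"
    and g: "\<And>x y z. x \<in> D \<Longrightarrow> y \<in> D \<Longrightarrow> z \<in> D \<Longrightarrow> map (\<lambda>j. g [x ! j, y ! j, z ! j]) [0..<n] \<in> D"
    and un: "\<And>b. g [b, b, b] = b"
    and dual: "\<And>a b c. g [\<not> a, \<not> b, \<not> c] = (\<not> g [a, b, c])"
    and nd: "\<And>d. d < 3 \<Longrightarrow> \<exists>a b c. g [a, b, c] \<noteq> [a, b, c] ! d"
  shows "xor3_closed D \<or> (\<exists>f. aggregator 2 n D f \<and> \<not> dictatorial 2 n f)"
proof -
  define p q r where "p = g [True, False, False]" and "q = g [False, True, False]"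
    and "r = g [False, False, True]"
  \<comment> \<open>If exactly one argument differs from the other two, duality reduces the value to
    a unit vector: a lone first argument \<open>a\<close> yields \<open>p\<close> if it is true and
    the negation of \<open>p\<close> otherwise, and likewise for the other positions.\<close>
  have g_eq: "g [a, b, c] =
      (if a = b \<and> b = c then a else if b = c then (a = p) else if a = c then (b = q) else (c = r))" for a b c
    using un dual[of True False False] dual[of False True False] dual[of False False True]
    by (cases a; cases b; cases c) (simp_all add: p_def q_def r_def)
  have maj: "xor3_closed D \<or> (\<exists>f. aggregator 2 n D f \<and> \<not> dictatorial 2 n f)"
    if "\<And>x y z. x \<in> D \<Longrightarrow> y \<in> D \<Longrightarrow> z \<in> D \<Longrightarrow>
      map (\<lambda>j. maj (x ! j) (y ! j) (z ! j)) [0..<n] \<in> D"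
    using majority_aggregator[OF n D that] by blast
  have nth_g: "map (\<lambda>j. g [x ! j, y ! j, z ! j]) [0..<n] ! i = g [x ! i, y ! i, z ! i]"
    if "i < n" for x y z :: "bool list" and i using that by simp
  consider "\<not> p" "\<not> q" "\<not> r" | "p" "q" "r" | "p" "\<not> q" "\<not> r" | "\<not> p" "q" "\<not> r"
    | "\<not> p" "\<not> q" "r" | "p" "\<not> q" "r" | "p" "q" "\<not> r" | "\<not> p" "q" "r" by blast
  then show ?thesis
  proof cases
    case 1
    have e: "maj a b c = g [a, b, c]" for a b c
      unfolding g_eq maj_def using 1 by auto
    show ?thesis by (rule maj) (unfold e, rule g)
  next
    case 2
    have e: "((a \<noteq> b) \<noteq> c) = g [a, b, c]" for a b c
      unfolding g_eq using 2 by auto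
    have "length x = n" if "x \<in> D" for x using D that by (simp add: domain_def)
    then have "xor3_closed D" unfolding xor3_closed_def xor3_def e using g by simp
    then show ?thesis ..
  next
    case 3
    then have "g [a, b, c] = [a, b, c] ! 0" for a b c unfolding g_eq by auto
    with nd[of 0] show ?thesis by auto
  next
    case 4
    then have "g [a, b, c] = [a, b, c] ! 1" for a b c unfolding g_eq by auto
    with nd[of 1] show ?thesis by auto
  next
    case 5
    then have "g [a, b, c] = [a, b, c] ! 2" for a b c unfolding g_eq by auto
    with nd[of 2] show ?thesis by auto
  next
    case 6
    \<comment> \<open>Here \<open>g\<close> is majority with its middle argument negated;
      substituting \<open>g\<close> into that argument cancels the negation. The next two cases do
      the same with the third and the first argument.\<close>
    have e: "maj a b c = g [a, g [a, b, c], c]" for a b c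
      unfolding g_eq maj_def using 6 by auto
    show ?thesis
    proof (rule maj)
      fix x y z assume xyz: "x \<in> D" "y \<in> D" "z \<in> D"
      let ?w = "map (\<lambda>j. g [x ! j, y ! j, z ! j]) [0..<n]"
      have "map (\<lambda>j. maj (x ! j) (y ! j) (z ! j)) [0..<n] = map (\<lambda>j. g [x ! j, ?w ! j, z ! j]) [0..<n]"
        unfolding e by (rule map_cong) simp_all
      also have "\<dots> \<in> D" using xyz by (intro g)
      finally show "map (\<lambda>j. maj (x ! j) (y ! j) (z ! j)) [0..<n] \<in> D" .
    qed
  next
    case 7
    have e: "maj a b c = g [a, c, g [a, c, b]]" for a b c
      unfolding g_eq maj_def using 7 by auto
    show ?thesis
    proof (rule maj)
      fix x y z assume xyz: "x \<in> D" "y \<in> D" "z \<in> D"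
      let ?w = "map (\<lambda>j. g [x ! j, z ! j, y ! j]) [0..<n]"
      have "map (\<lambda>j. maj (x ! j) (y ! j) (z ! j)) [0..<n] = map (\<lambda>j. g [x ! j, z ! j, ?w ! j]) [0..<n]"
        unfolding e by (rule map_cong) simp_all
      also have "\<dots> \<in> D" using xyz by (intro g)
      finally show "map (\<lambda>j. maj (x ! j) (y ! j) (z ! j)) [0..<n] \<in> D" .
    qed
  next
    case 8
    have e: "maj a b c = g [g [b, a, c], a, c]" for a b c
      unfolding g_eq maj_def using 8 by auto
    show ?thesis
    proof (rule maj)
      fix x y z assume xyz: "x \<in> D" "y \<in> D" "z \<in> D"
      let ?w = "map (\<lambda>j. g [y ! j, x ! j, z ! j]) [0..<n]"
      have "map (\<lambda>j. maj (x ! j) (y ! j) (z ! j)) [0..<n] = map (\<lambda>j. g [?w ! j, x ! j, z ! j]) [0..<n]"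
        unfolding e by (rule map_cong) simp_all
      also have "\<dots> \<in> D" using xyz by (intro g)
      finally show "map (\<lambda>j. maj (x ! j) (y ! j) (z ! j)) [0..<n] \<in> D" .
    qed
  qed
qed

text \<open>If \<open>g\<close> is true at the unit vector \<open>e i\<close>, then every minor that
  identifies two positions other than \<open>i\<close> must be projection to \<open>i\<close>; since
  \<open>k\<close> is at least 4, there are three such positions, and two of them carry equal bits
  in any \<open>y\<close>. If \<open>g\<close> is false at all unit vectors, then a minor
  identifying \<open>a\<close> and \<open>b\<close> can only project to \<open>a\<close> or
  \<open>b\<close>, which two disjoint pairs of positions contradict.\<close>

lemma projection_minors:
  fixes g :: "bool list \<Rightarrow> bool"
  assumes k: "4 \<le> k"
    and minor: "\<And>a b. a < b \<Longrightarrow> b < k \<Longrightarrow>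
      \<exists>d<k. \<forall>y. length y = k \<and> y ! a = y ! b \<longrightarrow> g y = y ! d"
  shows "\<exists>d<k. \<forall>y. length y = k \<longrightarrow> g y = y ! d"
proof -
  have minor': "\<exists>d<k. \<forall>y. length y = k \<and> y ! a = y ! b \<longrightarrow> g y = y ! d"
    if "a \<noteq> b" "a < k" "b < k" for a b
    using minor[of a b] minor[of b a] that by (metis linorder_neqE_nat)
  define e where "e i = map (\<lambda>t. t = i) [0..<k]" for i
  have e: "length (e i) = k" "t < k \<Longrightarrow> e i ! t = (t = i)" for i t by (simp_all add: e_def)
  show ?thesis
  proof (cases "\<exists>i<k. g (e i)")
    case True
    then obtain i where i: "i < k" "g (e i)" by blast
    have *: "g y = y ! i" if "a \<noteq> b" "a < k" "b < k" "a \<noteq> i" "b \<noteq> i" "length y = k" "y ! a = y ! b" for a b y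
    proof -
      note ab = that
      obtain d where d: "d < k" "\<And>y. length y = k \<Longrightarrow> y ! a = y ! b \<Longrightarrow> g y = y ! d"
        using minor'[of a b] ab by blast
      with i ab e have "d = i" by metis
      with d ab show ?thesis by blast
    qed
    have "\<exists>a b c. a < k \<and> b < k \<and> c < k \<and> a \<noteq> b \<and> a \<noteq> c \<and> b \<noteq> c \<and> a \<noteq> i \<and> b \<noteq> i \<and> c \<noteq> i"
    proof -
      consider "i = 0" | "i = 1" | "i = 2" | "i \<ge> 3" by linarith
      then show ?thesis
      proof cases
        case 1 show ?thesis by (rule exI[of _ 1], rule exI[of _ 2], rule exI[of _ 3]) (use k 1 in auto)
      next
        case 2 show ?thesis by (rule exI[of _ 0], rule exI[of _ 2], rule exI[of _ 3]) (use k 2 in auto)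
      next
        case 3 show ?thesis by (rule exI[of _ 0], rule exI[of _ 1], rule exI[of _ 3]) (use k 3 in auto)
      next
        case 4 show ?thesis by (rule exI[of _ 0], rule exI[of _ 1], rule exI[of _ 2]) (use k 4 in auto)
      qed
    qed
    then obtain a b c where "a < k" "b < k" "c < k" "a \<noteq> b" "a \<noteq> c" "b \<noteq> c" "a \<noteq> i" "b \<noteq> i" "c \<noteq> i"
      by blast
    then have "g y = y ! i" if "length y = k" for y
      using *[of a b y] *[of a c y] *[of b c y] that by blast
    with i show ?thesis by blast
  next
    case False
    have inside: "d = a \<or> d = b"
      if "a < k" "b < k" "d < k" "\<And>y. length y = k \<Longrightarrow> y ! a = y ! b \<Longrightarrow> g y = y ! d" for a b d
      using False that e by metis
    obtain d where d: "d < k" "\<And>y. length y = k \<Longrightarrow> y ! 0 = y ! 1 \<Longrightarrow> g y = y ! d"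
      using minor'[of 0 1] k by auto
    obtain d' where d': "d' < k" "\<And>y. length y = k \<Longrightarrow> y ! 2 = y ! 3 \<Longrightarrow> g y = y ! d'"
      using minor'[of 2 3] k by auto
    \<comment> \<open>This vector agrees at 0 and 1, where it is true, and at 2 and 3, where it is
      false; the two minors assign it opposite values.\<close>
    let ?y = "map (\<lambda>t. t < 2) [0..<k]"
    have "d = 0 \<or> d = 1" using inside[of 0 1 d] d k by auto
    then have "g ?y" using d(2)[of ?y] k by auto
    moreover have "d' = 2 \<or> d' = 3" using inside[of 2 3 d'] d' k by auto
    then have "\<not> g ?y" using d'(2)[of ?y] k by auto
    ultimately show ?thesis by blast
  qed
qed

theorem possibility_domain_cases:
  assumes n: "1 \<le> n" and D: "domain n D" and poss: "possibility_domain n D"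
  shows "xor3_closed D \<or> (\<exists>f. aggregator 2 n D f \<and> \<not> dictatorial 2 n f)"
proof -
  define P where "P k \<longleftrightarrow> (\<exists>f. aggregator k n D f \<and> \<not> dictatorial k n f)" for k
  define k where "k = (LEAST k. P k)"
  from poss have "\<exists>k. P k" by (simp add: possibility_domain_def P_def)
  then have "P k" and least: "\<And>k'. k' < k \<Longrightarrow> \<not> P k'"
    unfolding k_def by (auto intro: LeastI_ex dest: not_less_Least)
  then obtain f where f: "aggregator k n D f" and nd: "\<not> dictatorial k n f" by (auto simp: P_def)
  show ?thesis
  proof (cases "k = 2")
    case True
    with f nd show ?thesis by blast
  next
    case False
    with f have k: "3 \<le> k" by (simp add: aggregator_def)
    have minor: "\<exists>d<k. \<forall>j<n. \<forall>y. length y = k \<and> y ! a = y ! b \<longrightarrow> f j y = y ! d"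
      if "a < b" "b < k" for a b
      by (rule minor_dictator[OF f k that]) (use least[of "k - 1"] k in \<open>auto simp: P_def\<close>)
    define g where "g = f 0"
    have fg: "f j y = g y" if "j < n" "length y = k" for j y
    proof -
      \<comment> \<open>Two of any three bits agree, and the minor for these two positions
        prescribes the same projection to all components, so the components coincide.\<close>
      have "y ! 0 = y ! 1 \<or> y ! 0 = y ! 2 \<or> y ! 1 = y ! 2" by blast
      then show ?thesis
        using minor[of 0 1] minor[of 0 2] minor[of 1 2] k n that unfolding g_def
        by (auto simp: Suc_le_eq)
    qed
    have minor_g: "\<exists>d<k. \<forall>y. length y = k \<and> y ! a = y ! b \<longrightarrow> g y = y ! d"
      if "a < b" "b < k" for a b using minor[OF that] n unfolding g_def by auto
    have nd_g: "\<not> (\<exists>d<k. \<forall>y. length y = k \<longrightarrow> g y = y ! d)"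
      using nd fg unfolding dictatorial_def by auto
    from projection_minors[OF _ minor_g] nd_g have "k < 4" by force
    with k have k3: "k = 3" by simp
    \<comment> \<open>Two of the three arguments agree, and still agree after negation, so both
      values come from the same projection minor; projections commute with negation.\<close>
    have dual: "g [\<not> a, \<not> b, \<not> c] = (\<not> g [a, b, c])" for a b c
    proof -
      have "g [\<not> a, \<not> b, \<not> c] = (\<not> g [a, b, c])"
        if "u < v" "v < 3" "[a, b, c] ! u = [a, b, c] ! v" for u v
      proof -
        note uv = that
        obtain d where d: "d < 3" "\<And>y. length y = 3 \<and> y ! u = y ! v \<Longrightarrow> g y = y ! d"
          using minor_g[of u v] uv k3 by blast
        have m: "[\<not> a, \<not> b, \<not> c] ! i = (\<not> [a, b, c] ! i)" if "i < 3" for i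
          using that by (auto simp: less_Suc_eq numeral_3_eq_3)
        have "[\<not> a, \<not> b, \<not> c] ! u = [\<not> a, \<not> b, \<not> c] ! v"
          using m[of u] m[of v] uv by (metis less_trans)
        moreover have "length [a, b, c] = 3" "length [\<not> a, \<not> b, \<not> c] = 3" by simp_all
        ultimately show ?thesis using d(2) m[OF d(1)] uv(3) by metis
      qed
      from this[of 0 1] this[of 0 2] this[of 1 2] show ?thesis
        by (cases a; cases b; cases c) (simp_all add: numeral_2_eq_2)
    qed
    show ?thesis
    proof (rule ternary_aggregator_cases[OF n D, of g])
      fix x y z assume xyz: "x \<in> D" "y \<in> D" "z \<in> D"
      then have "map (\<lambda>j. f j (map (\<lambda>x. x ! j) [x, y, z])) [0..<n] \<in> D"
        using f k3 unfolding aggregator_def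
        by (metis empty_subsetI insert_subset length_Cons list.set(1,2) list.size(3) numeral_3_eq_3)
      moreover have "map (\<lambda>j. g [x ! j, y ! j, z ! j]) [0..<n] =
          map (\<lambda>j. f j (map (\<lambda>x. x ! j) [x, y, z])) [0..<n]"
        using fg k3 by simp
      ultimately show "map (\<lambda>j. g [x ! j, y ! j, z ! j]) [0..<n] \<in> D" by (simp only:)
    next
      show "g [b, b, b] = b" for b
        using f n k3 unfolding aggregator_def unanimous_def g_def
        by (auto simp: numeral_3_eq_3 dest!: spec[of _ 0])
    next
      fix d :: nat assume "d < 3"
      then obtain y where "length y = 3" "g y \<noteq> y ! d" using nd_g k3 by auto
      then show "\<exists>a b c. g [a, b, c] \<noteq> [a, b, c] ! d"
        by (auto simp: numeral_3_eq_3 length_Suc_conv)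
    qed (fact dual)
  qed
qed

section \<open>Literals and prime implicates\<close>

fun neg :: "literal \<Rightarrow> literal" where
  "neg (i, b) = (i, \<not> b)"

lemma neg_neg [simp]: "neg (neg l) = l"
  by (cases l) simp

lemma fst_neg [simp]: "fst (neg l) = fst l"
  by (cases l) simp

definition literals :: "nat \<Rightarrow> literal set" where
  "literals n = {..<n} \<times> UNIV"

lemma neg_literals [simp]: "neg l \<in> literals n \<longleftrightarrow> l \<in> literals n"
  by (cases l) (simp add: literals_def)

lemma finite_literals [simp]: "finite (literals n)"
  by (simp add: literals_def)

text \<open>These are not the consequences of the clause as in 2-satisfiability, which lead from
  \<open>neg l\<close> to \<open>l'\<close> for a two-literal clause. They are closure rules for a
  set of literals that an aggregator gives up: if \<open>l\<close> is given up, then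
  \<open>l'\<close> is kept.\<close>

definition implications :: "clause set \<Rightarrow> (literal \<times> literal) set" where
  "implications cs = {(l, neg l') | l l' c. c \<in> cs \<and> l \<in> set c \<and> l' \<in> set c \<and> l \<noteq> l'}"

lemma implications_contrapositive:
  "(l, l') \<in> implications cs \<Longrightarrow> (neg l', neg l) \<in> implications cs"
  unfolding implications_def by force

lemma implications_rtrancl_contrapositive:
  "(l, l') \<in> (implications cs)\<^sup>* \<Longrightarrow> (neg l', neg l) \<in> (implications cs)\<^sup>*"
  by (induction rule: rtrancl_induct)
    (auto intro: converse_rtrancl_into_rtrancl dest: implications_contrapositive)

lemma rtrancl_closed:
  "(a, b) \<in> r\<^sup>* \<Longrightarrow> r `` T \<subseteq> T \<Longrightarrow> a \<in> T \<Longrightarrow> b \<in> T"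
  by (induction rule: rtrancl_induct) auto

lemma vars_rename_clause [simp]: "vars (rename_clause S c) = vars c"
  by (simp add: vars_def rename_clause_def image_image case_prod_unfold)

text \<open>A minimal non-empty closed set of literals is either consistent, and then a set of literals to
  be renamed positive, or closed under negation, and then its variables form a separable block.\<close>

lemma separable_or_renamable_partially_Horn:
  assumes cs: "\<And>c. c \<in> set cs \<Longrightarrow> distinct c \<and> set c \<subseteq> literals n"
    and R: "R \<subseteq> literals n" "R \<noteq> {}" "R \<noteq> literals n" "implications (set cs) `` R \<subseteq> R"
  shows "separable n (CNF cs) \<or> renamable_partially_Horn n (CNF cs)"
proof -
  let ?E = "implications (set cs)"
  define P where "P T \<longleftrightarrow> T \<noteq> {} \<and> T \<subseteq> R \<and> ?E `` T \<subseteq> T" for T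
  have "\<exists>T. P T \<and> (\<forall>T'. P T' \<longrightarrow> card T \<le> card T')"
    by (rule ex_has_least_nat[of P R card]) (use R in \<open>simp add: P_def\<close>)
  then obtain T where T: "P T" and min: "\<And>T'. P T' \<Longrightarrow> card T \<le> card T'" by blast
  have TR: "T \<subseteq> R" and T_lit: "T \<subseteq> literals n" using T R(1) by (auto simp: P_def)
  have fin: "finite T" using T_lit finite_literals by (rule finite_subset)
  \<comment> \<open>By minimality, since the literals reachable from \<open>v\<close> form a
    non-empty closed subset of \<open>T\<close>. So \<open>T\<close> is strongly connected.\<close>
  have reach: "(v, w) \<in> ?E\<^sup>*" if "v \<in> T" "w \<in> T" for v w
  proof -
    have sub: "?E\<^sup>* `` {v} \<subseteq> T"
      using that(1) T rtrancl_closed[of v _ ?E T] unfolding P_def by blast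
    have "v \<in> ?E\<^sup>* `` {v}" by simp
    moreover have "?E `` (?E\<^sup>* `` {v}) \<subseteq> ?E\<^sup>* `` {v}" by (auto intro: rtrancl_into_rtrancl)
    ultimately have "P (?E\<^sup>* `` {v})" using TR sub unfolding P_def by blast
    from min[OF this] card_seteq[OF fin sub] that(2) show ?thesis by blast
  qed
  have step: "neg l' \<in> T" if "c \<in> set cs" "l \<in> set c" "l' \<in> set c" "l \<noteq> l'" "l \<in> T" for c l l'
    using T that unfolding P_def implications_def by blast
  show ?thesis
  proof (cases "\<exists>v\<in>T. neg v \<in> T")
    case True
    then obtain v where v: "v \<in> T" "neg v \<in> T" by blast
    \<comment> \<open>A path from \<open>w\<close> to \<open>neg v\<close> turns by contraposition
      into one from \<open>v\<close> to \<open>neg w\<close>; one complementary pair thus makes all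
      of \<open>T\<close> closed under negation.\<close>
    have negT: "neg w \<in> T" if "w \<in> T" for w
    proof -
      have "(v, neg w) \<in> ?E\<^sup>*"
        using implications_rtrancl_contrapositive[OF reach[OF that v(2)]] by simp
      then show ?thesis using T v(1) unfolding P_def by (blast intro: rtrancl_closed)
    qed
    let ?V = "fst ` T"
    have VT: "l \<in> T" if "fst l \<in> ?V" for l
    proof -
      from that obtain l' where "l' \<in> T" "fst l = fst l'" by (rule imageE)
      moreover have "l = l' \<or> l = neg l'" using \<open>fst l = fst l'\<close> by (cases l, cases l') auto
      ultimately show ?thesis using negT by blast
    qed
    have "?V \<subseteq> {..<n}" using T_lit by (auto simp: literals_def)
    moreover have "?V \<noteq> {..<n}"
    proof
      assume "?V = {..<n}"
      then have "l \<in> T" if "l \<in> literals n" for l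
        using that by (intro VT) (auto simp: literals_def)
      with TR R(1,3) show False by blast
    qed
    moreover have "\<not> (vars c \<inter> ?V \<noteq> {} \<and> vars c \<inter> ({..<n} - ?V) \<noteq> {})" if "c \<in> set cs" for c
    proof
      assume "vars c \<inter> ?V \<noteq> {} \<and> vars c \<inter> ({..<n} - ?V) \<noteq> {}"
      then obtain l l' where l: "l \<in> set c" "fst l \<in> ?V" "l' \<in> set c" "fst l' \<notin> ?V"
        unfolding vars_def by blast
      then have "neg l' \<in> T" using step[OF that l(1) l(3)] VT by blast
      then show False using l(4) by (metis fst_neg image_eqI)
    qed
    ultimately have "separable n (CNF cs)"
      unfolding separable_def using v
      by (intro exI[of _ ?V] exI[of _ "{..<n} - ?V"]) auto
    then show ?thesis ..
  next
    case False
    let ?V = "fst ` T" and ?S = "fst ` {l \<in> T. \<not> snd l}"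
    \<comment> \<open>\<open>T\<close> holds exactly one literal of each variable in
      \<open>?V\<close>, so swapping the variables in \<open>?S\<close> makes precisely the literals
      of \<open>T\<close> positive.\<close>
    have pos: "(if i \<in> ?S then \<not> b else b) \<longleftrightarrow> (i, b) \<in> T" if "i \<in> ?V" for i b
    proof -
      from that obtain b' where b': "(i, b') \<in> T" by force
      have *: "(i, a) \<in> T \<longleftrightarrow> a = b'" for a
      proof (cases "a = b'")
        case a: False
        then have "neg (i, a) = (i, b')" by auto
        with b' False a show ?thesis by metis
      qed (use b' in simp)
      have "i \<in> ?S \<longleftrightarrow> (i, False) \<in> T"
        by (auto simp: image_iff intro: bexI[of _ "(i, False)"])
      then show ?thesis unfolding * by auto
    qed
    \<comment> \<open>A clause containing some \<open>l\<close> in \<open>T\<close> has the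
      negations of all its other literals in \<open>T\<close>. Consistency then keeps those literals
      themselves out of \<open>T\<close>, so the clause has a single literal of \<open>T\<close> and
      only variables of \<open>?V\<close>; a clause with a variable outside \<open>?V\<close> avoids
      \<open>T\<close> altogether.\<close>
    have lit: "l' \<notin> T \<and> fst l' \<in> ?V" if "c \<in> set cs" "l \<in> set c" "l' \<in> set c" "l \<noteq> l'" "l \<in> T" for c l l'
    proof -
      have "neg l' \<in> T" by (rule step) fact+
      with False imageI[of "neg l'" T fst] show ?thesis unfolding fst_neg by blast
    qed
    have "partially_Horn n (map (rename_clause ?S) cs)"
      unfolding partially_Horn_def
    proof (intro exI[of _ ?V] conjI ballI impI)
      show "?V \<noteq> {}" using T by (simp add: P_def)
      show "?V \<subseteq> {..<n}" using T_lit by (auto simp: literals_def)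
    next
      fix c' assume "c' \<in> set (map (rename_clause ?S) cs)" "vars c' \<subseteq> ?V"
      then obtain c where c: "c \<in> set cs" "c' = rename_clause ?S c" by auto
      with \<open>vars c' \<subseteq> ?V\<close> have V: "fst l \<in> ?V" if "l \<in> set c" for l
        using that unfolding c(2) vars_rename_clause by (auto simp: vars_def)
      have "length (filter snd c') = length (filter (\<lambda>l. l \<in> T) c)"
      proof -
        have "snd (case l of (i, b) \<Rightarrow> (i, if i \<in> ?S then \<not> b else b)) = (l \<in> T)" if "l \<in> set c" for l
          using pos[of "fst l" "snd l"] V[OF that] by (simp add: case_prod_unfold)
        then have "filter (snd \<circ> (\<lambda>(i, b). (i, if i \<in> ?S then \<not> b else b))) c = filter (\<lambda>l. l \<in> T) c"
          by (intro filter_cong) simp_all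
        then show ?thesis by (simp add: c(2) rename_clause_def filter_map)
      qed
      also have "\<dots> = card (set c \<inter> T)"
        using cs[OF c(1)] by (simp add: distinct_length_filter Int_commute)
      also have "\<dots> \<le> 1"
      proof -
        have "x = y" if "x \<in> set c \<inter> T" "y \<in> set c \<inter> T" for x y
          using lit[OF c(1), of x y] that by blast
        then show ?thesis by (metis One_nat_def card_le_Suc0_iff_eq finite_Int finite_set)
      qed
      finally show "length (filter snd c') \<le> 1" .
    next
      fix c' assume "c' \<in> set (map (rename_clause ?S) cs)" and nV: "\<not> vars c' \<subseteq> ?V"
      then obtain c where c: "c \<in> set cs" "c' = rename_clause ?S c" by auto
      from nV obtain l where l: "l \<in> set c" "fst l \<notin> ?V"
        unfolding c(2) vars_rename_clause by (auto simp: vars_def)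
      have "(i, b) \<notin> T" if "(i, b) \<in> set c" for i b
        using lit[OF c(1) that l(1)] l(2) by force
      then show "case l of (i, b) \<Rightarrow> i \<in> ?V \<longrightarrow> \<not> b" if "l \<in> set c'" for l
      proof -
        from that obtain i b where "(i, b) \<in> set c" "l = (i, if i \<in> ?S then \<not> b else b)"
          unfolding c(2) rename_clause_def by auto
        then show ?thesis
          using pos[of i b] \<open>\<And>i b. (i, b) \<in> set c \<Longrightarrow> (i, b) \<notin> T\<close> by simp
      qed
    qed
    moreover have "?S \<subseteq> {..<n}" using T_lit by (auto simp: literals_def)
    ultimately have "renamable_partially_Horn n (CNF cs)"
      unfolding renamable_partially_Horn_def by blast
    then show ?thesis ..
  qed
qed

text \<open>Minimality is put in terms of witnesses: a row that satisfies \<open>l\<close> alone is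
  exactly what refutes the clause without \<open>l\<close>. The aggregator argument and the
  computation of the arrows both work with these rows.\<close>

definition prime_implicate :: "bool list set \<Rightarrow> clause \<Rightarrow> bool" where
  "prime_implicate D c \<longleftrightarrow> (\<forall>x\<in>D. \<exists>l\<in>set c. lit_true x l) \<and>
     (\<forall>l\<in>set c. \<exists>x\<in>D. \<forall>l'\<in>set c. lit_true x l' \<longleftrightarrow> l' = l)"

text \<open>\<open>T\<close> collects the literals that are lost when only the first argument
  satisfies them. Take rows satisfying only \<open>l\<close> and only \<open>l'\<close>: the
  combined vector lies in \<open>D\<close> and satisfies some literal of the clause. Unanimity rules
  out literals false in both rows, and \<open>l\<close> is lost, so \<open>l'\<close> is kept, which
  says that \<open>neg l'\<close> is in \<open>T\<close>. Empty \<open>T\<close> means first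
  projections everywhere, full \<open>T\<close> second projections.\<close>

lemma binary_aggregator_closed_set:
  assumes f: "aggregator 2 n D f" "\<not> dictatorial 2 n f"
    and cs: "\<And>c. c \<in> cs \<Longrightarrow> set c \<subseteq> literals n \<and> prime_implicate D c"
    and D: "\<And>x. x \<in> D \<Longrightarrow> length x = n"
  shows "\<exists>T. T \<subseteq> literals n \<and> T \<noteq> {} \<and> T \<noteq> literals n \<and> implications cs `` T \<subseteq> T"
proof -
  define T where "T = {(j, b). j < n \<and> f j [b, \<not> b] = (\<not> b)}"
  have un: "f j [b, b] = b" if "j < n" for j b
    using f(1) that by (simp add: aggregator_def unanimous_def numeral_2_eq_2)
  have two: "\<exists>a b. y = [a, b]" if "length y = 2" for y :: "bool list"
    using that by (auto simp: numeral_2_eq_2 length_Suc_conv)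
  have "T \<noteq> {}"
  proof
    assume "T = {}"
    then have *: "f j [b, \<not> b] = b" if "j < n" for j b using that by (auto simp: T_def)
    have "f j [a, b] = a" if "j < n" for j a b
      by (cases "b = a") (use *[OF that, of a] un[OF that, of a] in auto)
    then have "dictatorial 2 n f"
      unfolding dictatorial_def by (intro exI[of _ 0]) (auto dest!: two)
    with f(2) show False ..
  qed
  moreover have "T \<noteq> literals n"
  proof
    assume "T = literals n"
    then have *: "f j [b, \<not> b] = (\<not> b)" if "j < n" for j b
      using that by (auto simp: T_def literals_def set_eq_iff)
    have "f j [a, b] = b" if "j < n" for j a b
      by (cases "b = a") (use *[OF that, of a] un[OF that, of a] in auto)
    then have "dictatorial 2 n f"
      unfolding dictatorial_def by (intro exI[of _ 1]) (auto dest!: two)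
    with f(2) show False ..
  qed
  moreover have "neg l' \<in> T" if c: "c \<in> cs" and l: "l \<in> set c" "l' \<in> set c" "l \<noteq> l'" "l \<in> T" for c l l'
  proof -
    obtain j b j' b' where jb: "l = (j, b)" "l' = (j', b')" by (cases l, cases l') auto
    have wit: "\<exists>x\<in>D. \<forall>l'\<in>set c. lit_true x l' \<longleftrightarrow> l' = k" if "k \<in> set c" for k
      using cs[OF c] that unfolding prime_implicate_def by blast
    from wit[OF l(1)] wit[OF l(2)] obtain x y where x: "x \<in> D" "\<And>k. k \<in> set c \<Longrightarrow> lit_true x k \<longleftrightarrow> k = l"
      and y: "y \<in> D" "\<And>k. k \<in> set c \<Longrightarrow> lit_true y k \<longleftrightarrow> k = l'"
      by auto
    let ?z = "map (\<lambda>j. f j [x ! j, y ! j]) [0..<n]"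
    have "\<And>X. length X = 2 \<Longrightarrow> set X \<subseteq> D \<Longrightarrow> map (\<lambda>j. f j (map (\<lambda>x. x ! j) X)) [0..<n] \<in> D"
      using f(1) by (simp add: aggregator_def)
    from this[of "[x, y]"] x y have "?z \<in> D" by simp
    with cs[OF c] obtain k where k: "k \<in> set c" "lit_true ?z k"
      unfolding prime_implicate_def by blast
    obtain i a where ia: "k = (i, a)" by (cases k)
    have i: "i < n" using cs[OF c] k(1) ia by (auto simp: literals_def)
    have fa: "f i [x ! i, y ! i] = a" using k(2) i by (simp add: lit_true_def ia)
    have xi: "(x ! i = a) \<longleftrightarrow> k = l" and yi: "(y ! i = a) \<longleftrightarrow> k = l'"
      using x(2)[OF k(1)] y(2)[OF k(1)] by (simp_all add: lit_true_def ia)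
    have "k = l'"
    proof (rule ccontr)
      assume nl': "k \<noteq> l'"
      show False
      proof (cases "k = l")
        case True
        then have "x ! i = a" "y ! i = (\<not> a)" using xi yi nl' by auto
        with fa l(4) True ia jb show False by (simp add: T_def)
      next
        case False
        then have "x ! i = (\<not> a)" "y ! i = (\<not> a)" using xi yi nl' by auto
        with fa un[OF i] show False by simp
      qed
    qed
    then have "y ! i = a" "x ! i = (\<not> a)" using xi yi l(3) by auto
    with fa i \<open>k = l'\<close> ia show ?thesis by (auto simp: T_def)
  qed
  then have "implications cs `` T \<subseteq> T" unfolding implications_def by auto
  moreover have "T \<subseteq> literals n" by (auto simp: T_def literals_def)
  ultimately show ?thesis by blast
qed

text \<open>By contraposition, the second reachability hypothesis makes every literal reach
  \<open>(0, False)\<close>, so that the implication graph is strongly connected.\<close>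

lemma no_binary_aggregator:
  assumes all: "\<And>b l. l \<in> literals n \<Longrightarrow> ((0, b), l) \<in> (implications cs)\<^sup>*"
    and f: "aggregator 2 n D f"
    and cs: "\<And>c. c \<in> cs \<Longrightarrow> set c \<subseteq> literals n \<and> prime_implicate D c"
    and D: "\<And>x. x \<in> D \<Longrightarrow> length x = n"
  shows "dictatorial 2 n f"
proof (rule ccontr)
  assume "\<not> dictatorial 2 n f"
  then have "\<exists>T. T \<subseteq> literals n \<and> T \<noteq> {} \<and> T \<noteq> literals n \<and> implications cs `` T \<subseteq> T"
    using cs D by (intro binary_aggregator_closed_set[OF f])
  then obtain T where T: "T \<subseteq> literals n" "T \<noteq> {}" "T \<noteq> literals n" "implications cs `` T \<subseteq> T" by blast
  then obtain l where l: "l \<in> T" by blast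
  have "neg l \<in> literals n" using l T(1) by auto
  from implications_rtrancl_contrapositive[OF all[OF this, of True]]
  have "(l, (0, False)) \<in> (implications cs)\<^sup>*" by simp
  then have "(0, False) \<in> T" using T(4) l by (rule rtrancl_closed)
  then have "literals n \<subseteq> T" using all[of _ False] T(4) by (blast intro: rtrancl_closed)
  with T(1,3) show False by blast
qed

section \<open>Loop programs\<close>

text \<open>Restricting loops to \<open>For\<close> makes execution a total function
  \<open>run\<close>. Under \<open>well_formed\<close>, no counter is assigned in its loop body and
  no loop bound is assigned anywhere, so the cost depends on the initial registers alone.\<close>

datatype prog =
    Nop
  | Asg name aexp
  | Sto name aexp aexp
  | Out aexp
  | Sq prog prog (infixr \<open>;;\<close> 60)
  | Cond bexp prog prog
  | For name name prog

primrec compile :: "prog \<Rightarrow> com" where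
  "compile Nop = Skip"
| "compile (Asg x e) = Assign x e"
| "compile (Sto a i e) = Store a i e"
| "compile (Out e) = Write e"
| "compile (p ;; q) = Seq (compile p) (compile q)"
| "compile (Cond b p q) = If b (compile p) (compile q)"
| "compile (For x y p) = Seq (Assign x (N 0))
     (While (Less (V x) (V y)) (Seq (compile p) (Assign x (Plus (V x) (N 1)))))"

definition setr :: "name \<Rightarrow> nat \<Rightarrow> state \<Rightarrow> state" where
  "setr x v s = s\<lparr>reg := (reg s)(x := v)\<rparr>"

definition seta :: "name \<Rightarrow> nat \<Rightarrow> nat \<Rightarrow> state \<Rightarrow> state" where
  "seta a i v s = s\<lparr>arr := (arr s)(a := (arr s a)(i := v))\<rparr>"

definition emit :: "nat \<Rightarrow> state \<Rightarrow> state" where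
  "emit v s = s\<lparr>out := out s @ [v]\<rparr>"

lemma setr_simps [simp]:
  "reg (setr x v s) y = (if y = x then v else reg s y)"
  "arr (setr x v s) = arr s" "out (setr x v s) = out s"
  by (simp_all add: setr_def)

lemma seta_simps [simp]:
  "reg (seta a i v s) = reg s"
  "arr (seta a i v s) b = (if b = a then (arr s a)(i := v) else arr s b)"
  "out (seta a i v s) = out s"
  by (simp_all add: seta_def)

lemma emit_simps [simp]:
  "reg (emit v s) = reg s" "arr (emit v s) = arr s" "out (emit v s) = out s @ [v]"
  by (simp_all add: emit_def)

primrec run :: "prog \<Rightarrow> state \<Rightarrow> state" where
  "run Nop s = s"
| "run (Asg x e) s = setr x (aval e s) s"
| "run (Sto a i e) s = seta a (aval i s) (aval e s) s"
| "run (Out e) s = emit (aval e s) s"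
| "run (p ;; q) s = run q (run p s)"
| "run (Cond b p q) s = (if bval b s then run p s else run q s)"
| "run (For x y p) s =
     ((\<lambda>s. setr x (Suc (reg s x)) (run p s)) ^^ reg s y) (setr x 0 s)"

primrec rmod :: "prog \<Rightarrow> name set" where
  "rmod Nop = {}"
| "rmod (Asg x e) = {x}"
| "rmod (Sto a i e) = {}"
| "rmod (Out e) = {}"
| "rmod (p ;; q) = rmod p \<union> rmod q"
| "rmod (Cond b p q) = rmod p \<union> rmod q"
| "rmod (For x y p) = insert x (rmod p)"

primrec amod :: "prog \<Rightarrow> name set" where
  "amod Nop = {}"
| "amod (Asg x e) = {}"
| "amod (Sto a i e) = {a}"
| "amod (Out e) = {}"
| "amod (p ;; q) = amod p \<union> amod q"
| "amod (Cond b p q) = amod p \<union> amod q"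
| "amod (For x y p) = amod p"

primrec silent :: "prog \<Rightarrow> bool" where
  "silent Nop = True"
| "silent (Asg x e) = True"
| "silent (Sto a i e) = True"
| "silent (Out e) = False"
| "silent (p ;; q) = (silent p \<and> silent q)"
| "silent (Cond b p q) = (silent p \<and> silent q)"
| "silent (For x y p) = silent p"

primrec bounds :: "prog \<Rightarrow> name set" where
  "bounds Nop = {}"
| "bounds (Asg x e) = {}"
| "bounds (Sto a i e) = {}"
| "bounds (Out e) = {}"
| "bounds (p ;; q) = bounds p \<union> bounds q"
| "bounds (Cond b p q) = bounds p \<union> bounds q"
| "bounds (For x y p) = insert y (bounds p)"

primrec counters_ok :: "prog \<Rightarrow> bool" where
  "counters_ok Nop = True"
| "counters_ok (Asg x e) = True"
| "counters_ok (Sto a i e) = True"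
| "counters_ok (Out e) = True"
| "counters_ok (p ;; q) = (counters_ok p \<and> counters_ok q)"
| "counters_ok (Cond b p q) = (counters_ok p \<and> counters_ok q)"
| "counters_ok (For x y p) = (x \<notin> rmod p \<and> counters_ok p)"

definition well_formed :: "prog \<Rightarrow> bool" where
  "well_formed p \<longleftrightarrow> counters_ok p \<and> bounds p \<inter> rmod p = {}"

text \<open>An upper bound, since a conditional is charged for both branches. In a loop, 7 pays for
  the sequencing, the initialization of the counter and the last, failing test; 9 pays per round for
  the test, the sequencing and the increment.\<close>

primrec cost :: "(name \<Rightarrow> nat) \<Rightarrow> prog \<Rightarrow> nat" where
  "cost r Nop = 1"
| "cost r (Asg x e) = 1 + acost e"
| "cost r (Sto a i e) = 1 + acost i + acost e"
| "cost r (Out e) = 1 + acost e"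
| "cost r (p ;; q) = 1 + cost r p + cost r q"
| "cost r (Cond b p q) = 1 + bcost b + cost r p + cost r q"
| "cost r (For x y p) = 7 + r y * (cost r p + 9)"

lemma run_reg: "x \<notin> rmod p \<Longrightarrow> reg (run p s) x = reg s x"
proof (induction p arbitrary: s)
  case (For x' y p)
  have "reg (((\<lambda>s. setr x' (Suc (reg s x')) (run p s)) ^^ k) s) x = reg s x" for k s
    using For by (induction k) auto
  with For.prems show ?case by simp
qed auto

lemma run_arr: "a \<notin> amod p \<Longrightarrow> arr (run p s) a = arr s a"
proof (induction p arbitrary: s)
  case (For x' y p)
  have "arr (((\<lambda>s. setr x' (Suc (reg s x')) (run p s)) ^^ k) s) a = arr s a" for k s
    using For by (induction k) auto
  then show ?case by simp
qed auto

lemma run_out: "silent p \<Longrightarrow> out (run p s) = out s"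
proof (induction p arbitrary: s)
  case (For x' y p)
  have "out (((\<lambda>s. setr x' (Suc (reg s x')) (run p s)) ^^ k) s) = out s" for k s
    using For by (induction k) auto
  then show ?case by simp
qed auto

definition same :: "name set \<Rightarrow> name set \<Rightarrow> state \<Rightarrow> state \<Rightarrow> bool" where
  "same R A s s' \<longleftrightarrow> (\<forall>r. r \<notin> R \<longrightarrow> reg s' r = reg s r) \<and> (\<forall>a. a \<notin> A \<longrightarrow> arr s' a = arr s a)"

lemma same_reg: "same R A s s' \<Longrightarrow> r \<notin> R \<Longrightarrow> reg s' r = reg s r"
  and same_arr: "same R A s s' \<Longrightarrow> a \<notin> A \<Longrightarrow> arr s' a = arr s a"
  by (auto simp: same_def)

text \<open>The invariant rule for loops. \<open>R\<close> and \<open>A\<close> frame everything the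
  loop may change, so \<open>step\<close> may use that all other registers and arrays still have
  their values from before the loop, and the invariants need not carry them.\<close>

lemma run_For:
  assumes x: "x \<notin> rmod p" and R: "insert x (rmod p) \<subseteq> R" and A: "amod p \<subseteq> A" and y: "reg s y = M"
    and base: "I 0 (setr x 0 s)"
    and step: "\<And>i s'. i < M \<Longrightarrow> reg s' x = i \<Longrightarrow> same R A s s' \<Longrightarrow>
      I i s' \<Longrightarrow> I (Suc i) (setr x (Suc i) (run p s'))"
  shows "I M (run (For x y p) s)"
proof -
  define F where "F = (\<lambda>s. setr x (Suc (reg s x)) (run p s))"
  have F: "F t = setr x (Suc (reg t x)) (run p t)" for t by (simp add: F_def)
  have "I i ((F ^^ i) (setr x 0 s)) \<and> reg ((F ^^ i) (setr x 0 s)) x = i \<and>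
      same R A s ((F ^^ i) (setr x 0 s))" if "i \<le> M" for i
    using that
  proof (induction i)
    case 0
    with base R show ?case by (simp add: same_def)
  next
    case (Suc i)
    let ?s = "(F ^^ i) (setr x 0 s)"
    from Suc have IH: "I i ?s" "reg ?s x = i" "same R A s ?s" "i < M"
      by auto
    from step[OF IH(4,2,3,1)] have "I (Suc i) (F ?s)" by (simp add: F IH(2))
    moreover have "same R A s (F ?s)"
    proof -
      have "reg (F ?s) r = reg s r" if "r \<notin> R" for r
      proof -
        from that R have "r \<noteq> x" "r \<notin> rmod p" by auto
        with IH(3) that show ?thesis by (simp add: F run_reg same_def)
      qed
      moreover have "arr (F ?s) a = arr s a" if "a \<notin> A" for a
      proof -
        from that A have "a \<notin> amod p" by auto
        with IH(3) that show ?thesis by (simp add: F run_arr same_def)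
      qed
      ultimately show ?thesis by (simp add: same_def)
    qed
    moreover have "reg (F ?s) x = Suc i" by (simp add: F IH(2))
    moreover have "(F ^^ Suc i) (setr x 0 s) = F ?s" by simp
    ultimately show ?case by simp
  qed
  from this[of M] show ?thesis by (simp add: F_def y)
qed

lemma same_run: "rmod p \<subseteq> R \<Longrightarrow> amod p \<subseteq> A \<Longrightarrow> same R A s (run p s)"
  unfolding same_def by (auto intro!: run_reg run_arr)

lemma cost_cong: "(\<And>y. y \<in> bounds p \<Longrightarrow> r y = r' y) \<Longrightarrow> cost r p = cost r' p"
  by (induction p) auto

lemma cost_run: "bounds q \<inter> rmod p = {} \<Longrightarrow> cost (reg (run p s)) q = cost (reg s) q"
  by (rule cost_cong) (auto intro: run_reg)

text \<open>Loop bounds are never assigned, so the cost computed from the registers at the start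
  stays valid in every round and across sequencing.\<close>

lemma compile_exec:
  assumes "well_formed p"
  shows "\<exists>t\<le>cost (reg s) p. exec (compile p) s t (run p s)"
  using assms
proof (induction p arbitrary: s)
  case Nop
  then show ?case using exec.Skip by auto
next
  case (Asg x e)
  then show ?case using exec.Assign[of x e s] by (auto simp: setr_def)
next
  case (Sto a i e)
  then show ?case using exec.Store[of a i e s] by (auto simp: seta_def)
next
  case (Out e)
  then show ?case using exec.Write[of e s] by (auto simp: emit_def)
next
  case (Sq p q)
  then have wf: "well_formed p" "well_formed q" and "bounds q \<inter> rmod p = {}"
    by (auto simp: well_formed_def)
  from Sq.IH(1)[OF wf(1)] obtain t1 where t1: "t1 \<le> cost (reg s) p" "exec (compile p) s t1 (run p s)"
    by blast
  from Sq.IH(2)[OF wf(2)] obtain t2 where t2: "t2 \<le> cost (reg (run p s)) q"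
    "exec (compile q) (run p s) t2 (run q (run p s))" by blast
  have "exec (compile (p ;; q)) s (1 + t1 + t2) (run (p ;; q) s)"
    using exec.Seq[OF t1(2) t2(2)] by simp
  moreover have "1 + t1 + t2 \<le> cost (reg s) (p ;; q)"
    using t1(1) t2(1) cost_run[OF \<open>bounds q \<inter> rmod p = {}\<close>] by simp
  ultimately show ?case by blast
next
  case (Cond b p q)
  then have wf: "well_formed p" "well_formed q" by (auto simp: well_formed_def)
  from Cond.IH(1)[OF wf(1)] obtain t1 where t1: "t1 \<le> cost (reg s) p" "exec (compile p) s t1 (run p s)"
    by blast
  from Cond.IH(2)[OF wf(2)] obtain t2 where t2: "t2 \<le> cost (reg s) q" "exec (compile q) s t2 (run q s)"
    by blast
  show ?case
  proof (cases "bval b s")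
    case True
    from exec.IfTrue[OF True t1(2), of "compile q"] t1(1) True show ?thesis
      by (intro exI[of _ "1 + bcost b + t1"]) auto
  next
    case False
    from exec.IfFalse[OF False t2(2), of "compile p"] t2(1) False show ?thesis
      by (intro exI[of _ "1 + bcost b + t2"]) auto
  qed
next
  case (For x y p)
  then have wf: "well_formed p" and x: "x \<notin> rmod p" "x \<noteq> y" and y: "y \<notin> rmod p"
    and xb: "x \<notin> bounds p" and disj: "bounds p \<inter> rmod p = {}"
    by (auto simp: well_formed_def)
  define F where "F = (\<lambda>s. setr x (Suc (reg s x)) (run p s))"
  let ?W = "While (Less (V x) (V y)) (Seq (compile p) (Assign x (Plus (V x) (N 1))))"
  have loop: "\<exists>t\<le>4 + k * (cost (reg s) p + 9). exec ?W s t ((F ^^ k) s)"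
    if "reg s y = reg s x + k" for k s
    using that
  proof (induction k arbitrary: s)
    case 0
    then have "\<not> bval (Less (V x) (V y)) s" by simp
    from exec.WhileFalse[OF this, of "Seq (compile p) (Assign x (Plus (V x) (N 1)))"]
    show ?case by (intro exI[of _ 4]) (simp add: numeral_eq_Suc)
  next
    case (Suc k)
    then have b: "bval (Less (V x) (V y)) s" by simp
    from For.IH[OF wf] obtain t1 where t1: "t1 \<le> cost (reg s) p" "exec (compile p) s t1 (run p s)"
      by blast
    have "exec (Assign x (Plus (V x) (N 1))) (run p s) 4 (F s)"
      using exec.Assign[of x "Plus (V x) (N 1)" "run p s"] run_reg[OF x(1), of s]
      by (simp add: F_def setr_def numeral_eq_Suc)
    from exec.Seq[OF t1(2) this]
    have body: "exec (Seq (compile p) (Assign x (Plus (V x) (N 1)))) s (1 + t1 + 4) (F s)" .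
    have "reg (F s) y = reg (F s) x + k" using Suc.prems x y by (simp add: F_def run_reg)
    from Suc.IH[OF this] obtain t2 where t2: "t2 \<le> 4 + k * (cost (reg (F s)) p + 9)"
      "exec ?W (F s) t2 ((F ^^ k) (F s))" by blast
    have "cost (reg (F s)) p = cost (reg s) p"
      using xb disj by (intro cost_cong) (auto simp: F_def intro!: run_reg)
    with t2(1) have t2': "t2 \<le> 4 + k * (cost (reg s) p + 9)" by simp
    from exec.WhileTrue[OF b body t2(2)]
    have "exec ?W s (t1 + t2 + 9) ((F ^^ Suc k) s)"
      by (simp add: funpow_swap1 numeral_eq_Suc add.commute)
    moreover have "t1 + t2 + 9 \<le> 4 + Suc k * (cost (reg s) p + 9)" using t1(1) t2' by simp
    ultimately show ?case by blast
  qed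
  have "cost (reg (setr x 0 s)) p = cost (reg s) p" using xb by (intro cost_cong) auto
  with loop[of "setr x 0 s" "reg s y"] x(2) obtain t where
    t: "t \<le> 4 + reg s y * (cost (reg s) p + 9)" "exec ?W (setr x 0 s) t ((F ^^ reg s y) (setr x 0 s))"
    by (auto simp del: funpow.simps)
  have "exec (Assign x (N 0)) s 2 (setr x 0 s)"
    using exec.Assign[of x "N 0" s] by (simp add: setr_def numeral_eq_Suc)
  from exec.Seq[OF this t(2)] have "exec (compile (For x y p)) s (1 + 2 + t) (run (For x y p) s)"
    by (simp add: F_def)
  moreover have "1 + 2 + t \<le> cost (reg s) (For x y p)" using t(1) by simp
  ultimately show ?case by blast
qed

section \<open>Affine hulls\<close>

lemma xor3_nth [simp]: "j < length x \<Longrightarrow> xor3 x y z ! j = ((x ! j \<noteq> y ! j) \<noteq> z ! j)"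
  and length_xor3 [simp]: "length (xor3 x y z) = length x"
  by (simp_all add: xor3_def)

text \<open>Adding the pivot function \<open>L p\<close> to the functions that do not vanish at \<open>x\<close> adds to the
  zero set exactly its translate by \<open>s + x\<close>.\<close>

lemma zero_set_pivot:
  fixes L L' :: "nat \<Rightarrow> bool list \<Rightarrow> bool" and n K :: nat
  defines "Z \<equiv> {y. length y = n \<and> (\<forall>k<K. \<not> L k y)}"
    and "Z' \<equiv> {y. length y = n \<and> (\<forall>k<K. \<not> L' k y)}"
  assumes L: "\<And>k a b c. k < K \<Longrightarrow> length a = n \<Longrightarrow> length b = n \<Longrightarrow> length c = n \<Longrightarrow>
      L k (xor3 a b c) = ((L k a \<noteq> L k b) \<noteq> L k c)"
    and s: "s \<in> Z" and x: "length x = n" and p: "p < K" "L p x"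
    and L': "\<And>k y. k < K \<Longrightarrow> length y = n \<Longrightarrow> L' k y = (L k y \<noteq> (L k x \<and> L p y))"
  shows "Z' = Z \<union> (\<lambda>y. xor3 y s x) ` Z" "card Z' = 2 * card Z"
proof -
  have sn: "length s = n" "\<And>k. k < K \<Longrightarrow> \<not> L k s" using s by (auto simp: Z_def)
  have inv: "xor3 (xor3 y s x) s x = y" if "length y = n" for y
    using that sn(1) x by (auto intro!: nth_equalityI)
  have Lx: "L k (xor3 y s x) = (L k y \<noteq> L k x)" if "k < K" "length y = n" for k y
    using L[OF that sn(1) x] sn(2)[OF that(1)] by simp
  have "y \<in> (\<lambda>y. xor3 y s x) ` Z" if "y \<in> Z'" "L p y" for y
  proof (rule image_eqI)
    show "y = xor3 (xor3 y s x) s x" using inv that(1) by (simp add: Z'_def)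
    show "xor3 y s x \<in> Z" using that L' by (auto simp: Z_def Z'_def Lx)
  qed
  moreover have "y \<in> Z" if "y \<in> Z'" "\<not> L p y" for y
    using that L' by (auto simp: Z_def Z'_def)
  moreover have "y \<in> Z'" if "y \<in> Z" for y
    using that L' p by (auto simp: Z_def Z'_def)
  moreover have "xor3 y s x \<in> Z'" if "y \<in> Z" for y
    using that L' p by (auto simp: Z_def Z'_def Lx)
  ultimately show eq: "Z' = Z \<union> (\<lambda>y. xor3 y s x) ` Z" by blast
  have "finite {y :: bool list. length y = n}"
    using finite_lists_length_eq[of "UNIV :: bool set" n] by simp
  then have fin: "finite Z" by (rule finite_subset[rotated]) (auto simp: Z_def)
  have "Z \<inter> (\<lambda>y. xor3 y s x) ` Z = {}"
  proof -
    have "\<not> L p y \<and> L p (xor3 y s x)" if "y \<in> Z" for y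
      using that p Lx[OF p(1), of y] by (simp add: Z_def)
    then show ?thesis by blast
  qed
  moreover have "inj_on (\<lambda>y. xor3 y s x) Z"
    by (rule inj_on_inverseI[of _ "\<lambda>y. xor3 y s x"]) (simp add: inv Z_def)
  ultimately show "card Z' = 2 * card Z"
    unfolding eq using fin by (simp add: card_Un_disjoint card_image)
qed

lemma odd_sum_xor:
  fixes n :: nat
  assumes "\<And>j. j < n \<Longrightarrow> odd (h' j) = (odd (h j) \<noteq> odd (g j))"
  shows "odd (\<Sum>j<n. h' j :: nat) = (odd (\<Sum>j<n. h j :: nat) \<noteq> odd (\<Sum>j<n. g j :: nat))"
  using assms by (induction n) auto

section \<open>Address tables and the layout of the input\<close>

definition table_prog :: "name \<Rightarrow> name \<Rightarrow> name \<Rightarrow> prog" where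
  "table_prog a y z =
     (Asg ''p'' (N 0) ;;
      For ''i'' y (Sto a (V ''i'') (V ''p'') ;; Asg ''p'' (Plus (V ''p'') (V z))))"

text \<open>The machine has no multiplication. Multiples of the row length are therefore tabulated
  once by repeated addition, after which a matrix cell is accessed in constant time.\<close>

lemma table_prog:
  assumes s: "reg s y = M" "reg s z = c" and z: "z \<notin> {''i'', ''p''}" "y \<notin> {''i'', ''p''}" and k: "k < M"
  shows "arr (run (table_prog a y z) s) a k = k * c"
proof -
  let ?s = "setr ''p'' 0 s"
  let ?p = "Sto a (V ''i'') (V ''p'') ;; Asg ''p'' (Plus (V ''p'') (V z))"
  let ?I = "\<lambda>i s. reg s ''p'' = i * c \<and> (\<forall>k<i. arr s a k = k * c)"
  have "?I M (run (For ''i'' y ?p) ?s)"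
  proof (rule run_For[where I = ?I and R = "{''i'', ''p''}" and A = "{a}"])
    fix i s' assume "i < M" "reg s' ''i'' = i" "same {''i'', ''p''} {a} ?s s'" "?I i s'"
    moreover have "reg s' z = c" using calculation(3) s z by (auto simp: same_def)
    ultimately show "?I (Suc i) (setr ''i'' (Suc i) (run ?p s'))" by (auto simp: less_Suc_eq)
  qed (use s z in auto)
  with k show ?thesis by (simp add: table_prog_def del: run.simps(7))
qed

text \<open>Literal codes run from 1 to 2n, and 0 codes no literal, so 2n + 1 indices are needed.
  The one table of multiples of this width addresses both the adjacency matrix \<open>''A''\<close>
  and the coefficient matrix \<open>''h''\<close>, which fills only n columns.\<close>

definition width_prog :: prog where
  "width_prog = Asg ''w'' (Plus (Plus (V ''n'') (V ''n'')) (N 1))"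

definition tables_prog :: prog where
  "tables_prog = (table_prog ''R'' ''size'' ''n'' ;; table_prog ''T'' ''w'' ''w'')"

locale ram_input =
  fixes n :: nat and D :: "bool list set" and xs :: "bool list list"
  assumes n: "1 \<le> n" and D: "domain n D" and xs: "distinct xs" "set xs = D"
begin

definition m :: nat where "m = length xs"
definition w :: nat where "w = 2 * n + 1"

lemma card_D: "card D = m"
  using xs by (auto simp: m_def distinct_card)

lemma length_D: "x \<in> D \<Longrightarrow> length x = n"
  using D by (simp add: domain_def)

lemma row_in_D: "i < m \<Longrightarrow> xs ! i \<in> D"
  using xs by (auto simp: m_def)

lemma length_row: "i < m \<Longrightarrow> length (xs ! i) = n"
  by (intro length_D row_in_D)

lemma in_D_row: "x \<in> D \<Longrightarrow> \<exists>i<m. xs ! i = x"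
  using xs by (auto simp: m_def in_set_conv_nth)

lemma m_pos: "1 \<le> m"
proof -
  have "(\<lambda>x. x ! 0) ` D = {False, True}" using n D by (simp add: domain_def)
  then have "D \<noteq> {}" by blast
  with xs have "xs \<noteq> []" by auto
  then show ?thesis by (simp add: m_def Suc_le_eq)
qed

text \<open>The part of the memory that is fixed once the tables are filled; every later program
  preserves it by its frame alone.\<close>

definition base :: "state \<Rightarrow> bool" where
  "base s \<longleftrightarrow> reg s ''n'' = n \<and> reg s ''size'' = m \<and> reg s ''w'' = w \<and>
     (\<forall>i<m. \<forall>t<n. arr s ''in'' (i * n + t) = of_bool (xs ! i ! t)) \<and>
     (\<forall>i<m. arr s ''R'' i = i * n) \<and> (\<forall>u<w. arr s ''T'' u = u * w)"

lemma base_simps: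
  assumes "base s"
  shows "reg s ''n'' = n" "reg s ''size'' = m" "reg s ''w'' = w"
    "\<And>i t. i < m \<Longrightarrow> t < n \<Longrightarrow> arr s ''in'' (i * n + t) = of_bool (xs ! i ! t)"
    "\<And>i. i < m \<Longrightarrow> arr s ''R'' i = i * n" "\<And>u. u < w \<Longrightarrow> arr s ''T'' u = u * w"
  using assms by (auto simp: base_def)

lemma base_cong:
  assumes "base s" "same R A s s'" "R \<inter> {''n'', ''size'', ''w''} = {}" "A \<inter> {''in'', ''R'', ''T''} = {}"
  shows "base s'"
  using assms unfolding base_def same_def by auto

lemma concat_rows: "i < length ys \<Longrightarrow> (\<And>y. y \<in> set ys \<Longrightarrow> length y = n) \<Longrightarrow> t < n \<Longrightarrow>
  i * n + t < length (concat ys) \<and> concat ys ! (i * n + t) = ys ! i ! t"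
proof (induction ys arbitrary: i)
  case (Cons y ys)
  show ?case
  proof (cases i)
    case 0
    with Cons.prems show ?thesis by (auto simp: nth_append)
  next
    case (Suc i')
    with Cons.prems Cons.IH[of i'] show ?thesis by (auto simp: nth_append)
  qed
qed simp

lemma tables_base: "base (run tables_prog (run width_prog (initial_state n xs)))"
proof -
  let ?s0 = "run width_prog (initial_state n xs)"
  have s0: "reg ?s0 ''n'' = n" "reg ?s0 ''size'' = m" "reg ?s0 ''w'' = w"
    and s0_in: "\<And>i t. i < m \<Longrightarrow> t < n \<Longrightarrow> arr ?s0 ''in'' (i * n + t) = of_bool (xs ! i ! t)"
    using concat_rows[of _ xs] length_D xs
    by (auto simp: initial_state_def m_def w_def width_prog_def)
  let ?s1 = "run (table_prog ''R'' ''size'' ''n'') ?s0"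
  let ?s2 = "run (table_prog ''T'' ''w'' ''w'') ?s1"
  have s1: "same {''i'', ''p''} {''R''} ?s0 ?s1" and s2: "same {''i'', ''p''} {''T''} ?s1 ?s2"
    by (rule same_run; simp add: table_prog_def)+
  have "arr ?s1 ''R'' k = k * n" if "k < m" for k
    using s0 that by (intro table_prog) auto
  moreover have "arr ?s2 ''T'' k = k * w" if "k < w" for k
    using s0 that same_reg[OF s1] by (intro table_prog) auto
  ultimately show ?thesis
    unfolding base_def tables_prog_def using s0 s0_in
    by (simp add: same_reg[OF s1] same_reg[OF s2] same_arr[OF s1] same_arr[OF s2])
qed

end

abbreviation cell :: "name \<Rightarrow> name \<Rightarrow> name \<Rightarrow> name \<Rightarrow> aexp" where
  "cell a tab i j \<equiv> Sel a (Plus (Sel tab (V i)) (V j))"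

lemma row_index_inj:
  assumes "j < c" "j' < c" "k * c + j = k' * c + j'"
  shows "k = k' \<and> j = (j' :: nat)"
proof -
  have "(k * c + j) div c = k" "(k' * c + j') div c = k'" using assms(1,2) by auto
  with assms(3) show ?thesis by auto
qed

text \<open>Row \<open>k\<close> of \<open>h\<close> and entry \<open>k\<close> of \<open>c\<close> are the coefficients and the constant of an affine function
  over the two-element field, \<open>q\<close> is the size of the common zero set of these functions, and \<open>p\<close> is
  the pivot, or \<open>n\<close> if all functions vanish at the current row. Adding a copy \<open>g\<close>, \<open>d\<close> of the pivot
  function also to itself makes it zero.\<close>

definition aff_eval_prog :: prog where
  "aff_eval_prog =
     (Asg ''e'' (Sel ''c'' (V ''k'')) ;;
      For ''j'' ''n''
        (Cond (And (Eq (cell ''h'' ''T'' ''k'' ''j'') (N 1)) (Eq (cell ''in'' ''R'' ''i'' ''j'') (N 1)))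
          (Asg ''e'' (Minus (N 1) (V ''e''))) Nop))"

definition aff_find_prog :: prog where
  "aff_find_prog =
     (Asg ''p'' (V ''n'') ;;
      For ''k'' ''n''
        (aff_eval_prog ;; Sto ''v'' (V ''k'') (V ''e'') ;;
         Cond (Eq (V ''e'') (N 1)) (Asg ''p'' (V ''k'')) Nop))"

definition aff_copy_prog :: prog where
  "aff_copy_prog =
     (For ''j'' ''n'' (Sto ''g'' (V ''j'') (cell ''h'' ''T'' ''p'' ''j'')) ;;
      Asg ''d'' (Sel ''c'' (V ''p'')))"

definition aff_row_prog :: prog where
  "aff_row_prog =
     For ''j'' ''n''
       (Cond (Eq (Sel ''g'' (V ''j'')) (N 1))
         (Sto ''h'' (Plus (Sel ''T'' (V ''k'')) (V ''j'')) (Minus (N 1) (cell ''h'' ''T'' ''k'' ''j''))) Nop)"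

definition aff_add_prog :: prog where
  "aff_add_prog =
     For ''k'' ''n''
       (Cond (Eq (Sel ''v'' (V ''k'')) (N 1))
         (aff_row_prog ;;
          Cond (Eq (V ''d'') (N 1)) (Sto ''c'' (V ''k'') (Minus (N 1) (Sel ''c'' (V ''k'')))) Nop)
         Nop)"

text \<open>A pivot below \<open>n\<close> exists exactly if the row is not yet a common zero.
  Adding it to the functions doubles the zero set, so its size \<open>''q''\<close> is maintained by
  one addition.\<close>

definition aff_step_prog :: prog where
  "aff_step_prog =
     (aff_find_prog ;;
      Cond (Less (V ''p'') (V ''n''))
        (Asg ''q'' (Plus (V ''q'') (V ''q'')) ;; aff_copy_prog ;; aff_add_prog) Nop)"

definition aff_init_prog :: prog where
  "aff_init_prog =
     For ''k'' ''n''
       (Sto ''h'' (Plus (Sel ''T'' (V ''k'')) (V ''k'')) (N 1) ;;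
        Sto ''c'' (V ''k'') (Sel ''in'' (V ''k'')))"

definition affine_prog :: prog where
  "affine_prog = (aff_init_prog ;; Asg ''q'' (N 1) ;; For ''i'' ''size'' aff_step_prog)"

lemmas aff_defs = aff_eval_prog_def aff_find_prog_def aff_copy_prog_def aff_row_prog_def
  aff_add_prog_def aff_step_prog_def aff_init_prog_def affine_prog_def

section \<open>Correctness of the affine hull\<close>

context ram_input
begin

definition bits :: "state \<Rightarrow> bool" where
  "bits s \<longleftrightarrow> (\<forall>k<n. arr s ''c'' k \<le> 1 \<and> (\<forall>j<n. arr s ''h'' (k * w + j) \<le> 1))"

definition affval :: "state \<Rightarrow> nat \<Rightarrow> bool list \<Rightarrow> bool" where
  "affval s k y \<longleftrightarrow> odd (arr s ''c'' k + (\<Sum>j<n. arr s ''h'' (k * w + j) * of_bool (y ! j)))"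

definition zeros :: "state \<Rightarrow> bool list set" where
  "zeros s = {y. length y = n \<and> (\<forall>k<n. \<not> affval s k y)}"

lemma affval_xor3:
  assumes "length x = n" "length y = n" "length z = n"
  shows "affval s k (xor3 x y z) = ((affval s k x \<noteq> affval s k y) \<noteq> affval s k z)"
proof -
  let ?h = "\<lambda>j. arr s ''h'' (k * w + j)"
  have "odd (\<Sum>j<n. ?h j * of_bool (xor3 x y z ! j)) =
      (odd (\<Sum>j<n. ?h j * of_bool (x ! j)) \<noteq> odd (\<Sum>j<n. ?h j * of_bool (y ! j) + ?h j * of_bool (z ! j)))"
    by (rule odd_sum_xor) (use assms in auto)
  also have "odd (\<Sum>j<n. ?h j * of_bool (y ! j) + ?h j * of_bool (z ! j)) =
      (odd (\<Sum>j<n. ?h j * of_bool (y ! j)) \<noteq> odd (\<Sum>j<n. ?h j * of_bool (z ! j)))"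
    by (rule odd_sum_xor) auto
  finally show ?thesis by (auto simp: affval_def)
qed

lemma affval_same:
  assumes "arr s' ''h'' = arr s ''h''" "arr s' ''c'' = arr s ''c''"
  shows "affval s' = affval s" "zeros s' = zeros s" "bits s' = bits s"
  using assms by (auto simp: affval_def zeros_def bits_def fun_eq_iff)

lemma idx_w: "j < n \<Longrightarrow> j' < n \<Longrightarrow> k * w + j = k' * w + j' \<longleftrightarrow> k = k' \<and> j = j'"
  using row_index_inj[of j w j' k k'] by (auto simp: w_def)

lemma aff_eval:
  assumes b: "base s" and bits: "bits s" and k: "reg s ''k'' = k" "k < n" and i: "reg s ''i'' = i" "i < m"
  shows "reg (run aff_eval_prog s) ''e'' = of_bool (affval s k (xs ! i))"
proof -
  let ?s = "setr ''e'' (arr s ''c'' k) s"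
  let ?p = "Cond (And (Eq (cell ''h'' ''T'' ''k'' ''j'') (N 1)) (Eq (cell ''in'' ''R'' ''i'' ''j'') (N 1)))
          (Asg ''e'' (Minus (N 1) (V ''e''))) Nop"
  let ?I = "\<lambda>j s'. reg s' ''e'' = of_bool (odd (arr s ''c'' k + (\<Sum>j<j. arr s ''h'' (k * w + j) * of_bool (xs ! i ! j))))"
  have "?I n (run (For ''j'' ''n'' ?p) ?s)"
  proof (rule run_For[where I = ?I and R = "{''j'', ''e''}" and A = "{}"])
    fix j s' assume j: "j < n" "reg s' ''j'' = j" and sm: "same {''j'', ''e''} {} ?s s'" and I: "?I j s'"
    have "base s'" by (rule base_cong[of ?s, OF _ sm]) (use b in \<open>auto simp: base_def\<close>)
    note bs = base_simps[OF this]
    have "arr s' ''h'' = arr s ''h''" "reg s' ''k'' = k" "reg s' ''i'' = i"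
      using same_arr[OF sm, of "''h''"] same_reg[OF sm, of "''k''"] same_reg[OF sm, of "''i''"] k i by auto
    moreover have "arr s ''h'' (k * w + j) = 0 \<or> arr s ''h'' (k * w + j) = 1"
      using bits k j unfolding bits_def by (meson less_one order_le_less)
    ultimately show "?I (Suc j) (setr ''j'' (Suc j) (run ?p s'))"
      using I j k i by (auto simp: bs w_def)
  qed (use b bits k in \<open>auto simp: base_def bits_def le_Suc_eq\<close>)
  then show ?thesis using k by (simp add: aff_eval_prog_def affval_def del: run.simps(7))
qed

lemma aff_find:
  assumes b: "base s" and bits: "bits s" and i: "reg s ''i'' = i" "i < m"
  defines "s' \<equiv> run aff_find_prog s"
  shows "\<forall>k<n. arr s' ''v'' k = of_bool (affval s k (xs ! i))"
    "(reg s' ''p'' = n \<and> (\<forall>k<n. \<not> affval s k (xs ! i))) \<or>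
     (reg s' ''p'' < n \<and> affval s (reg s' ''p'') (xs ! i))"
proof -
  let ?s = "setr ''p'' n s"
  let ?p = "aff_eval_prog ;; Sto ''v'' (V ''k'') (V ''e'') ;; Cond (Eq (V ''e'') (N 1)) (Asg ''p'' (V ''k'')) Nop"
  let ?I = "\<lambda>k s'. (\<forall>k'<k. arr s' ''v'' k' = of_bool (affval s k' (xs ! i))) \<and>
    ((reg s' ''p'' = n \<and> (\<forall>k'<k. \<not> affval s k' (xs ! i))) \<or>
     (reg s' ''p'' < n \<and> affval s (reg s' ''p'') (xs ! i)))"
  let ?R = "{''k'', ''e'', ''j'', ''p''}"
  have "?I n (run (For ''k'' ''n'' ?p) ?s)"
  proof (rule run_For[where I = ?I and R = ?R and A = "{''v''}"])
    fix k s' assume k: "k < n" "reg s' ''k'' = k" and sm: "same ?R {''v''} ?s s'" and I: "?I k s'"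
    have b': "base s'" by (rule base_cong[of ?s, OF _ sm]) (use b in \<open>auto simp: base_def\<close>)
    have eq: "arr s' ''h'' = arr s ''h''" "arr s' ''c'' = arr s ''c''" "reg s' ''i'' = i"
      using same_arr[OF sm, of "''h''"] same_arr[OF sm, of "''c''"] same_reg[OF sm, of "''i''"] i by auto
    have "bits s'" using bits affval_same(3)[OF eq(1,2)] by simp
    from aff_eval[OF b' this k(2,1) eq(3) i(2)]
    have e: "reg (run aff_eval_prog s') ''e'' = of_bool (affval s k (xs ! i))"
      using affval_same(1)[OF eq(1,2)] by simp
    have "same {''e'', ''j''} {} s' (run aff_eval_prog s')"
      by (rule same_run) (simp_all add: aff_eval_prog_def)
    note sm' = same_reg[OF this] same_arr[OF this]
    show "?I (Suc k) (setr ''k'' (Suc k) (run ?p s'))"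
      using I e k by (auto simp: sm' less_Suc_eq split: if_splits)
  qed (use b in \<open>auto simp: base_def aff_eval_prog_def\<close>)
  then show "\<forall>k<n. arr s' ''v'' k = of_bool (affval s k (xs ! i))"
    "(reg s' ''p'' = n \<and> (\<forall>k<n. \<not> affval s k (xs ! i))) \<or>
     (reg s' ''p'' < n \<and> affval s (reg s' ''p'') (xs ! i))"
    using b by (simp_all add: s'_def aff_find_prog_def base_def del: run.simps(7))
qed

lemma aff_copy:
  assumes b: "base s" and p: "reg s ''p'' = p" "p < n"
  defines "s' \<equiv> run aff_copy_prog s"
  shows "\<forall>j<n. arr s' ''g'' j = arr s ''h'' (p * w + j)" "reg s' ''d'' = arr s ''c'' p"
proof -
  let ?p = "Sto ''g'' (V ''j'') (cell ''h'' ''T'' ''p'' ''j'')"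
  let ?I = "\<lambda>j s'. \<forall>j'<j. arr s' ''g'' j' = arr s ''h'' (p * w + j')"
  let ?s = "run (For ''j'' ''n'' ?p) s"
  have "?I n ?s"
  proof (rule run_For[where I = ?I and R = "{''j''}" and A = "{''g''}"])
    fix j s' assume j: "j < n" "reg s' ''j'' = j" and sm: "same {''j''} {''g''} s s'" and I: "?I j s'"
    have b': "base s'" by (rule base_cong[OF b sm]) auto
    note bs = base_simps[OF this]
    have "arr s' ''h'' = arr s ''h''" "reg s' ''p'' = p"
      using same_arr[OF sm, of "''h''"] same_reg[OF sm, of "''p''"] p by auto
    then show "?I (Suc j) (setr ''j'' (Suc j) (run ?p s'))"
      using I j p by (auto simp: bs w_def less_Suc_eq)
  qed (use b in \<open>auto simp: base_def\<close>)
  moreover have "same {''j''} {''g''} s ?s" by (rule same_run) simp_all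
  note same_reg[OF this] same_arr[OF this]
  ultimately show "\<forall>j<n. arr s' ''g'' j = arr s ''h'' (p * w + j)" "reg s' ''d'' = arr s ''c'' p"
    using p by (simp_all add: s'_def aff_copy_prog_def del: run.simps(7))
qed

lemma aff_row:
  assumes b: "base s" and k: "reg s ''k'' = k" "k < n"
  shows "arr (run aff_row_prog s) ''h'' =
    (\<lambda>q. if \<exists>j<n. q = k * w + j \<and> arr s ''g'' j = 1 then 1 - arr s ''h'' q else arr s ''h'' q)"
proof -
  let ?p = "Cond (Eq (Sel ''g'' (V ''j'')) (N 1))
         (Sto ''h'' (Plus (Sel ''T'' (V ''k'')) (V ''j'')) (Minus (N 1) (cell ''h'' ''T'' ''k'' ''j''))) Nop"
  let ?I = "\<lambda>j s'. arr s' ''h'' =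
    (\<lambda>q. if \<exists>j'<j. q = k * w + j' \<and> arr s ''g'' j' = 1 then 1 - arr s ''h'' q else arr s ''h'' q)"
  have "?I n (run (For ''j'' ''n'' ?p) s)"
  proof (rule run_For[where I = ?I and R = "{''j''}" and A = "{''h''}"])
    fix j s' assume j: "j < n" "reg s' ''j'' = j" and sm: "same {''j''} {''h''} s s'" and I: "?I j s'"
    have b': "base s'" by (rule base_cong[OF b sm]) auto
    note bs = base_simps[OF this]
    have "arr s' ''g'' = arr s ''g''" "reg s' ''k'' = k"
      using same_arr[OF sm, of "''g''"] same_reg[OF sm, of "''k''"] k by auto
    then show "?I (Suc j) (setr ''j'' (Suc j) (run ?p s'))"
      using I j k by (auto simp: bs w_def less_Suc_eq fun_eq_iff)
  qed (use b in \<open>auto simp: base_def\<close>)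
  then show ?thesis by (simp only: aff_row_prog_def)
qed

lemma aff_add:
  assumes b: "base s"
  defines "s' \<equiv> run aff_add_prog s"
  shows "\<forall>k<n. \<forall>j<n. arr s' ''h'' (k * w + j) =
      (if arr s ''v'' k = 1 \<and> arr s ''g'' j = 1 then 1 - arr s ''h'' (k * w + j) else arr s ''h'' (k * w + j))"
    "\<forall>k<n. arr s' ''c'' k =
      (if arr s ''v'' k = 1 \<and> reg s ''d'' = 1 then 1 - arr s ''c'' k else arr s ''c'' k)"
proof -
  let ?p = "Cond (Eq (Sel ''v'' (V ''k'')) (N 1))
         (aff_row_prog ;;
          Cond (Eq (V ''d'') (N 1)) (Sto ''c'' (V ''k'') (Minus (N 1) (Sel ''c'' (V ''k'')))) Nop)
         Nop"
  let ?I = "\<lambda>k s'. (\<forall>k'<n. \<forall>j<n. arr s' ''h'' (k' * w + j) =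
      (if k' < k \<and> arr s ''v'' k' = 1 \<and> arr s ''g'' j = 1 then 1 - arr s ''h'' (k' * w + j) else arr s ''h'' (k' * w + j))) \<and>
    (\<forall>k'<n. arr s' ''c'' k' =
      (if k' < k \<and> arr s ''v'' k' = 1 \<and> reg s ''d'' = 1 then 1 - arr s ''c'' k' else arr s ''c'' k'))"
  have "?I n (run (For ''k'' ''n'' ?p) s)"
  proof (rule run_For[where I = ?I and R = "{''k'', ''j''}" and A = "{''h'', ''c''}"])
    fix k s' assume k: "k < n" "reg s' ''k'' = k" and sm: "same {''k'', ''j''} {''h'', ''c''} s s'" and I: "?I k s'"
    have b': "base s'" by (rule base_cong[OF b sm]) auto
    have eq: "arr s' ''g'' = arr s ''g''" "arr s' ''v'' = arr s ''v''" "reg s' ''d'' = reg s ''d''"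
      using same_arr[OF sm, of "''g''"] same_arr[OF sm, of "''v''"] same_reg[OF sm, of "''d''"] by auto
    have row: "arr (run aff_row_prog s') ''h'' (k' * w + j) =
        (if k' = k \<and> arr s ''g'' j = 1 then 1 - arr s' ''h'' (k' * w + j) else arr s' ''h'' (k' * w + j))"
      if "j < n" for k' j
      unfolding aff_row[OF b' k(2,1)] using that by (auto simp: idx_w eq)
    have "same {''j''} {''h''} s' (run aff_row_prog s')"
      by (rule same_run) (simp_all add: aff_row_prog_def)
    note sm' = same_reg[OF this] same_arr[OF this]
    show "?I (Suc k) (setr ''k'' (Suc k) (run ?p s'))"
      using I k by (auto simp: sm' row eq less_Suc_eq)
  qed (use b in \<open>auto simp: base_def aff_row_prog_def\<close>)
  then show "\<forall>k<n. \<forall>j<n. arr s' ''h'' (k * w + j) =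
      (if arr s ''v'' k = 1 \<and> arr s ''g'' j = 1 then 1 - arr s ''h'' (k * w + j) else arr s ''h'' (k * w + j))"
    "\<forall>k<n. arr s' ''c'' k =
      (if arr s ''v'' k = 1 \<and> reg s ''d'' = 1 then 1 - arr s ''c'' k else arr s ''c'' k)"
    unfolding s'_def aff_add_prog_def by simp_all
qed

text \<open>The last conjunct bounds the zero set by every closed superset of all of
  \<open>D\<close>, not of the first \<open>i\<close> rows only; this is enough for the final
  comparison with \<open>D\<close>. Row 0 is listed apart because it is the base point of all
  translations, already at \<open>i = 0\<close>.\<close>

definition aff_inv :: "nat \<Rightarrow> state \<Rightarrow> bool" where
  "aff_inv i s \<longleftrightarrow> base s \<and> bits s \<and> xs ! 0 \<in> zeros s \<and> (\<forall>k<i. xs ! k \<in> zeros s) \<and>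
     card (zeros s) = reg s ''q'' \<and>
     (\<forall>E. xor3_closed E \<and> D \<subseteq> E \<longrightarrow> zeros s \<subseteq> E)"

lemma aff_inv_cong:
  assumes "aff_inv i s" "same R A s s'" "R \<inter> {''n'', ''size'', ''w'', ''q''} = {}"
    "A \<inter> {''in'', ''R'', ''T'', ''h'', ''c''} = {}"
  shows "aff_inv i s'"
proof -
  have "arr s' ''h'' = arr s ''h''" "arr s' ''c'' = arr s ''c''" "reg s' ''q'' = reg s ''q''"
    using assms by (auto simp: same_def)
  moreover have "base s'" using base_cong[OF _ assms(2)] assms by (auto simp: aff_inv_def)
  ultimately show ?thesis using assms(1) affval_same[of s' s] by (simp add: aff_inv_def)
qed

lemma aff_step:
  assumes I: "aff_inv i s" and i: "reg s ''i'' = i" "i < m"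
  shows "aff_inv (Suc i) (run aff_step_prog s)"
proof -
  from I have b: "base s" and bits: "bits s" and I0: "xs ! 0 \<in> zeros s" "\<forall>k<i. xs ! k \<in> zeros s"
    and q: "card (zeros s) = reg s ''q''" and hull: "\<And>E. xor3_closed E \<Longrightarrow> D \<subseteq> E \<Longrightarrow> zeros s \<subseteq> E"
    by (auto simp: aff_inv_def)
  let ?x = "xs ! i"
  have x: "length ?x = n" "?x \<in> D" using i length_row row_in_D by auto
  let ?s1 = "run aff_find_prog s"
  have sm1: "same {''k'', ''e'', ''j'', ''p''} {''v''} s ?s1"
    by (rule same_run) (simp_all add: aff_find_prog_def aff_eval_prog_def)
  have I1: "aff_inv i ?s1" by (rule aff_inv_cong[OF I sm1]) auto
  have z1: "zeros ?s1 = zeros s" "affval ?s1 = affval s"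
    using affval_same[of ?s1 s] same_arr[OF sm1] by auto
  note find = aff_find[OF b bits i]
  show ?thesis
  proof (cases "reg ?s1 ''p'' < n")
    case False
    then have "?x \<in> zeros s" using find(2) x by (auto simp: zeros_def)
    then have "aff_inv (Suc i) ?s1" using I1 z1 by (auto simp: aff_inv_def less_Suc_eq)
    then show ?thesis using False base_simps(1)[of ?s1] I1 by (simp add: aff_step_prog_def aff_inv_def)
  next
    case True
    let ?p = "reg ?s1 ''p''"
    let ?s2 = "setr ''q'' (2 * reg s ''q'') ?s1"
    let ?s3 = "run aff_copy_prog ?s2"
    let ?s4 = "run aff_add_prog ?s3"
    have b2: "base ?s2" using I1 by (auto simp: aff_inv_def base_def)
    have sm3: "same {''j'', ''d''} {''g''} ?s2 ?s3" by (rule same_run) (simp_all add: aff_copy_prog_def)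
    have b3: "base ?s3" by (rule base_cong[OF b2 sm3]) auto
    have sm4: "same {''k'', ''j''} {''h'', ''c''} ?s3 ?s4"
      by (rule same_run) (simp_all add: aff_add_prog_def aff_row_prog_def)
    have b4: "base ?s4" by (rule base_cong[OF b3 sm4]) auto
    have run: "run aff_step_prog s = ?s4"
      using True base_simps(1)[of ?s1] I1 same_reg[OF sm1, of "''q''"]
      by (simp add: aff_step_prog_def aff_inv_def mult_2)
    note copy = aff_copy[OF b2 _ True, simplified]
    have h3: "arr ?s3 ''h'' = arr s ''h''" "arr ?s3 ''c'' = arr s ''c''" "arr ?s3 ''v'' = arr ?s1 ''v''"
      using same_arr[OF sm3] same_arr[OF sm1] by auto
    have h4: "arr ?s4 ''h'' (k * w + j) =
        (if affval s k ?x \<and> arr s ''h'' (?p * w + j) = 1 then 1 - arr s ''h'' (k * w + j) else arr s ''h'' (k * w + j))"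
      if "k < n" "j < n" for k j
      using aff_add(1)[OF b3] that find(1) copy(1) h3 same_arr[OF sm1] by simp
    have c4: "arr ?s4 ''c'' k = (if affval s k ?x \<and> arr s ''c'' ?p = 1 then 1 - arr s ''c'' k else arr s ''c'' k)"
      if "k < n" for k
      using aff_add(2)[OF b3] that find(1) copy(2) h3 same_arr[OF sm1] by simp
    have bit: "arr s ''c'' k = 0 \<or> arr s ''c'' k = 1" "arr s ''h'' (k * w + j) = 0 \<or> arr s ''h'' (k * w + j) = 1"
      if "k < n" "j < n" for k j
      using bits that unfolding bits_def by (meson less_one order_le_less)+
    have L': "affval ?s4 k y = (affval s k y \<noteq> (affval s k ?x \<and> affval s ?p y))" if "k < n" "length y = n" for k y
    proof -
      have "odd (\<Sum>j<n. arr ?s4 ''h'' (k * w + j) * of_bool (y ! j)) =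
        (odd (\<Sum>j<n. arr s ''h'' (k * w + j) * of_bool (y ! j)) \<noteq>
         odd (\<Sum>j<n. (if affval s k ?x then arr s ''h'' (?p * w + j) * of_bool (y ! j) else 0)))"
      proof (rule odd_sum_xor)
        fix j assume "j < n"
        then show "odd (arr ?s4 ''h'' (k * w + j) * of_bool (y ! j)) =
         (odd (arr s ''h'' (k * w + j) * of_bool (y ! j)) \<noteq>
          odd (if affval s k ?x then arr s ''h'' (?p * w + j) * of_bool (y ! j) else 0))"
          using bit(2)[OF \<open>k < n\<close> \<open>j < n\<close>] bit(2)[OF True \<open>j < n\<close>] that by (auto simp: h4)
      qed
      also have "odd (\<Sum>j<n. (if affval s k ?x then arr s ''h'' (?p * w + j) * of_bool (y ! j) else 0)) =
          (affval s k ?x \<and> odd (\<Sum>j<n. arr s ''h'' (?p * w + j) * of_bool (y ! j)))"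
        by (cases "affval s k ?x") simp_all
      finally have h: "odd (\<Sum>j<n. arr ?s4 ''h'' (k * w + j) * of_bool (y ! j)) =
        (odd (\<Sum>j<n. arr s ''h'' (k * w + j) * of_bool (y ! j)) \<noteq>
          (affval s k ?x \<and> odd (\<Sum>j<n. arr s ''h'' (?p * w + j) * of_bool (y ! j))))" .
      have c: "odd (arr ?s4 ''c'' k) = (odd (arr s ''c'' k) \<noteq> (affval s k ?x \<and> odd (arr s ''c'' ?p)))"
        using bit(1)[OF \<open>k < n\<close> \<open>k < n\<close>] bit(1)[OF True \<open>k < n\<close>] unfolding c4[OF that(1)] by auto
      show ?thesis
        unfolding affval_def[of ?s4] affval_def[of s k y] affval_def[of s ?p y] odd_add h c by argo
    qed
    have px: "affval s ?p ?x" using find(2) True by auto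
    \<comment> \<open>Row 0 serves as the base point. New zeros are sums of an old zero, row 0 and
      row \<open>i\<close>, hence they remain in any closed superset of \<open>D\<close>.\<close>
    have Z: "zeros ?s4 = zeros s \<union> (\<lambda>y. xor3 y (xs ! 0) ?x) ` zeros s"
      and cardZ: "card (zeros ?s4) = 2 * card (zeros s)"
      unfolding zeros_def
      by (rule zero_set_pivot; use I0(1) x(1) True px L' affval_xor3 in \<open>simp add: zeros_def\<close>)+
    have "bits ?s4" using bits h4 c4 by (auto simp: bits_def)
    moreover have "?x \<in> zeros ?s4" using L' x px by (simp add: zeros_def)
    moreover have "reg ?s4 ''q'' = 2 * reg s ''q''" using same_reg[OF sm4] same_reg[OF sm3] by simp
    moreover have "zeros ?s4 \<subseteq> E" if "xor3_closed E" "D \<subseteq> E" for E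
      using hull[OF that] that x(2) I0(1) unfolding Z xor3_closed_def by blast
    ultimately show ?thesis
      unfolding run aff_inv_def using b4 q cardZ I0 Z by (auto simp: less_Suc_eq)
  qed
qed

end

section \<open>The affine hull as a system of exclusive disjunctions\<close>

definition xnf_row_prog :: prog where
  "xnf_row_prog =
     For ''j'' ''n''
       (Cond (Eq (cell ''h'' ''T'' ''k'' ''j'') (N 1)) (Out (Plus (Plus (V ''j'') (V ''j'')) (N 2))) Nop)"

definition xnf_prog :: prog where
  "xnf_prog =
     (Out (N 2) ;;
      For ''k'' ''n''
        (xnf_row_prog ;;
         Cond (Eq (Sel ''c'' (V ''k'')) (N 0)) (Out (N 2) ;; Out (N 1)) Nop ;;
         Out (N 0)))"

lemma length_filter_upt:
  "length (filter P (map f (filter Q [0..<n]))) = (\<Sum>j<n. of_bool (Q j \<and> P (f j)))"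
  by (induction n) auto

lemma encode_clauses_snoc: "encode_clauses (cs @ [c]) = encode_clauses cs @ map encode_literal c @ [0]"
  by (simp add: encode_clauses_def)

context ram_input
begin

text \<open>The initial functions are the differences between coordinate \<open>k\<close> and its
  value in row 0. Their only common zero is row 0, hence size 1. Only the diagonal of
  \<open>''h''\<close> is written, so the array must start out zero.\<close>

lemma aff_init:
  assumes b: "base s" and h: "arr s ''h'' = (\<lambda>_. 0)"
  shows "aff_inv 0 (run (aff_init_prog ;; Asg ''q'' (N 1)) s)"
proof -
  let ?p = "Sto ''h'' (Plus (Sel ''T'' (V ''k'')) (V ''k'')) (N 1) ;; Sto ''c'' (V ''k'') (Sel ''in'' (V ''k''))"
  let ?s = "run (For ''k'' ''n'' ?p) s"
  let ?I = "\<lambda>k s'. (\<forall>k'<n. \<forall>j<n. arr s' ''h'' (k' * w + j) = of_bool (k' < k \<and> j = k')) \<and>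
    (\<forall>k'<k. arr s' ''c'' k' = of_bool (xs ! 0 ! k'))"
  have I: "?I n ?s"
  proof (rule run_For[where I = ?I and R = "{''k''}" and A = "{''h'', ''c''}"])
    fix k s' assume k: "k < n" "reg s' ''k'' = k" and sm: "same {''k''} {''h'', ''c''} s s'" and I: "?I k s'"
    have b': "base s'" by (rule base_cong[OF b sm]) auto
    note bs = base_simps[OF this]
    have kw: "k < w" using k by (simp add: w_def)
    \<comment> \<open>Row 0 starts at address 0, so its bits are read without an offset.\<close>
    have "arr s' ''in'' k = of_bool (xs ! 0 ! k)" using bs(4)[of 0 k] m_pos k by simp
    then show "?I (Suc k) (setr ''k'' (Suc k) (run ?p s'))"
      using I k kw by (auto simp: bs idx_w less_Suc_eq)
  qed (use b h in \<open>auto simp: base_def\<close>)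
  let ?s' = "setr ''q'' 1 ?s"
  have "same {''k''} {''h'', ''c''} s ?s" by (rule same_run) simp_all
  from base_cong[OF b this] have "base ?s'" by (auto simp: base_def)
  moreover have "bits ?s'" using I by (simp add: bits_def del: run.simps(7))
  moreover have "affval ?s' k y = (xs ! 0 ! k \<noteq> y ! k)" if "k < n" for k y
  proof -
    have "(\<Sum>j<n. arr ?s ''h'' (k * w + j) * of_bool (y ! j)) = (\<Sum>j<n. if j = k then of_bool (y ! j) else 0)"
      using I that by (intro sum.cong) auto
    also have "\<dots> = of_bool (y ! k)" by (subst sum.delta) (use that in auto)
    finally have sum: "(\<Sum>j<n. arr ?s ''h'' (k * w + j) * of_bool (y ! j)) = of_bool (y ! k)" .
    have c: "arr ?s ''c'' k = of_bool (xs ! 0 ! k)" using I that by blast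
    show ?thesis unfolding affval_def setr_simps sum c by auto
  qed
  then have "zeros ?s' = {xs ! 0}"
    using length_row[of 0] m_pos by (auto simp: zeros_def intro!: nth_equalityI simp del: run.simps(7))
  moreover have "xs ! 0 \<in> D" using row_in_D m_pos by simp
  ultimately show ?thesis by (auto simp: aff_inv_def aff_init_prog_def simp del: run.simps(7))
qed

text \<open>The final zero set is finite and contains \<open>D\<close>, so equal size means
  equality; if \<open>D\<close> is closed, the hull property of the invariant gives the other
  inclusion.\<close>

lemma affine_prog:
  assumes b: "base s" and h: "arr s ''h'' = (\<lambda>_. 0)"
  defines "s' \<equiv> run affine_prog s"
  shows "base s'" "bits s'" "reg s' ''q'' = m \<Longrightarrow> zeros s' = D" "xor3_closed D \<Longrightarrow> reg s' ''q'' = m"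
proof -
  let ?s = "run (aff_init_prog ;; Asg ''q'' (N 1)) s"
  have I0: "aff_inv 0 ?s" by (rule aff_init[OF b h])
  let ?R = "{''i'', ''k'', ''e'', ''j'', ''p'', ''d'', ''q''}" and ?A = "{''v'', ''g'', ''h'', ''c''}"
  have "aff_inv m (run (For ''i'' ''size'' aff_step_prog) ?s)"
  proof (rule run_For[where I = aff_inv and R = ?R and A = ?A])
    fix i s' assume i: "i < m" "reg s' ''i'' = i" and I: "aff_inv i s'"
    have "same {''i''} {} (run aff_step_prog s') (setr ''i'' (Suc i) (run aff_step_prog s'))"
      by (simp add: same_def)
    with aff_step[OF I i(2,1)] show "aff_inv (Suc i) (setr ''i'' (Suc i) (run aff_step_prog s'))"
      by (rule aff_inv_cong) auto
  next
    have "same {''i''} {} ?s (setr ''i'' 0 ?s)" by (simp add: same_def)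
    with I0 show "aff_inv 0 (setr ''i'' 0 ?s)" by (rule aff_inv_cong) auto
  qed (use I0 in \<open>auto simp: aff_defs aff_inv_def base_def\<close>)
  then have I: "aff_inv m s'" by (simp add: s'_def affine_prog_def del: run.simps(7))
  then show "base s'" "bits s'" by (auto simp: aff_inv_def)
  have "finite {y :: bool list. length y = n}"
    using finite_lists_length_eq[of "UNIV :: bool set" n] by simp
  then have fin: "finite (zeros s')" by (rule finite_subset[rotated]) (auto simp: zeros_def)
  have sub: "D \<subseteq> zeros s'" using I in_D_row by (fastforce simp: aff_inv_def)
  show "zeros s' = D" if "reg s' ''q'' = m"
    using card_subset_eq[OF fin sub] I that card_D by (simp add: aff_inv_def)
  show "reg s' ''q'' = m" if "xor3_closed D"
  proof -
    have "zeros s' \<subseteq> D" using I that by (auto simp: aff_inv_def)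
    with sub have "zeros s' = D" by simp
    with I card_D show ?thesis by (simp add: aff_inv_def)
  qed
qed

text \<open>The literals \<open>x\<^sub>0\<close>, \<open>\<not> x\<^sub>0\<close> together contribute 1, which turns the odd parity demanded by a clause
  into an even one.\<close>

definition xnf_clause :: "state \<Rightarrow> nat \<Rightarrow> clause" where
  "xnf_clause s k = map (\<lambda>j. (j, True)) (filter (\<lambda>j. arr s ''h'' (k * w + j) = 1) [0..<n]) @
     (if arr s ''c'' k = 0 then [(0, True), (0, False)] else [])"

lemma xnf_prog:
  assumes b: "base s"
  shows "out (run xnf_prog s) = out s @ 2 # encode_clauses (map (xnf_clause s) [0..<n])"
proof -
  let ?p1 = "Cond (Eq (cell ''h'' ''T'' ''k'' ''j'') (N 1)) (Out (Plus (Plus (V ''j'') (V ''j'')) (N 2))) Nop"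
  let ?p2 = "Cond (Eq (Sel ''c'' (V ''k'')) (N 0)) (Out (N 2) ;; Out (N 1)) Nop ;; Out (N 0)"
  let ?p = "xnf_row_prog ;; ?p2"
  have inner: "out (run xnf_row_prog s') = out s' @
      map encode_literal (map (\<lambda>j. (j, True)) (filter (\<lambda>j. arr s' ''h'' (k * w + j) = 1) [0..<n]))"
    if b': "base s'" and k: "reg s' ''k'' = k" "k < n" for s' k
  proof -
    let ?I = "\<lambda>j r. out r = out s' @
      map encode_literal (map (\<lambda>j. (j, True)) (filter (\<lambda>j. arr s' ''h'' (k * w + j) = 1) [0..<j]))"
    show ?thesis
      unfolding xnf_row_prog_def
    proof (rule run_For[where I = ?I and R = "{''j''}" and A = "{}"])
      fix j r assume j: "j < n" "reg r ''j'' = j" and sm: "same {''j''} {} s' r" and I: "?I j r"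
      have "base r" by (rule base_cong[OF b' sm]) auto
      note bs = base_simps[OF this]
      have "arr r ''h'' = arr s' ''h''" "reg r ''k'' = k"
        using same_arr[OF sm, of "''h''"] same_reg[OF sm, of "''k''"] k by auto
      then show "?I (Suc j) (setr ''j'' (Suc j) (run ?p1 r))"
        using I j k by (auto simp: bs w_def)
    qed (use b' in \<open>auto simp: base_def\<close>)
  qed
  let ?s = "emit 2 s"
  let ?I = "\<lambda>k s'. out s' = out s @ 2 # encode_clauses (map (xnf_clause s) [0..<k])"
  have "?I n (run (For ''k'' ''n'' ?p) ?s)"
  proof (rule run_For[where I = ?I and R = "{''k'', ''j''}" and A = "{}"])
    fix k s' assume k: "k < n" "reg s' ''k'' = k" and sm: "same {''k'', ''j''} {} ?s s'" and I: "?I k s'"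
    have b': "base s'" by (rule base_cong[of ?s, OF _ sm]) (use b in \<open>auto simp: base_def\<close>)
    have eq: "arr s' = arr s" using same_arr[OF sm] by auto
    have "same {''j''} {} s' (run xnf_row_prog s')"
      by (rule same_run) (simp_all add: xnf_row_prog_def)
    note sm' = same_reg[OF this] same_arr[OF this]
    show "?I (Suc k) (setr ''k'' (Suc k) (run ?p s'))"
      using I k by (simp add: inner[OF b' k(2,1)] sm' eq encode_clauses_snoc xnf_clause_def del: run.simps(7))
  qed (use b in \<open>auto simp: base_def encode_clauses_def xnf_row_prog_def\<close>)
  then show ?thesis by (simp add: xnf_prog_def del: run.simps(7))
qed

lemma xnf_models:
  assumes bits: "bits s"
  shows "models n (XNF (map (xnf_clause s) [0..<n])) = zeros s"
proof -
  have "odd (length (filter (lit_true y) (xnf_clause s k))) \<longleftrightarrow> \<not> affval s k y" if k: "k < n" for y k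
  proof -
    have "(\<Sum>j<n. of_bool (arr s ''h'' (k * w + j) = 1 \<and> lit_true y (j, True))) =
        (\<Sum>j<n. arr s ''h'' (k * w + j) * of_bool (y ! j))"
    proof (rule sum.cong)
      fix j assume "j \<in> {..<n}"
      then have "arr s ''h'' (k * w + j) = 0 \<or> arr s ''h'' (k * w + j) = 1"
        using bits k unfolding bits_def by (metis One_nat_def le_SucE le_zero_eq lessThan_iff)
      then show "of_bool (arr s ''h'' (k * w + j) = 1 \<and> lit_true y (j, True)) =
          arr s ''h'' (k * w + j) * of_bool (y ! j)" by (auto simp: lit_true_def)
    qed simp
    moreover have "arr s ''c'' k = 0 \<or> arr s ''c'' k = 1"
      using bits k unfolding bits_def by (metis One_nat_def le_SucE le_zero_eq)
    moreover have "length (filter (lit_true y) (xnf_clause s k)) =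
        (\<Sum>j<n. of_bool (arr s ''h'' (k * w + j) = 1 \<and> lit_true y (j, True))) +
        (if arr s ''c'' k = 0 then 1 else 0)"
      unfolding xnf_clause_def filter_append length_append length_filter_upt by (simp add: lit_true_def)
    ultimately show ?thesis unfolding affval_def by auto
  qed
  then show ?thesis by (auto simp: models_def zeros_def)
qed

lemma xnf_constraint:
  "possibility_integrity_constraint n (XNF (map (xnf_clause s) [0..<n]))"
  using n by (auto simp: possibility_integrity_constraint_def affine_def formula_over_def
      xnf_clause_def vars_def)

end

section \<open>A formula of prime implicates\<close>

abbreviation sat_test :: bexp where
  "sat_test \<equiv> Eq (Sel ''l'' (V ''t'')) (Plus (cell ''in'' ''R'' ''k'' ''t'') (N 1))"

definition build_prog :: prog where
  "build_prog =
     For ''t'' ''n''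
       (Sto ''l'' (V ''t'') (N 0) ;;
        Cond (Less (V ''t'') (V ''j'')) (Sto ''l'' (V ''t'') (Minus (N 2) (cell ''in'' ''R'' ''i'' ''t''))) Nop ;;
        Cond (Eq (V ''t'') (V ''j'')) (Sto ''l'' (V ''t'') (Plus (cell ''in'' ''R'' ''i'' ''t'') (N 1))) Nop)"

definition count_row_prog :: prog where
  "count_row_prog =
     (Asg ''e'' (N 0) ;; For ''t'' ''n'' (Cond sat_test (Asg ''e'' (Plus (V ''e'') (N 1))) Nop))"

definition count_prog :: prog where
  "count_prog =
     (Asg ''f'' (N 1) ;;
      For ''k'' ''size''
        (count_row_prog ;; Sto ''b'' (V ''k'') (V ''e'') ;; Cond (Eq (V ''e'') (N 0)) (Asg ''f'' (N 0)) Nop))"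

definition check_prog :: prog where
  "check_prog =
     (Asg ''e'' (N 1) ;;
      For ''k'' ''size'' (Cond (And sat_test (Eq (Sel ''b'' (V ''k'')) (N 1))) (Asg ''e'' (N 0)) Nop))"

definition decr_prog :: prog where
  "decr_prog =
     For ''k'' ''size'' (Cond sat_test (Sto ''b'' (V ''k'') (Minus (Sel ''b'' (V ''k'')) (N 1))) Nop)"

definition min_prog :: prog where
  "min_prog =
     For ''t'' ''n'' (check_prog ;; Cond (Eq (V ''e'') (N 1)) (decr_prog ;; Sto ''l'' (V ''t'') (N 0)) Nop)"

definition find_prog :: prog where
  "find_prog = For ''t'' ''n'' (Cond sat_test (Asg ''u'' (V ''t'')) Nop)"

definition mark_prog :: prog where
  "mark_prog =
     For ''t'' ''n''
       (Cond (And (Not (Eq (V ''t'') (V ''u''))) (Less (N 0) (Sel ''l'' (V ''t''))))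
         (Sto ''A'' (Plus (V ''a'') (Minus (Plus (Plus (V ''t'') (V ''t'')) (N 3)) (Sel ''l'' (V ''t'')))) (N 1)) Nop)"

definition edge_prog :: prog where
  "edge_prog =
     For ''k'' ''size''
       (Cond (Eq (Sel ''b'' (V ''k'')) (N 1))
         (find_prog ;;
          Asg ''a'' (Sel ''T'' (Plus (Plus (V ''u'') (V ''u'')) (Sel ''l'' (V ''u'')))) ;;
          mark_prog) Nop)"

definition emit_prog :: prog where
  "emit_prog =
     (For ''t'' ''n''
        (Cond (Less (N 0) (Sel ''l'' (V ''t'')))
          (Sto ''o'' (V ''z'') (Plus (Plus (V ''t'') (V ''t'')) (Sel ''l'' (V ''t''))) ;;
           Asg ''z'' (Plus (V ''z'') (N 1))) Nop) ;;
      Sto ''o'' (V ''z'') (N 0) ;; Asg ''z'' (Plus (V ''z'') (N 1)))"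

definition clause_prog :: prog where
  "clause_prog =
     (build_prog ;; count_prog ;;
      Cond (Eq (V ''f'') (N 1)) (min_prog ;; edge_prog ;; emit_prog) Nop)"

definition cnf_prog :: prog where
  "cnf_prog = For ''i'' ''size'' (For ''j'' ''n'' clause_prog)"

lemmas cnf_defs = build_prog_def count_row_prog_def count_prog_def check_prog_def decr_prog_def
  min_prog_def find_prog_def mark_prog_def edge_prog_def emit_prog_def clause_prog_def cnf_prog_def

lemma card_less_Suc_conj:
  "card {t'. t' < Suc t \<and> P t'} = card {t'. t' < t \<and> P t'} + of_bool (P t)"
proof -
  have "{t'. t' < Suc t \<and> P t'} = {t'. t' < t \<and> P t'} \<union> (if P t then {t} else {})"
    by (auto simp: less_Suc_eq)
  then show ?thesis by (simp add: card_insert_if)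
qed

context ram_input
begin

text \<open>A clause is stored as an array with entry 0 for an absent, 1 for a negated and 2 for a plain
  variable, so that the entry of a literal is one more than the bit that satisfies it.\<close>

definition sat :: "(nat \<Rightarrow> nat) \<Rightarrow> nat \<Rightarrow> nat set" where
  "sat c k = {t. t < n \<and> c t = of_bool (xs ! k ! t) + 1}"

text \<open>The clause that forbids the first \<open>j\<close> bits of row \<open>i\<close> followed by the complement of bit \<open>j\<close>.\<close>

definition start :: "nat \<Rightarrow> nat \<Rightarrow> nat \<Rightarrow> nat" where
  "start i j t = (if t < j then 2 - of_bool (xs ! i ! t) else if t = j then of_bool (xs ! i ! t) + 1 else 0)"

definition clause_of :: "(nat \<Rightarrow> nat) \<Rightarrow> clause" where
  "clause_of c = map (\<lambda>t. (t, c t = 2)) (filter (\<lambda>t. c t \<noteq> 0) [0..<n])"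

text \<open>The vertices are the literal codes: \<open>2 * t + c t\<close> encodes a literal and \<open>2 * t' + 3 - c t'\<close> the
  negation of one.\<close>

definition edge :: "(nat \<Rightarrow> nat) \<Rightarrow> nat \<Rightarrow> nat \<Rightarrow> bool" where
  "edge c x y \<longleftrightarrow> (\<exists>t t'. t < n \<and> t' < n \<and> t \<noteq> t' \<and> c t \<noteq> 0 \<and> c t' \<noteq> 0 \<and>
     x = 2 * t + c t \<and> y = 2 * t' + 3 - c t')"

definition good :: "(nat \<Rightarrow> nat) \<Rightarrow> bool" where
  "good c \<longleftrightarrow> (\<forall>t<n. c t \<le> 2) \<and> (\<forall>k<m. sat c k \<noteq> {}) \<and>
     (\<forall>t<n. c t \<noteq> 0 \<longrightarrow> (\<exists>k<m. sat c k = {t}))"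

text \<open>Whether the formula is the answer is known only after the search, and the output tape
  cannot be revised; the clauses are therefore collected in an array.\<close>

definition buffer :: "state \<Rightarrow> nat list" where
  "buffer s = map (arr s ''o'') [0..<reg s ''z'']"

lemma finite_sat [simp]: "finite (sat c k)"
  by (simp add: sat_def)

lemma build_prog:
  assumes b: "base s" and ij: "reg s ''i'' = i" "i < m" "reg s ''j'' = j"
  shows "\<forall>t<n. arr (run build_prog s) ''l'' t = start i j t"
proof -
  let ?I = "\<lambda>t s'. \<forall>t'<t. arr s' ''l'' t' = start i j t'"
  show ?thesis
    unfolding build_prog_def
  proof (rule run_For[where I = ?I and R = "{''t''}" and A = "{''l''}"])
    fix t s' assume t: "t < n" "reg s' ''t'' = t" and sm: "same {''t''} {''l''} s s'" and I: "?I t s'"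
    have "base s'" by (rule base_cong[OF b sm]) auto
    note bs = base_simps[OF this]
    have "reg s' ''i'' = i" "reg s' ''j'' = j"
      using same_reg[OF sm, of "''i''"] same_reg[OF sm, of "''j''"] ij by auto
    then show "?I (Suc t) (setr ''t'' (Suc t) (run (Sto ''l'' (V ''t'') (N 0) ;;
        Cond (Less (V ''t'') (V ''j'')) (Sto ''l'' (V ''t'') (Minus (N 2) (cell ''in'' ''R'' ''i'' ''t''))) Nop ;;
        Cond (Eq (V ''t'') (V ''j'')) (Sto ''l'' (V ''t'') (Plus (cell ''in'' ''R'' ''i'' ''t'') (N 1))) Nop) s'))"
      using I t ij by (auto simp: bs start_def less_Suc_eq)
  qed (use b in \<open>auto simp: base_def\<close>)
qed

lemma count_row_prog:
  assumes b: "base s" and k: "reg s ''k'' = k" "k < m"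
  shows "reg (run count_row_prog s) ''e'' = card (sat (arr s ''l'') k)"
proof -
  let ?s = "setr ''e'' 0 s"
  let ?p = "Cond sat_test (Asg ''e'' (Plus (V ''e'') (N 1))) Nop"
  let ?I = "\<lambda>t s'. reg s' ''e'' = card {t'. t' < t \<and> arr s ''l'' t' = of_bool (xs ! k ! t') + 1}"
  have "?I n (run (For ''t'' ''n'' ?p) ?s)"
  proof (rule run_For[where I = ?I and R = "{''t'', ''e''}" and A = "{}"])
    fix t s' assume t: "t < n" "reg s' ''t'' = t" and sm: "same {''t'', ''e''} {} ?s s'" and I: "?I t s'"
    have "base s'" by (rule base_cong[of ?s, OF _ sm]) (use b in \<open>auto simp: base_def\<close>)
    note bs = base_simps[OF this]
    have "reg s' ''k'' = k" "arr s' ''l'' = arr s ''l''"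
      using same_reg[OF sm, of "''k''"] same_arr[OF sm, of "''l''"] k by auto
    then show "?I (Suc t) (setr ''t'' (Suc t) (run ?p s'))"
      using I t k by (simp add: bs card_less_Suc_conj)
  qed (use b in \<open>auto simp: base_def\<close>)
  then show ?thesis by (simp add: count_row_prog_def sat_def del: run.simps(7))
qed

text \<open>The flag tells whether the clause is an implicate of \<open>D\<close>. For a starting
  clause, count 0 at a row means that the row continues with the forbidden prefix.\<close>

lemma count_prog:
  assumes b: "base s"
  shows "\<forall>k<m. arr (run count_prog s) ''b'' k = card (sat (arr s ''l'') k)"
    "reg (run count_prog s) ''f'' = of_bool (\<forall>k<m. sat (arr s ''l'') k \<noteq> {})"
proof -
  let ?s = "setr ''f'' 1 s"
  let ?p = "count_row_prog ;; Sto ''b'' (V ''k'') (V ''e'') ;; Cond (Eq (V ''e'') (N 0)) (Asg ''f'' (N 0)) Nop"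
  let ?I = "\<lambda>k s'. (\<forall>k'<k. arr s' ''b'' k' = card (sat (arr s ''l'') k')) \<and>
    reg s' ''f'' = of_bool (\<forall>k'<k. sat (arr s ''l'') k' \<noteq> {})"
  let ?R = "{''k'', ''t'', ''e'', ''f''}"
  have "?I m (run (For ''k'' ''size'' ?p) ?s)"
  proof (rule run_For[where I = ?I and R = ?R and A = "{''b''}"])
    fix k s' assume k: "k < m" "reg s' ''k'' = k" and sm: "same ?R {''b''} ?s s'" and I: "?I k s'"
    have b': "base s'" by (rule base_cong[of ?s, OF _ sm]) (use b in \<open>auto simp: base_def\<close>)
    have "arr s' ''l'' = arr s ''l''" using same_arr[OF sm, of "''l''"] by auto
    with count_row_prog[OF b' k(2,1)]
    have e: "reg (run count_row_prog s') ''e'' = card (sat (arr s ''l'') k)" by simp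
    have "same {''t'', ''e''} {} s' (run count_row_prog s')"
      by (rule same_run) (simp_all add: count_row_prog_def)
    note sm' = same_reg[OF this] same_arr[OF this]
    show "?I (Suc k) (setr ''k'' (Suc k) (run ?p s'))"
      using I e k by (auto simp: sm' less_Suc_eq)
  qed (use b in \<open>auto simp: base_def count_row_prog_def\<close>)
  then show "\<forall>k<m. arr (run count_prog s) ''b'' k = card (sat (arr s ''l'') k)"
    "reg (run count_prog s) ''f'' = of_bool (\<forall>k<m. sat (arr s ''l'') k \<noteq> {})"
    by (simp_all add: count_prog_def del: run.simps(7))
qed

lemma check_prog:
  assumes b: "base s" and t: "reg s ''t'' = t" "t < n"
  shows "reg (run check_prog s) ''e'' = of_bool (\<forall>k<m. \<not> (t \<in> sat (arr s ''l'') k \<and> arr s ''b'' k = 1))"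
proof -
  let ?s = "setr ''e'' 1 s"
  let ?p = "Cond (And sat_test (Eq (Sel ''b'' (V ''k'')) (N 1))) (Asg ''e'' (N 0)) Nop"
  let ?I = "\<lambda>k s'. reg s' ''e'' = of_bool (\<forall>k'<k. \<not> (t \<in> sat (arr s ''l'') k' \<and> arr s ''b'' k' = 1))"
  have "?I m (run (For ''k'' ''size'' ?p) ?s)"
  proof (rule run_For[where I = ?I and R = "{''k'', ''e''}" and A = "{}"])
    fix k s' assume k: "k < m" "reg s' ''k'' = k" and sm: "same {''k'', ''e''} {} ?s s'" and I: "?I k s'"
    have "base s'" by (rule base_cong[of ?s, OF _ sm]) (use b in \<open>auto simp: base_def\<close>)
    note bs = base_simps[OF this]
    have "reg s' ''t'' = t" "arr s' ''l'' = arr s ''l''" "arr s' ''b'' = arr s ''b''"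
      using same_reg[OF sm, of "''t''"] same_arr[OF sm, of "''l''"] same_arr[OF sm, of "''b''"] t by auto
    then show "?I (Suc k) (setr ''k'' (Suc k) (run ?p s'))"
      using I t k by (auto simp: bs sat_def less_Suc_eq)
  qed (use b in \<open>auto simp: base_def\<close>)
  then show ?thesis by (simp add: check_prog_def del: run.simps(7))
qed

lemma decr_prog:
  assumes b: "base s" and t: "reg s ''t'' = t" "t < n"
  shows "\<forall>k<m. arr (run decr_prog s) ''b'' k = arr s ''b'' k - of_bool (t \<in> sat (arr s ''l'') k)"
proof -
  let ?p = "Cond sat_test (Sto ''b'' (V ''k'') (Minus (Sel ''b'' (V ''k'')) (N 1))) Nop"
  let ?I = "\<lambda>k s'. \<forall>k'<m. arr s' ''b'' k' = arr s ''b'' k' - of_bool (k' < k \<and> t \<in> sat (arr s ''l'') k')"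
  have "?I m (run (For ''k'' ''size'' ?p) s)"
  proof (rule run_For[where I = ?I and R = "{''k''}" and A = "{''b''}"])
    fix k s' assume k: "k < m" "reg s' ''k'' = k" and sm: "same {''k''} {''b''} s s'" and I: "?I k s'"
    have "base s'" by (rule base_cong[OF b sm]) auto
    note bs = base_simps[OF this]
    have "reg s' ''t'' = t" "arr s' ''l'' = arr s ''l''"
      using same_reg[OF sm, of "''t''"] same_arr[OF sm, of "''l''"] t by auto
    then show "?I (Suc k) (setr ''k'' (Suc k) (run ?p s'))"
      using I t k by (auto simp: bs sat_def less_Suc_eq)
  qed (use b in \<open>auto simp: base_def\<close>)
  then show ?thesis by (simp add: decr_prog_def del: run.simps(7))
qed

text \<open>Literal \<open>t\<close> must stay exactly if some row contains it and has count 1. One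
  pass suffices: a kept literal has a row satisfied by it alone, which later deletions do not
  affect. The counts make each test and each deletion linear in the number of rows.\<close>

lemma min_prog:
  assumes b: "base s" and cnt: "\<forall>k<m. arr s ''b'' k = card (sat (arr s ''l'') k)"
    and imp: "\<forall>k<m. sat (arr s ''l'') k \<noteq> {}" and le: "\<forall>t<n. arr s ''l'' t \<le> 2"
  defines "s' \<equiv> run min_prog s"
  shows "\<forall>t. arr s' ''l'' t = 0 \<or> arr s' ''l'' t = arr s ''l'' t" "good (arr s' ''l'')"
    "\<forall>k<m. arr s' ''b'' k = card (sat (arr s' ''l'') k)"
proof -
  let ?p = "check_prog ;; Cond (Eq (V ''e'') (N 1)) (decr_prog ;; Sto ''l'' (V ''t'') (N 0)) Nop"
  let ?I = "\<lambda>t s'. (\<forall>k<m. arr s' ''b'' k = card (sat (arr s' ''l'') k)) \<and>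
    (\<forall>t'. arr s' ''l'' t' = 0 \<or> arr s' ''l'' t' = arr s ''l'' t') \<and>
    (\<forall>k<m. sat (arr s' ''l'') k \<noteq> {}) \<and>
    (\<forall>t'<t. arr s' ''l'' t' \<noteq> 0 \<longrightarrow> (\<exists>k<m. sat (arr s' ''l'') k = {t'}))"
  let ?R = "{''t'', ''k'', ''e''}" and ?A = "{''b'', ''l''}"
  have I: "?I n s'"
    unfolding s'_def min_prog_def
  proof (rule run_For[where I = ?I and R = ?R and A = ?A])
    fix t s' assume t: "t < n" "reg s' ''t'' = t" and sm: "same ?R ?A s s'" and I: "?I t s'"
    have b': "base s'" by (rule base_cong[OF b sm]) auto
    let ?c = "arr s' ''l''"
    let ?s1 = "run check_prog s'"
    have sm1: "same {''k'', ''e''} {} s' ?s1" by (rule same_run) (simp_all add: check_prog_def)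
    have b1: "base ?s1" by (rule base_cong[OF b' sm1]) auto
    note e = check_prog[OF b' t(2,1)]
    show "?I (Suc t) (setr ''t'' (Suc t) (run ?p s'))"
    proof (cases "\<forall>k<m. \<not> (t \<in> sat ?c k \<and> arr s' ''b'' k = 1)")
      case False
      have e0: "reg ?s1 ''e'' = 0" unfolding e of_bool_def by (rule if_not_P[OF False])
      from False obtain k where k: "k < m" "t \<in> sat ?c k" "arr s' ''b'' k = 1" by blast
      then have "card (sat ?c k) = 1" using I by simp
      then have "sat ?c k = {t}" using k(2) by (auto simp: card_1_singleton_iff)
      with I k(1) show ?thesis by (auto simp: same_arr[OF sm1] e0 less_Suc_eq)
    next
      case True
      have e1: "reg ?s1 ''e'' = 1" unfolding e of_bool_def by (rule if_P[OF True])
      let ?s2 = "run decr_prog ?s1"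
      have sm2: "same {''k''} {''b''} ?s1 ?s2" by (rule same_run) (simp_all add: decr_prog_def)
      have t1: "reg ?s1 ''t'' = t" using same_reg[OF sm1, of "''t''"] t by simp
      have l2: "arr ?s2 ''l'' = ?c" "reg ?s2 ''t'' = t"
        using same_arr[OF sm2, of "''l''"] same_arr[OF sm1, of "''l''"] same_reg[OF sm2, of "''t''"] t1 by auto
      have b2: "\<forall>k<m. arr ?s2 ''b'' k = arr s' ''b'' k - of_bool (t \<in> sat ?c k)"
        using decr_prog[OF b1 t1 t(1)] same_arr[OF sm1] by simp
      have sat': "sat (?c(t := 0)) k = sat ?c k - {t}" for k by (auto simp: sat_def)
      have ne: "sat ?c k - {t} \<noteq> {}" if "k < m" for k
      proof
        assume *: "sat ?c k - {t} = {}"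
        moreover have "sat ?c k \<noteq> {}" using I that by blast
        ultimately have "sat ?c k = {t}" by blast
        with I that have "t \<in> sat ?c k \<and> arr s' ''b'' k = 1" by simp
        with True that show False by blast
      qed
      have "arr ?s2 ''b'' k = card (sat ?c k - {t})" if "k < m" for k
        using b2 I that by simp
      moreover have "\<exists>k<m. sat ?c k - {t} = {t'}" if t': "t' < t" "?c t' \<noteq> 0" for t'
      proof -
        from I t' obtain k where "k < m" "sat ?c k = {t'}" by blast
        with t' show ?thesis by (intro exI[of _ k]) auto
      qed
      ultimately show ?thesis
        using I ne by (simp add: l2 sat' e1 less_Suc_eq)
    qed
  qed (use b cnt imp in \<open>auto simp: base_def check_prog_def decr_prog_def\<close>)
  then show "\<forall>t. arr s' ''l'' t = 0 \<or> arr s' ''l'' t = arr s ''l'' t"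
    "\<forall>k<m. arr s' ''b'' k = card (sat (arr s' ''l'') k)" by auto
  have "arr s' ''l'' t \<le> 2" if "t < n" for t
    using I le that by (metis zero_le)
  then show "good (arr s' ''l'')" using I by (auto simp: good_def)
qed

lemma find_prog:
  assumes b: "base s" and k: "reg s ''k'' = k" "k < m" and u: "sat (arr s ''l'') k = {u}"
  shows "reg (run find_prog s) ''u'' = u"
proof -
  let ?p = "Cond sat_test (Asg ''u'' (V ''t'')) Nop"
  let ?I = "\<lambda>t s'. u < t \<longrightarrow> reg s' ''u'' = u"
  have "?I n (run (For ''t'' ''n'' ?p) s)"
  proof (rule run_For[where I = ?I and R = "{''t'', ''u''}" and A = "{}"])
    fix t s' assume t: "t < n" "reg s' ''t'' = t" and sm: "same {''t'', ''u''} {} s s'" and I: "?I t s'"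
    have "base s'" by (rule base_cong[OF b sm]) auto
    note bs = base_simps[OF this]
    have eq: "reg s' ''k'' = k" "arr s' ''l'' = arr s ''l''"
      using same_reg[OF sm, of "''k''"] same_arr[OF sm, of "''l''"] k by auto
    have "bval sat_test s' \<longleftrightarrow> t \<in> sat (arr s ''l'') k" using t k by (simp add: bs eq sat_def)
    also have "\<dots> \<longleftrightarrow> t = u" using u by auto
    finally show "?I (Suc t) (setr ''t'' (Suc t) (run ?p s'))"
      using I t by (simp add: less_Suc_eq del: bval.simps)
  qed (use b in \<open>auto simp: base_def\<close>)
  moreover have "u < n" using u by (auto simp: sat_def)
  ultimately show ?thesis by (simp add: find_prog_def del: run.simps(7))
qed

lemma mark_prog:
  assumes b: "base s"
  shows "arr (run mark_prog s) ''A'' = (\<lambda>q. if \<exists>t<n. t \<noteq> reg s ''u'' \<and> arr s ''l'' t \<noteq> 0 \<and>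
      q = reg s ''a'' + (2 * t + 3 - arr s ''l'' t) then 1 else arr s ''A'' q)"
proof -
  let ?p = "Cond (And (Not (Eq (V ''t'') (V ''u''))) (Less (N 0) (Sel ''l'' (V ''t''))))
         (Sto ''A'' (Plus (V ''a'') (Minus (Plus (Plus (V ''t'') (V ''t'')) (N 3)) (Sel ''l'' (V ''t'')))) (N 1)) Nop"
  define P where "P t q \<longleftrightarrow> t \<noteq> reg s ''u'' \<and> arr s ''l'' t \<noteq> 0 \<and>
      q = reg s ''a'' + (2 * t + 3 - arr s ''l'' t)" for t q
  let ?I = "\<lambda>t s'. \<forall>q. arr s' ''A'' q = (if \<exists>t'<t. P t' q then 1 else arr s ''A'' q)"
  have "?I n (run (For ''t'' ''n'' ?p) s)"
  proof (rule run_For[where I = ?I and R = "{''t''}" and A = "{''A''}"])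
    fix t s' assume t: "t < n" "reg s' ''t'' = t" and sm: "same {''t''} {''A''} s s'" and I: "?I t s'"
    have "reg s' ''u'' = reg s ''u''" "reg s' ''a'' = reg s ''a''" "arr s' ''l'' = arr s ''l''"
      using same_reg[OF sm, of "''u''"] same_reg[OF sm, of "''a''"] same_arr[OF sm, of "''l''"] by auto
    then have "arr (run ?p s') ''A'' q = (if P t q then 1 else arr s' ''A'' q)" for q
      using t by (simp add: P_def)
    with I show "?I (Suc t) (setr ''t'' (Suc t) (run ?p s'))"
      by (auto simp: Ex_less_Suc simp del: run.simps)
  qed (use b in \<open>auto simp: base_def\<close>)
  then show ?thesis unfolding mark_prog_def P_def by (intro ext) blast
qed

text \<open>Row \<open>k\<close> with count 1 contributes the arrows \<open>E k\<close> out of its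
  only satisfied literal. Since every literal of a \<open>good\<close> clause is the only satisfied
  one in some row, no arrow is missed, and the effort is rows times variables instead of pairs of
  literals.\<close>

lemma edge_prog:
  assumes b: "base s" and good: "good (arr s ''l'')"
    and cnt: "\<forall>k<m. arr s ''b'' k = card (sat (arr s ''l'') k)"
  shows "\<forall>x<w. \<forall>y<w. arr (run edge_prog s) ''A'' (x * w + y) =
    (if edge (arr s ''l'') x y then 1 else arr s ''A'' (x * w + y))"
proof -
  let ?c = "arr s ''l''"
  let ?p = "Cond (Eq (Sel ''b'' (V ''k'')) (N 1))
         (find_prog ;;
          Asg ''a'' (Sel ''T'' (Plus (Plus (V ''u'') (V ''u'')) (Sel ''l'' (V ''u'')))) ;;
          mark_prog) Nop"
  define E where "E k x y \<longleftrightarrow> (\<exists>u t. sat ?c k = {u} \<and> t < n \<and> t \<noteq> u \<and> ?c t \<noteq> 0 \<and>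
      x = 2 * u + ?c u \<and> y = 2 * t + 3 - ?c t)" for k x y
  let ?I = "\<lambda>k s'. \<forall>x<w. \<forall>y<w. arr s' ''A'' (x * w + y) =
    (if \<exists>k'<k. E k' x y then 1 else arr s ''A'' (x * w + y))"
  let ?R = "{''k'', ''t'', ''u'', ''a''}"
  have I: "?I m (run (For ''k'' ''size'' ?p) s)"
  proof (rule run_For[where I = ?I and R = ?R and A = "{''A''}"])
    fix k s' assume k: "k < m" "reg s' ''k'' = k" and sm: "same ?R {''A''} s s'" and I: "?I k s'"
    have b': "base s'" by (rule base_cong[OF b sm]) auto
    have eq: "arr s' ''l'' = ?c" "arr s' ''b'' = arr s ''b''"
      using same_arr[OF sm, of "''l''"] same_arr[OF sm, of "''b''"] by auto
    show "?I (Suc k) (setr ''k'' (Suc k) (run ?p s'))"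
    proof (cases "\<exists>u. sat ?c k = {u}")
      case False
      then have "card (sat ?c k) \<noteq> 1" by (simp add: card_1_singleton_iff)
      moreover have "\<not> E k x y" for x y using False by (auto simp: E_def)
      ultimately show ?thesis using I k cnt by (simp add: eq Ex_less_Suc)
    next
      case True
      then obtain u where u: "sat ?c k = {u}" by blast
      then have un: "u < n" by (auto simp: sat_def)
      let ?s1 = "run find_prog s'"
      have sm1: "same {''t'', ''u''} {} s' ?s1" by (rule same_run) (simp_all add: find_prog_def)
      have b1: "base ?s1" by (rule base_cong[OF b' sm1]) auto
      have u1: "reg ?s1 ''u'' = u" using find_prog[OF b' k(2,1)] u eq by simp
      have l1: "arr ?s1 ''l'' = ?c" "arr ?s1 ''A'' = arr s' ''A''"
        using same_arr[OF sm1, of "''l''"] same_arr[OF sm1, of "''A''"] eq by auto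
      have cu: "?c u \<le> 2" using good un by (simp add: good_def)
      then have uw: "2 * u + ?c u < w" using un by (simp add: w_def)
      let ?s2 = "setr ''a'' ((2 * u + ?c u) * w) ?s1"
      have b2: "base ?s2" using b1 by (auto simp: base_def)
      have run: "run ?p s' = run mark_prog ?s2"
        using k cnt u u1 l1 eq base_simps(6)[OF b1 uw] by (simp add: mult_2)
      have "arr (run mark_prog ?s2) ''A'' (x * w + y) = (if E k x y then 1 else arr s' ''A'' (x * w + y))"
        if xy: "x < w" "y < w" for x y
      proof -
        \<comment> \<open>The target code is below \<open>w\<close>, so an address of the matrix
          determines source and target.\<close>
        have "x * w + y = (2 * u + ?c u) * w + (2 * t + 3 - ?c t) \<longleftrightarrow> x = 2 * u + ?c u \<and> y = 2 * t + 3 - ?c t"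
          if "t < n" "?c t \<noteq> 0" for t
        proof -
          have "2 * t + 3 - ?c t < w" using that by (simp add: w_def)
          with row_index_inj[OF xy(2) this] show ?thesis by blast
        qed
        then have "(\<exists>t<n. t \<noteq> u \<and> ?c t \<noteq> 0 \<and> x * w + y = (2 * u + ?c u) * w + (2 * t + 3 - ?c t)) \<longleftrightarrow> E k x y"
          unfolding E_def u by blast
        then show ?thesis unfolding mark_prog[OF b2] using u1 l1 by simp
      qed
      with I show ?thesis unfolding run by (auto simp: Ex_less_Suc)
    qed
  qed (use b in \<open>auto simp: base_def find_prog_def mark_prog_def\<close>)
  have "(\<exists>k<m. E k x y) \<longleftrightarrow> edge ?c x y" for x y
  proof
    assume "\<exists>k<m. E k x y"
    then obtain k u t where *: "sat ?c k = {u}" "t < n" "t \<noteq> u" "?c t \<noteq> 0" "x = 2 * u + ?c u" "y = 2 * t + 3 - ?c t"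
      unfolding E_def by blast
    moreover have "u \<in> sat ?c k" using *(1) by simp
    then have "u < n" "?c u \<noteq> 0" by (auto simp: sat_def)
    ultimately show "edge ?c x y" unfolding edge_def by blast
  next
    assume "edge ?c x y"
    then obtain u t where *: "u < n" "t < n" "u \<noteq> t" "?c u \<noteq> 0" "?c t \<noteq> 0"
      "x = 2 * u + ?c u" "y = 2 * t + 3 - ?c t" unfolding edge_def by blast
    with good obtain k where "k < m" "sat ?c k = {u}" unfolding good_def by blast
    with * show "\<exists>k<m. E k x y" unfolding E_def by blast
  qed
  with I show ?thesis by (simp add: edge_prog_def del: run.simps(7))
qed

lemma encode_literal_entry: "c \<noteq> 0 \<Longrightarrow> c \<le> 2 \<Longrightarrow> encode_literal (t, c = 2) = 2 * t + c"
  by auto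

lemma emit_prog:
  assumes b: "base s" and le: "\<forall>t<n. arr s ''l'' t \<le> 2"
  shows "buffer (run emit_prog s) = buffer s @ map encode_literal (clause_of (arr s ''l'')) @ [0]"
proof -
  let ?c = "arr s ''l''"
  let ?p = "Cond (Less (N 0) (Sel ''l'' (V ''t'')))
          (Sto ''o'' (V ''z'') (Plus (Plus (V ''t'') (V ''t'')) (Sel ''l'' (V ''t''))) ;;
           Asg ''z'' (Plus (V ''z'') (N 1))) Nop"
  let ?I = "\<lambda>t s'. buffer s' = buffer s @ map encode_literal (map (\<lambda>t. (t, ?c t = 2)) (filter (\<lambda>t. ?c t \<noteq> 0) [0..<t]))"
  have "?I n (run (For ''t'' ''n'' ?p) s)"
  proof (rule run_For[where I = ?I and R = "{''t'', ''z''}" and A = "{''o''}"])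
    fix t s' assume t: "t < n" "reg s' ''t'' = t" and sm: "same {''t'', ''z''} {''o''} s s'" and I: "?I t s'"
    have "arr s' ''l'' = ?c" using same_arr[OF sm, of "''l''"] by auto
    moreover have "buffer (setr ''t'' (Suc t) (setr ''z'' (Suc (reg s' ''z'')) (seta ''o'' (reg s' ''z'') v s'))) =
        buffer s' @ [v]" for v by (simp add: buffer_def)
    moreover have "buffer (setr ''t'' (Suc t) s') = buffer s'" by (simp add: buffer_def)
    ultimately show "?I (Suc t) (setr ''t'' (Suc t) (run ?p s'))"
      using I t le encode_literal_entry[of "?c t" t] by (simp add: mult_2 del: encode_literal.simps)
  qed (use b in \<open>auto simp: base_def buffer_def\<close>)
  then show ?thesis by (simp add: emit_prog_def clause_of_def buffer_def del: run.simps(7))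
qed

end

section \<open>The formula obtained from all pairs of a row and a position\<close>

context ram_input
begin

text \<open>The list \<open>cs\<close> is a ghost: memory holds its encoding in the buffer and its
  arrows in \<open>''A''\<close>. \<open>P\<close> is the set of pairs already treated and
  \<open>M\<close> bounds the number of clauses, each pair adding at most one. The last conjunct
  retains what the models need: each starting clause that is an implicate has a subclause in
  \<open>cs\<close>.\<close>

definition cnf_inv :: "(nat \<times> nat) set \<Rightarrow> nat \<Rightarrow> (nat \<Rightarrow> nat) list \<Rightarrow> state \<Rightarrow> bool" where
  "cnf_inv P M cs s \<longleftrightarrow> base s \<and> buffer s = encode_clauses (map clause_of cs) \<and> length cs \<le> M \<and>
     (\<forall>c\<in>set cs. good c) \<and>
     (\<forall>x<w. \<forall>y<w. arr s ''A'' (x * w + y) = of_bool (\<exists>c\<in>set cs. edge c x y)) \<and>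
     (\<forall>(i, j)\<in>P. (\<forall>k<m. sat (start i j) k \<noteq> {}) \<longrightarrow>
        (\<exists>c\<in>set cs. \<forall>t<n. c t = 0 \<or> c t = start i j t))"

lemma cnf_inv_cong:
  assumes "cnf_inv P M cs s" "same R A s s'" "R \<inter> {''n'', ''size'', ''w'', ''z''} = {}"
    "A \<inter> {''in'', ''R'', ''T'', ''A'', ''o''} = {}"
  shows "cnf_inv P M cs s'"
proof -
  have "arr s' ''A'' = arr s ''A''" "buffer s' = buffer s"
    using assms by (auto simp: same_def buffer_def)
  moreover have "base s'" using base_cong[OF _ assms(2)] assms by (auto simp: cnf_inv_def)
  ultimately show ?thesis using assms(1) by (simp add: cnf_inv_def)
qed

lemma sat_cong: "(\<And>t. t < n \<Longrightarrow> c t = c' t) \<Longrightarrow> sat c k = sat c' k"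
  by (auto simp: sat_def)

lemma clause_prog:
  assumes I: "cnf_inv P M cs s" and ij: "reg s ''i'' = i" "i < m" "reg s ''j'' = j"
  shows "\<exists>cs'. cnf_inv (insert (i, j) P) (Suc M) cs' (run clause_prog s)"
proof -
  let ?s1 = "run build_prog s"
  let ?s2 = "run count_prog ?s1"
  have sm1: "same {''t''} {''l''} s ?s1" by (rule same_run) (simp_all add: build_prog_def)
  have sm2: "same {''k'', ''t'', ''e'', ''f''} {''b''} ?s1 ?s2"
    by (rule same_run) (simp_all add: count_prog_def count_row_prog_def)
  have b: "base s" using I by (simp add: cnf_inv_def)
  have b1: "base ?s1" by (rule base_cong[OF b sm1]) auto
  have I2: "cnf_inv P M cs ?s2"
    by (rule cnf_inv_cong[OF cnf_inv_cong[OF I sm1] sm2]) auto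
  then have b2: "base ?s2" by (simp add: cnf_inv_def)
  have l1: "\<forall>t<n. arr ?s1 ''l'' t = start i j t" by (rule build_prog[OF b ij])
  have sat1: "sat (arr ?s1 ''l'') k = sat (start i j) k" for k
    by (rule sat_cong) (use l1 in simp)
  have l2: "arr ?s2 ''l'' = arr ?s1 ''l''" using same_arr[OF sm2, of "''l''"] by simp
  note count = count_prog[OF b1]
  show ?thesis
  proof (cases "\<forall>k<m. sat (start i j) k \<noteq> {}")
    case False
    then have "\<not> (\<forall>k<m. sat (arr ?s1 ''l'') k \<noteq> {})" by (simp add: sat1)
    then have "reg ?s2 ''f'' = 0" unfolding count(2) of_bool_def by (rule if_not_P)
    then have "run clause_prog s = ?s2" by (simp add: clause_prog_def)
    moreover have "cnf_inv (insert (i, j) P) (Suc M) cs ?s2"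
      using I2 False by (auto simp: cnf_inv_def)
    ultimately show ?thesis by auto
  next
    case True
    then have imp: "\<forall>k<m. sat (arr ?s1 ''l'') k \<noteq> {}" by (simp add: sat1)
    have "reg ?s2 ''f'' = 1" unfolding count(2) of_bool_def by (rule if_P[OF imp])
    then have run: "run clause_prog s = run emit_prog (run edge_prog (run min_prog ?s2))"
      by (simp add: clause_prog_def)
    let ?s3 = "run min_prog ?s2"
    let ?s4 = "run edge_prog ?s3"
    let ?s5 = "run emit_prog ?s4"
    let ?c = "arr ?s3 ''l''"
    have sm3: "same {''t'', ''k'', ''e''} {''b'', ''l''} ?s2 ?s3"
      by (rule same_run) (simp_all add: min_prog_def check_prog_def decr_prog_def)
    have sm4: "same {''k'', ''t'', ''u'', ''a''} {''A''} ?s3 ?s4"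
      by (rule same_run) (simp_all add: edge_prog_def find_prog_def mark_prog_def)
    have sm5: "same {''t'', ''z''} {''o''} ?s4 ?s5"
      by (rule same_run) (simp_all add: emit_prog_def)
    have I3: "cnf_inv P M cs ?s3" by (rule cnf_inv_cong[OF I2 sm3]) auto
    then have b3: "base ?s3" by (simp add: cnf_inv_def)
    have b4: "base ?s4" by (rule base_cong[OF b3 sm4]) auto
    have b5: "base ?s5" by (rule base_cong[OF b4 sm5]) auto
    have "start i j t \<le> 2" for t by (simp add: start_def)
    then have "\<forall>t<n. arr ?s2 ''l'' t \<le> 2" using l1 l2 by simp
    moreover have "\<forall>k<m. arr ?s2 ''b'' k = card (sat (arr ?s2 ''l'') k)"
      "\<forall>k<m. sat (arr ?s2 ''l'') k \<noteq> {}"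
      using count(1) imp l2 by auto
    ultimately have c: "\<forall>t. ?c t = 0 \<or> ?c t = arr ?s1 ''l'' t" "good ?c"
      "\<forall>k<m. arr ?s3 ''b'' k = card (sat ?c k)"
      using min_prog[OF b2] l2 by auto
    note edge = edge_prog[OF b3 c(2,3)]
    have l4: "arr ?s4 ''l'' = ?c" using same_arr[OF sm4, of "''l''"] by simp
    have "\<forall>t<n. arr ?s4 ''l'' t \<le> 2" using c(2) l4 by (simp add: good_def)
    from emit_prog[OF b4 this]
    have "buffer ?s5 = buffer ?s4 @ map encode_literal (clause_of ?c) @ [0]" by (simp add: l4)
    moreover have "buffer ?s4 = buffer ?s3"
      using same_arr[OF sm4, of "''o''"] same_reg[OF sm4, of "''z''"] by (simp add: buffer_def)
    ultimately have "buffer ?s5 = encode_clauses (map clause_of (cs @ [?c]))"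
      using I3 by (simp add: cnf_inv_def encode_clauses_snoc)
    moreover have "arr ?s5 ''A'' (x * w + y) = of_bool (\<exists>c\<in>set (cs @ [?c]). edge c x y)"
      if "x < w" "y < w" for x y
    proof -
      have "arr ?s5 ''A'' (x * w + y) = (if edge ?c x y then 1 else arr ?s3 ''A'' (x * w + y))"
        using edge that same_arr[OF sm5, of "''A''"] by simp
      also have "arr ?s3 ''A'' (x * w + y) = of_bool (\<exists>c\<in>set cs. edge c x y)"
        using I3 that by (simp add: cnf_inv_def)
      finally show ?thesis by auto
    qed
    moreover have "\<forall>t<n. ?c t = 0 \<or> ?c t = start i j t" using c(1) l1 by metis
    ultimately have "cnf_inv (insert (i, j) P) (Suc M) (cs @ [?c]) ?s5"
      using I3 b5 c(2) unfolding cnf_inv_def by auto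
    then show ?thesis unfolding run by blast
  qed
qed

lemma cnf_prog:
  assumes b: "base s" and A: "arr s ''A'' = (\<lambda>_. 0)" and z: "reg s ''z'' = 0"
  shows "\<exists>cs. cnf_inv ({..<m} \<times> {..<n}) (m * n) cs (run cnf_prog s)"
proof -
  let ?P = "\<lambda>i j. {..<i} \<times> {..<n} \<union> {i} \<times> {..<j}"
  let ?R = "{''j'', ''t'', ''k'', ''e'', ''f'', ''u'', ''a'', ''z''}" and ?A = "{''l'', ''b'', ''A'', ''o''}"
  let ?R' = "insert ''i'' ?R"
  let ?I = "\<lambda>i s. \<exists>cs. cnf_inv ({..<i} \<times> {..<n}) (i * n) cs s"
  have inner: "?I (Suc i) (run (For ''j'' ''n'' clause_prog) s)"
    if I: "?I i s" and i: "reg s ''i'' = i" "i < m" for i s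
  proof -
    let ?J = "\<lambda>j s. \<exists>cs. cnf_inv (?P i j) (i * n + j) cs s"
    have "?J n (run (For ''j'' ''n'' clause_prog) s)"
    proof (rule run_For[where I = ?J and R = ?R and A = ?A])
      fix j s' assume j: "j < n" "reg s' ''j'' = j" and sm: "same ?R ?A s s'" and J: "?J j s'"
      from J obtain cs where cs: "cnf_inv (?P i j) (i * n + j) cs s'" by blast
      have "reg s' ''i'' = i" using same_reg[OF sm, of "''i''"] i by simp
      from clause_prog[OF cs this i(2) j(2)] obtain cs' where
        cs': "cnf_inv (insert (i, j) (?P i j)) (Suc (i * n + j)) cs' (run clause_prog s')" by blast
      have "same {''j''} {} (run clause_prog s') (setr ''j'' (Suc j) (run clause_prog s'))"
        by (simp add: same_def)
      from cnf_inv_cong[OF cs' this]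
      have "cnf_inv (insert (i, j) (?P i j)) (Suc (i * n + j)) cs' (setr ''j'' (Suc j) (run clause_prog s'))"
        by auto
      moreover have "insert (i, j) (?P i j) = ?P i (Suc j)" by auto
      ultimately show "?J (Suc j) (setr ''j'' (Suc j) (run clause_prog s'))" by auto
    next
      from I obtain cs where cs: "cnf_inv ({..<i} \<times> {..<n}) (i * n) cs s" by blast
      have "same {''j''} {} s (setr ''j'' 0 s)" by (simp add: same_def)
      from cnf_inv_cong[OF cs this] show "?J 0 (setr ''j'' 0 s)" by auto
      from cs show "reg s ''n'' = n" by (auto simp: cnf_inv_def base_def)
    qed (auto simp: cnf_defs)
    moreover have "?P i n = {..<Suc i} \<times> {..<n}" by auto
    ultimately show ?thesis by (simp add: add.commute del: run.simps)
  qed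
  show ?thesis
    unfolding cnf_prog_def
  proof (rule run_For[where I = ?I and R = ?R' and A = ?A])
    fix i s' assume i: "i < m" "reg s' ''i'' = i" and I: "?I i s'"
    from inner[OF I i(2,1)] obtain cs where
      cs: "cnf_inv ({..<Suc i} \<times> {..<n}) (Suc i * n) cs (run (For ''j'' ''n'' clause_prog) s')" by blast
    have "same {''i''} {} (run (For ''j'' ''n'' clause_prog) s') (setr ''i'' (Suc i) (run (For ''j'' ''n'' clause_prog) s'))"
      by (simp add: same_def del: run.simps)
    from cnf_inv_cong[OF cs this]
    show "?I (Suc i) (setr ''i'' (Suc i) (run (For ''j'' ''n'' clause_prog) s'))" by blast
  next
    have "cnf_inv {} 0 [] (setr ''i'' 0 s)"
      using b A z by (auto simp: cnf_inv_def base_def buffer_def encode_clauses_def)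
    then show "?I 0 (setr ''i'' 0 s)" by auto
  qed (use b in \<open>auto simp: cnf_defs base_def\<close>)
qed

lemma set_clause_of: "set (clause_of c) = {(t, c t = 2) | t. t < n \<and> c t \<noteq> 0}"
  by (auto simp: clause_of_def)

lemma clause_of_literals: "distinct (clause_of c)" "set (clause_of c) \<subseteq> literals n"
  by (auto simp: clause_of_def distinct_map inj_on_def literals_def)

lemma lit_true_sat:
  assumes "good c" "t < n" "c t \<noteq> 0"
  shows "lit_true (xs ! k) (t, c t = 2) \<longleftrightarrow> t \<in> sat c k"
proof -
  have "c t = 1 \<or> c t = 2" using assms by (auto simp: good_def le_Suc_eq numeral_2_eq_2)
  then show ?thesis using assms(2) by (auto simp: lit_true_def sat_def)
qed

lemma good_prime_implicate:
  assumes g: "good c"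
  shows "prime_implicate D (clause_of c)"
  unfolding prime_implicate_def
proof (intro conjI ballI)
  fix x assume "x \<in> D"
  then obtain k where k: "k < m" "xs ! k = x" using in_D_row by blast
  with g obtain t where t: "t \<in> sat c k" unfolding good_def by blast
  then have "t < n" "c t \<noteq> 0" by (auto simp: sat_def)
  with lit_true_sat[OF g this, of k] t k show "\<exists>l\<in>set (clause_of c). lit_true x l"
    unfolding set_clause_of by blast
next
  fix l assume "l \<in> set (clause_of c)"
  then obtain t where t: "l = (t, c t = 2)" "t < n" "c t \<noteq> 0" unfolding set_clause_of by blast
  with g obtain k where k: "k < m" "sat c k = {t}" unfolding good_def by blast
  have "lit_true (xs ! k) l' \<longleftrightarrow> l' = l" if "l' \<in> set (clause_of c)" for l'
  proof -
    from that obtain t' where t': "l' = (t', c t' = 2)" "t' < n" "c t' \<noteq> 0" unfolding set_clause_of by blast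
    with lit_true_sat[OF g t'(2,3), of k] k(2) t(1) show ?thesis by auto
  qed
  then show "\<exists>x\<in>D. \<forall>l'\<in>set (clause_of c). lit_true x l' \<longleftrightarrow> l' = l"
    using row_in_D[OF k(1)] by blast
qed

lemma implications_edge:
  assumes good: "\<And>c. c \<in> set cs \<Longrightarrow> good c"
  shows "(l, l') \<in> implications (set (map clause_of cs)) \<longleftrightarrow>
    (\<exists>c\<in>set cs. edge c (encode_literal l) (encode_literal l'))"
proof -
  have enc: "encode_literal (t, c t = 2) = 2 * t + c t"
    "encode_literal (neg (t, c t = 2)) = 2 * t + 3 - c t"
    if "c \<in> set cs" "t < n" "c t \<noteq> 0" for c t
  proof -
    have "c t = 1 \<or> c t = 2" using good[OF that(1)] that(2,3) by (auto simp: good_def le_Suc_eq numeral_2_eq_2)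
    then show "encode_literal (t, c t = 2) = 2 * t + c t"
      "encode_literal (neg (t, c t = 2)) = 2 * t + 3 - c t" by auto
  qed
  show ?thesis
  proof
    assume "(l, l') \<in> implications (set (map clause_of cs))"
    then obtain c a where c: "c \<in> set cs" "l \<in> set (clause_of c)" "a \<in> set (clause_of c)" "l \<noteq> a" "l' = neg a"
      unfolding implications_def by auto
    then obtain t t' where t: "l = (t, c t = 2)" "t < n" "c t \<noteq> 0" "a = (t', c t' = 2)" "t' < n" "c t' \<noteq> 0"
      unfolding set_clause_of by blast
    then have "edge c (encode_literal l) (encode_literal l')"
      unfolding edge_def using c enc[OF c(1) t(2,3)] enc[OF c(1) t(5,6)] by blast
    with c(1) show "\<exists>c\<in>set cs. edge c (encode_literal l) (encode_literal l')" by blast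
  next
    assume "\<exists>c\<in>set cs. edge c (encode_literal l) (encode_literal l')"
    then obtain c t t' where c: "c \<in> set cs" and t: "t < n" "t' < n" "t \<noteq> t'" "c t \<noteq> 0" "c t' \<noteq> 0"
      "encode_literal l = 2 * t + c t" "encode_literal l' = 2 * t' + 3 - c t'"
      unfolding edge_def by blast
    have l: "l = (t, c t = 2)" "l' = neg (t', c t' = 2)"
      using enc[OF c t(1,4)] enc[OF c t(2,5)] t(6,7) by (metis encode_literal_inj)+
    have "(t, c t = 2) \<in> set (clause_of c)" "(t', c t' = 2) \<in> set (clause_of c)"
      using t unfolding set_clause_of by blast+
    moreover have "(t, c t = 2) \<noteq> (t', c t' = 2)" using t(3) by simp
    ultimately show "(l, l') \<in> implications (set (map clause_of cs))"
      unfolding implications_def l using c by fastforce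
  qed
qed

text \<open>A vector \<open>y\<close> outside \<open>D\<close> shares its first \<open>j\<close>
  bits with some row \<open>i\<close>, for a depth \<open>j\<close> at which no row shares one bit
  more. Then no row follows \<open>y\<close> through position \<open>j\<close>, so
  \<open>start i j\<close> is an implicate, and all its literals are false at \<open>y\<close>; so
  is every subclause.\<close>

lemma cnf_models:
  assumes I: "cnf_inv ({..<m} \<times> {..<n}) M cs s"
  shows "models n (CNF (map clause_of cs)) = D"
proof (intro equalityI subsetI)
  fix x assume x: "x \<in> D"
  have "\<exists>l\<in>set (clause_of c). lit_true x l" if "c \<in> set cs" for c
    using good_prime_implicate[of c] I that x unfolding cnf_inv_def prime_implicate_def by blast
  then show "x \<in> models n (CNF (map clause_of cs))"
    using length_D[OF x] by (simp add: models_def)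
next
  fix y assume y: "y \<in> models n (CNF (map clause_of cs))"
  then have len: "length y = n" by (simp add: models_def)
  show "y \<in> D"
  proof (rule ccontr)
    assume yD: "y \<notin> D"
    define P where "P j \<longleftrightarrow> (\<exists>i<m. \<forall>t<j. xs ! i ! t = y ! t)" for j
    have "P 0" using m_pos by (auto simp: P_def intro!: exI[of _ 0])
    moreover have "\<not> P n"
    proof
      assume "P n"
      then obtain i where i: "i < m" "\<forall>t<n. xs ! i ! t = y ! t" by (auto simp: P_def)
      then have "xs ! i = y" using len length_row by (intro nth_equalityI) auto
      with i(1) yD row_in_D show False by blast
    qed
    \<comment> \<open>The depth at which \<open>y\<close> leaves the prefix tree of
      \<open>D\<close>.\<close>
    ultimately obtain j where j: "j < n" "P j" "\<not> P (Suc j)"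
      using inc_induct[of 0 n "\<lambda>j. \<not> P j"] by auto
    from j(2) obtain i where i: "i < m" "\<forall>t<j. xs ! i ! t = y ! t" by (auto simp: P_def)
    with j(3) have ij: "xs ! i ! j \<noteq> y ! j" by (auto simp: P_def less_Suc_eq)
    have "sat (start i j) k \<noteq> {}" if k: "k < m" for k
    proof
      assume e: "sat (start i j) k = {}"
      have "xs ! k ! t = y ! t" if "t < Suc j" for t
      proof -
        have "t < n" using that j(1) by simp
        then have "start i j t \<noteq> of_bool (xs ! k ! t) + 1" using e by (auto simp: sat_def)
        then show ?thesis using that i(2) ij
          by (cases "t < j") (auto simp: start_def less_Suc_eq split: if_splits)
      qed
      with j(3) k show False by (auto simp: P_def)
    qed
    then obtain c where c: "c \<in> set cs" "\<forall>t<n. c t = 0 \<or> c t = start i j t"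
      using I i(1) j(1) unfolding cnf_inv_def by blast
    from c(1) y obtain l where l: "l \<in> set (clause_of c)" "lit_true y l" by (auto simp: models_def)
    then obtain t where t: "t < n" "c t \<noteq> 0" "y ! t = (c t = 2)"
      unfolding set_clause_of by (auto simp: lit_true_def)
    have ct: "c t = start i j t" using c(2)[rule_format, OF t(1)] t(2) by simp
    have "t < j \<or> t = j" using t(2) unfolding ct start_def by presburger
    then show False
    proof
      assume "t < j"
      then have "c t = 2 - of_bool (y ! t)" using i(2) ct by (simp add: start_def)
      with t(3) show False by (cases "y ! t") simp_all
    next
      assume "t = j"
      then have "c t = of_bool (xs ! i ! t) + 1" using ct by (simp add: start_def)
      with t(3) ij \<open>t = j\<close> show False by (cases "y ! t") simp_all
    qed
  qed
qed

end

section \<open>Strong connectivity\<close>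

definition pick_prog :: prog where
  "pick_prog =
     (Asg ''u'' (N 0) ;; For ''v'' ''w'' (Cond (Eq (Sel ''S'' (V ''v'')) (N 1)) (Asg ''u'' (V ''v'')) Nop))"

definition expand_prog :: prog where
  "expand_prog =
     For ''v'' ''w''
       (Cond (And (Eq (cell ''A'' ''T'' ''u'' ''v'') (N 1)) (Eq (Sel ''S'' (V ''v'')) (N 0)))
         (Sto ''S'' (V ''v'') (N 1)) Nop)"

definition clear_prog :: prog where
  "clear_prog = For ''v'' ''w'' (Sto ''S'' (V ''v'') (N 0))"

definition reach_prog :: "nat \<Rightarrow> prog" where
  "reach_prog a =
     (clear_prog ;; Sto ''S'' (N a) (N 1) ;;
      For ''r'' ''w''
        (pick_prog ;;
         Cond (Less (N 0) (V ''u'')) (Sto ''S'' (V ''u'') (N 2) ;; expand_prog) Nop))"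

definition flag_prog :: prog where
  "flag_prog =
     For ''v'' ''w'' (Cond (And (Less (N 0) (V ''v'')) (Eq (Sel ''S'' (V ''v'')) (N 0))) (Asg ''x'' (N 1)) Nop)"

lemmas search_defs = pick_prog_def expand_prog_def clear_prog_def reach_prog_def flag_prog_def

context ram_input
begin

definition graph :: "state \<Rightarrow> (nat \<times> nat) set" where
  "graph s = {(u, v). u < w \<and> v < w \<and> arr s ''A'' (u * w + v) = 1}"

text \<open>Vertex 0 codes no literal, so the result 0 can mean that no vertex is pending;
  \<open>S0\<close> ensures that it is never itself pending.\<close>

lemma pick_prog:
  assumes b: "base s" and S0: "arr s ''S'' 0 = 0"
  defines "u \<equiv> reg (run pick_prog s) ''u''"
  shows "(u = 0 \<and> (\<forall>v<w. arr s ''S'' v \<noteq> 1)) \<or> (0 < u \<and> u < w \<and> arr s ''S'' u = 1)"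
proof -
  let ?s = "setr ''u'' 0 s"
  let ?p = "Cond (Eq (Sel ''S'' (V ''v'')) (N 1)) (Asg ''u'' (V ''v'')) Nop"
  let ?I = "\<lambda>v s'. (reg s' ''u'' = 0 \<and> (\<forall>v'<v. arr s ''S'' v' \<noteq> 1)) \<or>
    (0 < reg s' ''u'' \<and> reg s' ''u'' < w \<and> arr s ''S'' (reg s' ''u'') = 1)"
  have "?I w (run (For ''v'' ''w'' ?p) ?s)"
  proof (rule run_For[where I = ?I and R = "{''v'', ''u''}" and A = "{}"])
    fix v s' assume v: "v < w" "reg s' ''v'' = v" and sm: "same {''v'', ''u''} {} ?s s'" and I: "?I v s'"
    have "arr s' ''S'' = arr s ''S''" using same_arr[OF sm, of "''S''"] by simp
    moreover have "v = 0 \<Longrightarrow> arr s ''S'' v \<noteq> 1" using S0 by simp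
    ultimately show "?I (Suc v) (setr ''v'' (Suc v) (run ?p s'))"
      using I v by (cases "arr s ''S'' v = 1") (auto simp: less_Suc_eq)
  qed (use b in \<open>auto simp: base_def\<close>)
  then show ?thesis by (simp add: u_def pick_prog_def del: run.simps(7))
qed

lemma expand_prog:
  assumes b: "base s" and u: "reg s ''u'' = u" "u < w"
  shows "\<forall>v<w. arr (run expand_prog s) ''S'' v =
    (if (u, v) \<in> graph s \<and> arr s ''S'' v = 0 then 1 else arr s ''S'' v)"
proof -
  let ?p = "Cond (And (Eq (cell ''A'' ''T'' ''u'' ''v'') (N 1)) (Eq (Sel ''S'' (V ''v'')) (N 0)))
         (Sto ''S'' (V ''v'') (N 1)) Nop"
  let ?I = "\<lambda>v s'. \<forall>v'. arr s' ''S'' v' =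
    (if v' < v \<and> (u, v') \<in> graph s \<and> arr s ''S'' v' = 0 then 1 else arr s ''S'' v')"
  have "?I w (run (For ''v'' ''w'' ?p) s)"
  proof (rule run_For[where I = ?I and R = "{''v''}" and A = "{''S''}"])
    fix v s' assume v: "v < w" "reg s' ''v'' = v" and sm: "same {''v''} {''S''} s s'" and I: "?I v s'"
    have "base s'" by (rule base_cong[OF b sm]) auto
    note bs = base_simps[OF this]
    have "arr s' ''A'' = arr s ''A''" "reg s' ''u'' = u"
      using same_arr[OF sm, of "''A''"] same_reg[OF sm, of "''u''"] u by auto
    then have "bval (Eq (cell ''A'' ''T'' ''u'' ''v'') (N 1)) s' \<longleftrightarrow> (u, v) \<in> graph s"
      using v u by (simp add: bs graph_def)
    moreover have "arr s' ''S'' v = arr s ''S'' v" using I by simp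
    ultimately have "arr (run ?p s') ''S'' v' =
        (if v' = v \<and> (u, v) \<in> graph s \<and> arr s ''S'' v = 0 then 1 else arr s' ''S'' v')" for v'
      using v(2) by (simp del: bval.simps(1)) simp
    with I show "?I (Suc v) (setr ''v'' (Suc v) (run ?p s'))"
      by (auto simp: less_Suc_eq simp del: run.simps)
  qed (use b in \<open>auto simp: base_def\<close>)
  then show ?thesis by (simp add: expand_prog_def del: run.simps(7))
qed

lemma clear_prog:
  assumes b: "base s"
  shows "\<forall>v<w. arr (run clear_prog s) ''S'' v = 0"
proof -
  let ?I = "\<lambda>v s'. \<forall>v'<v. arr s' ''S'' v' = 0"
  have "?I w (run (For ''v'' ''w'' (Sto ''S'' (V ''v'') (N 0))) s)"
    by (rule run_For[where I = ?I and R = "{''v''}" and A = "{''S''}"])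
      (use b in \<open>auto simp: base_def\<close>)
  then show ?thesis by (simp add: clear_prog_def del: run.simps(7))
qed

text \<open>The entries of \<open>S\<close> are 0 for unvisited, 1 for pending and 2 for expanded vertices. A round
  expands a pending vertex if there is one, so that after \<open>w\<close> rounds none is left.\<close>

lemma reach_prog:
  assumes b: "base s" and a: "0 < a" "a < w" and G0: "\<And>u. (u, 0) \<notin> graph s"
  shows "\<forall>v<w. arr (run (reach_prog a) s) ''S'' v \<noteq> 0 \<longleftrightarrow> (a, v) \<in> (graph s)\<^sup>*"
proof -
  let ?G = "graph s"
  let ?p = "pick_prog ;; Cond (Less (N 0) (V ''u'')) (Sto ''S'' (V ''u'') (N 2) ;; expand_prog) Nop"
  let ?s1 = "run clear_prog s"
  let ?s2 = "seta ''S'' a 1 ?s1"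
  have sm1: "same {''v''} {''S''} s ?s1" by (rule same_run) (simp_all add: clear_prog_def)
  have b1: "base ?s1" by (rule base_cong[OF b sm1]) auto
  have b2: "base ?s2" using b1 by (simp add: base_def)
  have S2: "arr ?s2 ''S'' v = of_bool (v = a)" if "v < w" for v using clear_prog[OF b] that by auto
  let ?N = "\<lambda>s'. card {v. v < w \<and> arr s' ''S'' v = 2}"
  let ?I = "\<lambda>r s'. arr s' ''S'' a \<noteq> 0 \<and> arr s' ''S'' 0 = 0 \<and>
    (\<forall>v<w. arr s' ''S'' v \<le> 2) \<and>
    (\<forall>v<w. arr s' ''S'' v \<noteq> 0 \<longrightarrow> (a, v) \<in> ?G\<^sup>*) \<and>
    (\<forall>u v. u < w \<and> arr s' ''S'' u = 2 \<and> (u, v) \<in> ?G \<longrightarrow> arr s' ''S'' v \<noteq> 0) \<and>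
    (r \<le> ?N s' \<or> (\<forall>v<w. arr s' ''S'' v \<noteq> 1))"
  let ?R = "{''r'', ''v'', ''u''}"
  let ?t = "run (For ''r'' ''w'' ?p) ?s2"
  have I: "?I w ?t"
  proof (rule run_For[where I = ?I and R = ?R and A = "{''S''}"])
    fix r s' assume r: "r < w" "reg s' ''r'' = r" and sm: "same ?R {''S''} ?s2 s'" and I: "?I r s'"
    have b': "base s'" by (rule base_cong[OF b2 sm]) auto
    let ?p1 = "run pick_prog s'"
    let ?u = "reg ?p1 ''u''"
    have smp: "same {''u'', ''v''} {} s' ?p1" by (rule same_run) (simp_all add: pick_prog_def)
    have bp: "base ?p1" by (rule base_cong[OF b' smp]) auto
    have Sp: "arr ?p1 ''S'' = arr s' ''S''" using same_arr[OF smp, of "''S''"] by simp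
    have "arr s' ''S'' 0 = 0" using I by blast
    note pick = pick_prog[OF b' this]
    show "?I (Suc r) (setr ''r'' (Suc r) (run ?p s'))"
    proof (cases "?u = 0")
      case True
      then have "\<forall>v<w. arr s' ''S'' v \<noteq> 1" using pick by simp
      with I True show ?thesis by (simp add: Sp)
    next
      case False
      then have u: "?u < w" "arr s' ''S'' ?u = 1" using pick by auto
      let ?s3 = "seta ''S'' ?u 2 ?p1"
      let ?s4 = "run expand_prog ?s3"
      have b3: "base ?s3" using bp by (simp add: base_def)
      have G3: "graph ?s3 = ?G"
        using same_arr[OF smp, of "''A''"] same_arr[OF sm, of "''A''"] same_arr[OF sm1, of "''A''"]
        by (simp add: graph_def)
      have run: "run ?p s' = ?s4" using False by simp
      have S4: "arr ?s4 ''S'' v = (if v = ?u then 2 else if (?u, v) \<in> ?G \<and> arr s' ''S'' v = 0 then 1 else arr s' ''S'' v)"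
        if "v < w" for v
        using expand_prog[OF b3 _ u(1)] that G3 Sp by simp
      have w0: "0 < w" by (simp add: w_def)
      have au: "(a, ?u) \<in> ?G\<^sup>*" using I u by auto
      have ne: "arr ?s4 ''S'' v \<noteq> 0" if "v < w" "arr s' ''S'' v \<noteq> 0" for v
        using that S4 by auto
      have 1: "arr ?s4 ''S'' a \<noteq> 0" using ne a(2) I by blast
      have 2: "arr ?s4 ''S'' 0 = 0" using S4[OF w0] I G0 False by auto
      have 3: "\<forall>v<w. arr ?s4 ''S'' v \<le> 2" using S4 I by auto
      have 4: "(a, v) \<in> ?G\<^sup>*" if "v < w" "arr ?s4 ''S'' v \<noteq> 0" for v
      proof (cases "v = ?u \<or> arr s' ''S'' v \<noteq> 0")
        case True
        with au I that(1) show ?thesis by blast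
      next
        case False
        with S4[OF that(1)] that(2) have "(?u, v) \<in> ?G" by (auto split: if_splits)
        with au show ?thesis by (rule rtrancl_into_rtrancl)
      qed
      have 5: "arr ?s4 ''S'' v \<noteq> 0" if "x < w" "arr ?s4 ''S'' x = 2" "(x, v) \<in> ?G" for x v
      proof -
        have v: "v < w" using that(3) by (simp add: graph_def)
        show ?thesis
        proof (cases "x = ?u")
          case True
          with S4[OF v] that(3) show ?thesis by auto
        next
          case False
          with S4[OF that(1)] that(2) have "arr s' ''S'' x = 2" by (auto split: if_splits)
          with I that have "arr s' ''S'' v \<noteq> 0" by blast
          with ne v show ?thesis by blast
        qed
      qed
      have "{v. v < w \<and> arr ?s4 ''S'' v = 2} = insert ?u {v. v < w \<and> arr s' ''S'' v = 2}"
        using S4 u by (auto split: if_splits)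
      moreover have "?u \<notin> {v. v < w \<and> arr s' ''S'' v = 2}" using u by simp
      ultimately have "?N ?s4 = Suc (?N s')" by simp
      moreover have "r \<le> ?N s'" using I u by blast
      ultimately have 6: "Suc r \<le> ?N ?s4" by simp
      show ?thesis unfolding run setr_simps using 1 2 3 4 5 6 by blast
    qed
  next
    have *: "arr (setr ''r'' 0 ?s2) ''S'' v = of_bool (v = a)" if "v < w" for v using S2 that by simp
    have w0: "0 < w" by (simp add: w_def)
    show "?I 0 (setr ''r'' 0 ?s2)" using * a w0 by (auto simp: graph_def of_bool_def simp del: seta_simps setr_simps split: if_splits)
    show "reg ?s2 ''w'' = w" using b2 by (simp add: base_def)
  qed (auto simp: pick_prog_def expand_prog_def)
  have w0: "0 < w" by (simp add: w_def)
  \<comment> \<open>Vertex 0 has no incoming arrow and is never expanded, so fewer than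
    \<open>w\<close> vertices are. This excludes the first alternative of the last conjunct of the
    invariant after \<open>w\<close> rounds.\<close>
  have "{v. v < w \<and> arr ?t ''S'' v = 2} \<subseteq> {..<w} - {0}" using I by auto
  then have "?N ?t \<le> card ({..<w} - {0})" by (rule card_mono[rotated]) simp
  also have "\<dots> < w" using w0 by simp
  finally have "\<not> w \<le> ?N ?t" by simp
  with I have "\<forall>v<w. arr ?t ''S'' v \<noteq> 1" by blast
  then have two: "arr ?t ''S'' v = 2" if "v < w" "arr ?t ''S'' v \<noteq> 0" for v
  proof -
    have "arr ?t ''S'' v \<le> 2" "arr ?t ''S'' v \<noteq> 1"
      using that(1) I \<open>\<forall>v<w. arr ?t ''S'' v \<noteq> 1\<close> by blast+
    with that(2) show ?thesis by linarith
  qed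
  have "v < w \<and> arr ?t ''S'' v \<noteq> 0" if "(a, v) \<in> ?G\<^sup>*" for v
    using that
  proof (induction rule: rtrancl_induct)
    case base
    with I a show ?case by blast
  next
    case (step u v)
    then have "arr ?t ''S'' u = 2" using two by blast
    moreover have "v < w" using step(2) by (simp add: graph_def)
    ultimately show ?case using step I by blast
  qed
  moreover have "(a, v) \<in> ?G\<^sup>*" if "v < w" "arr ?t ''S'' v \<noteq> 0" for v using I that by blast
  moreover have "run (reach_prog a) s = ?t" by (simp add: reach_prog_def)
  ultimately show ?thesis by metis
qed

lemma flag_prog:
  assumes b: "base s"
  shows "reg (run flag_prog s) ''x'' = (if \<exists>v<w. 0 < v \<and> arr s ''S'' v = 0 then 1 else reg s ''x'')"
proof -
  let ?p = "Cond (And (Less (N 0) (V ''v'')) (Eq (Sel ''S'' (V ''v'')) (N 0))) (Asg ''x'' (N 1)) Nop"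
  let ?I = "\<lambda>v s'. reg s' ''x'' = (if \<exists>v'<v. 0 < v' \<and> arr s ''S'' v' = 0 then 1 else reg s ''x'')"
  have "?I w (run (For ''v'' ''w'' ?p) s)"
  proof (rule run_For[where I = ?I and R = "{''v'', ''x''}" and A = "{}"])
    fix v s' assume v: "v < w" "reg s' ''v'' = v" and sm: "same {''v'', ''x''} {} s s'" and I: "?I v s'"
    have "arr s' ''S'' = arr s ''S''" using same_arr[OF sm, of "''S''"] by simp
    then show "?I (Suc v) (setr ''v'' (Suc v) (run ?p s'))"
      using I v by (auto simp: Ex_less_Suc)
  qed (use b in \<open>auto simp: base_def\<close>)
  then show ?thesis by (simp add: flag_prog_def del: run.simps(7))
qed

end

section \<open>The algorithm\<close>

text \<open>Codes 1 and 2 are the negated and the plain literal of variable 0. The register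
  \<open>''x''\<close> is raised as soon as one of the two searches misses a literal.\<close>

definition search_prog :: prog where
  "search_prog = (reach_prog 1 ;; flag_prog ;; reach_prog 2 ;; flag_prog)"

definition print_prog :: prog where
  "print_prog = (Out (N 1) ;; For ''i'' ''z'' (Out (Sel ''o'' (V ''i''))))"

text \<open>The pieces are composed after compilation because the whole would not be well-formed as
  one loop program: \<open>''w''\<close> and \<open>''z''\<close> are assigned in one piece and
  bound loops in later ones.\<close>

definition recognizer :: com where
  "recognizer =
     Seq (compile width_prog) (Seq (compile tables_prog) (Seq (compile affine_prog)
       (If (Eq (V ''q'') (V ''size''))
         (compile xnf_prog)
         (Seq (compile cnf_prog) (Seq (compile search_prog)
           (If (Eq (V ''x'') (N 0)) (compile (Out (N 0))) (compile print_prog)))))))"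

lemma well_formed_progs:
  "well_formed width_prog" "well_formed tables_prog" "well_formed affine_prog"
  "well_formed xnf_prog" "well_formed cnf_prog" "well_formed search_prog"
  "well_formed print_prog" "well_formed (Out e)"
  by (simp_all add: well_formed_def width_prog_def tables_prog_def table_prog_def aff_defs
      xnf_prog_def xnf_row_prog_def cnf_defs search_prog_def search_defs print_prog_def)

section \<open>Correctness and running time\<close>

context ram_input
begin

lemma print_prog:
  "out (run print_prog s) = out s @ 1 # buffer s"
proof -
  let ?s = "emit 1 s"
  let ?I = "\<lambda>i s'. out s' = out s @ 1 # map (arr s ''o'') [0..<i]"
  have "?I (reg s ''z'') (run (For ''i'' ''z'' (Out (Sel ''o'' (V ''i'')))) ?s)"
  proof (rule run_For[where I = ?I and R = "{''i''}" and A = "{}"])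
    fix i s' assume i: "i < reg s ''z''" "reg s' ''i'' = i" and sm: "same {''i''} {} ?s s'" and I: "?I i s'"
    have "arr s' ''o'' = arr s ''o''" using same_arr[OF sm, of "''o''"] by simp
    then show "?I (Suc i) (setr ''i'' (Suc i) (run (Out (Sel ''o'' (V ''i''))) s'))" using I i by simp
  qed auto
  then show ?thesis by (simp add: print_prog_def buffer_def del: run.simps(7))
qed

lemma literals_code: "0 < v \<and> v < w \<longleftrightarrow> (\<exists>l\<in>literals n. v = encode_literal l)"
proof
  assume v: "0 < v \<and> v < w"
  then have "v = 2 * ((v - 1) div 2) + (if even v then 2 else 1)" by presburger
  then have "v = encode_literal ((v - 1) div 2, even v)" by simp
  moreover have "((v - 1) div 2, even v) \<in> literals n" using v by (auto simp: literals_def w_def)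
  ultimately show "\<exists>l\<in>literals n. v = encode_literal l" by blast
next
  assume "\<exists>l\<in>literals n. v = encode_literal l"
  then obtain i b where "v = encode_literal (i, b)" "i < n" by (auto simp: literals_def)
  then show "0 < v \<and> v < w" by (cases b) (simp_all add: w_def)
qed

lemma search_prog:
  assumes I: "cnf_inv P M cs s" and x: "reg s ''x'' = 0"
  defines "s' \<equiv> run search_prog s" and "G \<equiv> {(u, v). \<exists>c\<in>set cs. edge c u v}"
  shows "reg s' ''x'' = (if \<exists>a\<in>{1, 2}. \<exists>v<w. 0 < v \<and> (a, v) \<notin> G\<^sup>* then 1 else 0)"
    "buffer s' = buffer s" "reg s' ''z'' = reg s ''z''" "out s' = out s"
proof -
  have good: "good c" if "c \<in> set cs" for c using I that by (simp add: cnf_inv_def)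
  have E: "0 < v \<and> v < w \<and> u < w" if "edge c u v" "c \<in> set cs" for c u v
  proof -
    from that(1) obtain t t' where t: "t < n" "t' < n" "c t \<noteq> 0" "c t' \<noteq> 0" "u = 2 * t + c t" "v = 2 * t' + 3 - c t'"
      unfolding edge_def by blast
    moreover have "c t \<le> 2" "c t' \<le> 2" using good[OF that(2)] t(1,2) by (auto simp: good_def)
    ultimately show ?thesis by (simp add: w_def)
  qed
  have graph_eq: "graph r = G" if "arr r ''A'' = arr s ''A''" for r
  proof -
    have "arr s ''A'' (u * w + v) = of_bool (\<exists>c\<in>set cs. edge c u v)" if "u < w" "v < w" for u v
      using I that by (simp add: cnf_inv_def)
    then show ?thesis using E unfolding graph_def G_def that by (auto simp: of_bool_def split: if_splits)
  qed
  have G0: "(u, 0) \<notin> graph r" if "arr r ''A'' = arr s ''A''" for r u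
    using graph_eq[OF that] E by (auto simp: G_def)
  have b: "base s" using I by (simp add: cnf_inv_def)
  let ?R = "{''r'', ''v'', ''u'', ''x''}" and ?A = "{''S''}"
  let ?s1 = "run (reach_prog 1) s"
  let ?s2 = "run flag_prog ?s1"
  let ?s3 = "run (reach_prog 2) ?s2"
  have sm1: "same {''r'', ''v'', ''u''} ?A s ?s1" and sm3: "same {''r'', ''v'', ''u''} ?A ?s2 ?s3"
    by (rule same_run; simp add: search_defs)+
  have sm2: "same {''v'', ''x''} ?A ?s1 ?s2" by (rule same_run) (simp_all add: search_defs)
  have b1: "base ?s1" by (rule base_cong[OF b sm1]) auto
  have b2: "base ?s2" by (rule base_cong[OF b1 sm2]) auto
  have b3: "base ?s3" by (rule base_cong[OF b2 sm3]) auto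
  have A2: "arr ?s2 ''A'' = arr s ''A''"
    using same_arr[OF sm1, of "''A''"] same_arr[OF sm2, of "''A''"] by simp
  have w2: "1 < w" "2 < w" using n by (auto simp: w_def)
  have S1: "\<forall>v<w. arr ?s1 ''S'' v \<noteq> 0 \<longleftrightarrow> (1, v) \<in> G\<^sup>*"
    using reach_prog[OF b _ w2(1) G0[OF refl]] graph_eq[OF refl] by simp
  have S3: "\<forall>v<w. arr ?s3 ''S'' v \<noteq> 0 \<longleftrightarrow> (2, v) \<in> G\<^sup>*"
    using reach_prog[OF b2 _ w2(2) G0[OF A2]] graph_eq[OF A2] by simp
  have x1: "reg ?s1 ''x'' = 0" using same_reg[OF sm1, of "''x''"] x by simp
  have x2: "reg ?s2 ''x'' = (if \<exists>v<w. 0 < v \<and> (1, v) \<notin> G\<^sup>* then 1 else 0)"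
    unfolding flag_prog[OF b1] x1 using S1 by (intro if_cong) auto
  have "reg s' ''x'' = (if \<exists>v<w. 0 < v \<and> (2, v) \<notin> G\<^sup>* then 1 else reg ?s3 ''x'')"
    using flag_prog[OF b3] S3 by (auto simp: s'_def search_prog_def)
  also have "reg ?s3 ''x'' = reg ?s2 ''x''" using same_reg[OF sm3, of "''x''"] by simp
  finally show "reg s' ''x'' = (if \<exists>a\<in>{1, 2}. \<exists>v<w. 0 < v \<and> (a, v) \<notin> G\<^sup>* then 1 else 0)"
    unfolding x2 by auto
  have "same ?R ?A s s'" unfolding s'_def by (rule same_run) (simp_all add: search_prog_def search_defs)
  from same_reg[OF this, of "''z''"] same_arr[OF this, of "''o''"]
  show "buffer s' = buffer s" "reg s' ''z'' = reg s ''z''" by (simp_all add: buffer_def)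
  show "out s' = out s"
    unfolding s'_def by (rule run_out) (simp add: search_prog_def search_defs)
qed

text \<open>The literals reachable from \<open>a\<close> form a closed set that contains the literal
  coded by \<open>a\<close> and misses the one coded by \<open>v\<close>.\<close>

lemma not_strongly_connected:
  assumes good: "\<And>c. c \<in> set cs \<Longrightarrow> good c"
    and a: "a \<in> {1, 2}" and v: "0 < v" "v < w" "(a, v) \<notin> {(u, v). \<exists>c\<in>set cs. edge c u v}\<^sup>*"
  shows "possibility_integrity_constraint n (CNF (map clause_of cs))"
proof -
  let ?G = "{(u, v). \<exists>c\<in>set cs. edge c u v}" and ?cs = "map clause_of cs"
  let ?R = "{l \<in> literals n. (a, encode_literal l) \<in> ?G\<^sup>*}"
  have "separable n (CNF ?cs) \<or> renamable_partially_Horn n (CNF ?cs)"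
  proof (rule separable_or_renamable_partially_Horn)
    show "distinct c \<and> set c \<subseteq> literals n" if "c \<in> set ?cs" for c
      using that clause_of_literals by auto
    have "0 < a" "a < w" using a n by (auto simp: w_def)
    then obtain l0 where "l0 \<in> literals n" "a = encode_literal l0" using literals_code[of a] by blast
    then have "l0 \<in> ?R" by simp
    then show "?R \<noteq> {}" by blast
    obtain l where "l \<in> literals n" "v = encode_literal l" using literals_code[of v] v by blast
    then show "?R \<noteq> literals n" using v(3) by blast
    show "implications (set ?cs) `` ?R \<subseteq> ?R"
    proof
      fix l' assume "l' \<in> implications (set ?cs) `` ?R"
      then obtain l where l: "l \<in> ?R" "(l, l') \<in> implications (set ?cs)" by blast
      then have "(encode_literal l, encode_literal l') \<in> ?G"
        using implications_edge[OF good] by simp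
      with l(1) have "(a, encode_literal l') \<in> ?G\<^sup>*" by (auto intro: rtrancl_into_rtrancl)
      moreover obtain c b where "b \<in> set (clause_of c)" "l' = neg b"
        using l(2) unfolding implications_def by auto
      then have "l' \<in> literals n" using clause_of_literals(2)[of c] by auto
      ultimately show "l' \<in> ?R" by simp
    qed
  qed auto
  moreover have "formula_over n (CNF ?cs)"
    using clause_of_literals(2) by (force simp: formula_over_def vars_def literals_def)
  ultimately show ?thesis by (auto simp: possibility_integrity_constraint_def)
qed

lemma strongly_connected:
  assumes good: "\<And>c. c \<in> set cs \<Longrightarrow> good c"
    and conn: "\<And>a v. a \<in> {1, 2} \<Longrightarrow> 0 < v \<Longrightarrow> v < w \<Longrightarrow> (a, v) \<in> {(u, v). \<exists>c\<in>set cs. edge c u v}\<^sup>*"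
    and not_affine: "\<not> xor3_closed D"
  shows "\<not> possibility_domain n D"
proof
  let ?G = "{(u, v). \<exists>c\<in>set cs. edge c u v}" and ?E = "implications (set (map clause_of cs))"
  assume "possibility_domain n D"
  from possibility_domain_cases[OF n D this] not_affine obtain f where
    f: "aggregator 2 n D f" "\<not> dictatorial 2 n f" by blast
  \<comment> \<open>The graph lives on numbers. Its arrows lead to literal codes only, so a path
    from a literal can be read back as a path of literals.\<close>
  have code: "\<exists>l. v = encode_literal l" if "edge c u v" "c \<in> set cs" for c u v
  proof -
    from that(1) obtain t where t: "t < n" "c t \<noteq> 0" "v = 2 * t + 3 - c t" unfolding edge_def by blast
    have "c t \<le> 2" using good[OF that(2)] t(1) by (simp add: good_def)
    with t(2) have "c t = 1 \<or> c t = 2" by linarith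
    then have "v = encode_literal (t, c t = 1)" using t(3) by auto
    then show ?thesis by blast
  qed
  have path: "\<exists>l. v = encode_literal l \<and> (l0, l) \<in> ?E\<^sup>*" if "(encode_literal l0, v) \<in> ?G\<^sup>*" for l0 v
    using that
  proof (induction rule: rtrancl_induct)
    case (step u v)
    then obtain l c where l: "u = encode_literal l" "(l0, l) \<in> ?E\<^sup>*" and c: "c \<in> set cs" "edge c u v" by blast
    from code[OF c(2,1)] obtain l' where l': "v = encode_literal l'" by blast
    with c l(1) have "(l, l') \<in> ?E" using implications_edge[OF good] by blast
    with l(2) l' show ?case by (blast intro: rtrancl_into_rtrancl)
  qed blast
  have reach: "((0, b), l) \<in> ?E\<^sup>*" if l: "l \<in> literals n" for b l
  proof -
    have "(encode_literal (0, b), encode_literal l) \<in> ?G\<^sup>*"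
      using literals_code[of "encode_literal l"] l by (intro conn) auto
    from path[OF this] obtain l' where "encode_literal l = encode_literal l'" "((0, b), l') \<in> ?E\<^sup>*" by blast
    with encode_literal_inj[of l l'] show ?thesis by simp
  qed
  have "dictatorial 2 n f"
  proof (rule no_binary_aggregator[OF reach f(1)])
    show "set c \<subseteq> literals n \<and> prime_implicate D c" if "c \<in> set (map clause_of cs)" for c
      using that clause_of_literals(2) good good_prime_implicate by auto
  qed (auto intro: length_D)
  with f(2) show False ..
qed

text \<open>A clause takes at most \<open>n\<close> literals and its terminator. The register
  \<open>''z''\<close> bounds the printing loop, hence this controls its cost.\<close>

lemma buffer_bound:
  assumes I: "cnf_inv P M cs s"
  shows "reg s ''z'' \<le> M * (n + 1)"
proof -
  have "length (encode_clauses (map clause_of cs)) \<le> length cs * (n + 1)" for cs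
  proof (induction cs)
    case (Cons c cs)
    have "length (clause_of c) \<le> n"
      unfolding clause_of_def length_map using length_filter_le[of _ "[0..<n]"] by (metis diff_zero length_upt)
    with Cons show ?case by (simp add: encode_clauses_def)
  qed (simp add: encode_clauses_def)
  also have "length cs * (n + 1) \<le> M * (n + 1)"
    using I by (intro mult_right_mono) (auto simp: cnf_inv_def)
  finally have "length (encode_clauses (map clause_of cs)) \<le> M * (n + 1)" .
  moreover have "reg s ''z'' = length (buffer s)" by (simp add: buffer_def)
  ultimately show ?thesis using I by (simp add: cnf_inv_def)
qed

lemma cost_bounds:
  assumes r: "r ''n'' = n" "r ''size'' = m" "r ''w'' = w"
  shows "cost r width_prog + cost r tables_prog + cost r affine_prog + cost r xnf_prog + cost r cnf_prog +
    cost r search_prog \<le> 3000 * (m * m * n * n)"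
    "r ''z'' \<le> m * n * (n + 1) \<Longrightarrow> cost r print_prog \<le> 1000 * (m * m * n * n)"
proof -
  define B where "B = m * m * n * n"
  have mn: "1 \<le> m" "1 \<le> n" using m_pos n by auto
  have le: "1 \<le> B" "m \<le> B" "n \<le> B" "m * n \<le> B" "n * n \<le> B" "m * m * n \<le> B" "m * n * n \<le> B" "m * m \<le> B"
  proof -
    have up: "a \<le> a * b" if "1 \<le> b" for a b :: nat using that by simp
    have 1: "m * m * n \<le> B" unfolding B_def using up mn by blast
    have 2: "m * n * n \<le> B" unfolding B_def using up[of m "m * n * n"] mn by (simp add: ac_simps)
    have 3: "m * m \<le> m * m * n" "m \<le> m * m" "m * n \<le> m * n * n" "n \<le> n * n" using up mn by blast+
    have 4: "n * n \<le> m * n * n" using up[of m "n * n"] mn by (simp add: ac_simps)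
    show "1 \<le> B" "m \<le> B" "n \<le> B" "m * n \<le> B" "n * n \<le> B" "m * m * n \<le> B" "m * n * n \<le> B" "m * m \<le> B"
      using 1 2 3 4 mn by linarith+
  qed
  show "cost r width_prog + cost r tables_prog + cost r affine_prog + cost r xnf_prog + cost r cnf_prog +
    cost r search_prog \<le> 3000 * (m * m * n * n)"
  proof -
    \<comment> \<open>The coefficients come from unfolding the loop costs with
      \<open>w = 2 * n + 1\<close>. As \<open>m\<close> and \<open>n\<close> are positive, each
      monomial is at most \<open>B\<close>, and the coefficients add up to 2028.\<close>
    have "cost r width_prog + cost r tables_prog + cost r affine_prog + cost r xnf_prog + cost r cnf_prog +
      cost r search_prog = 358 + 82 * m + 705 * n + 368 * (n * n) + 147 * (m * n) + 163 * (m * n * n) +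
      70 * (m * m * n) + 135 * B"
      by (simp add: width_prog_def tables_prog_def table_prog_def aff_defs xnf_prog_def xnf_row_prog_def
          cnf_defs search_prog_def search_defs r w_def B_def algebra_simps)
    then show ?thesis using le unfolding B_def[symmetric] by linarith
  qed
  show "cost r print_prog \<le> 1000 * (m * m * n * n)" if z: "r ''z'' \<le> m * n * (n + 1)"
  proof -
    have "cost r print_prog = 10 + 12 * r ''z''" by (simp add: print_prog_def)
    moreover have "m * n * (n + 1) = m * n * n + m * n" by (simp add: algebra_simps)
    ultimately show ?thesis using le z unfolding B_def[symmetric] by linarith
  qed
qed

lemma recognizer_correct:
  "\<exists>t s answer. exec recognizer (initial_state n xs) t s \<and> t \<le> 5000 * (m * m * n * n) \<and>
     out s = encode_answer answer \<and>
     (case answer of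
        None \<Rightarrow> \<not> possibility_domain n D
      | Some \<phi> \<Rightarrow> possibility_integrity_constraint n \<phi> \<and> length (clauses \<phi>) \<le> m * n \<and> models n \<phi> = D)"
proof -
  let ?B = "m * m * n * n"
  let ?s0 = "initial_state n xs"
  define s1 where "s1 = run width_prog ?s0"
  define s2 where "s2 = run tables_prog s1"
  define s3 where "s3 = run affine_prog s2"
  define s4 where "s4 = run cnf_prog s3"
  define s5 where "s5 = run search_prog s4"
  have sm1: "same {''w''} {} ?s0 s1"
    unfolding s1_def by (rule same_run) (simp_all add: width_prog_def)
  have sm2: "same {''i'', ''p''} {''R'', ''T''} s1 s2"
    unfolding s2_def by (rule same_run) (simp_all add: tables_prog_def table_prog_def)
  have sm3: "same {''i'', ''k'', ''e'', ''j'', ''p'', ''d'', ''q''} {''v'', ''g'', ''h'', ''c''} s2 s3"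
    unfolding s3_def by (rule same_run) (simp_all add: aff_defs)
  have sm4: "same {''i'', ''j'', ''t'', ''k'', ''e'', ''f'', ''u'', ''a'', ''z''} {''l'', ''b'', ''A'', ''o''} s3 s4"
    unfolding s4_def by (rule same_run) (simp_all add: cnf_defs)
  have sm5: "same {''r'', ''v'', ''u'', ''x''} {''S''} s4 s5"
    unfolding s5_def by (rule same_run) (simp_all add: search_prog_def search_defs)
  have out: "out s3 = []" "out s4 = []"
    unfolding s1_def s2_def s3_def s4_def
    by (simp_all add: run_out width_prog_def tables_prog_def table_prog_def aff_defs cnf_defs
        initial_state_def del: run.simps)
  have b2: "base s2" unfolding s1_def s2_def by (rule tables_base)
  have "arr s2 ''h'' = (\<lambda>_. 0)"
    using same_arr[OF sm2, of "''h''"] same_arr[OF sm1, of "''h''"] by (simp add: initial_state_def)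
  note aff = affine_prog[OF b2 this, folded s3_def]
  \<comment> \<open>The loops before printing are bounded by \<open>''n''\<close>,
    \<open>''size''\<close> and \<open>''w''\<close> only, so all their costs can be evaluated at
    one common register content. Printing is bounded by \<open>''z''\<close> and is treated
    apart.\<close>
  define r where "r = reg s3"
  have r: "r ''n'' = n" "r ''size'' = m" "r ''w'' = w" using base_simps[OF aff(1)] by (simp_all add: r_def)
  define c where "c p = cost r p" for p
  have cost0: "cost (reg ?s0) width_prog = c width_prog"
    unfolding c_def by (rule cost_cong) (simp add: width_prog_def)
  have cost1: "cost (reg s1) tables_prog = c tables_prog"
    unfolding c_def r_def by (rule cost_cong)
      (auto simp: same_reg[OF sm2] same_reg[OF sm3] tables_prog_def table_prog_def)
  have cost2: "cost (reg s2) affine_prog = c affine_prog"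
    unfolding c_def r_def by (rule cost_cong) (auto simp: same_reg[OF sm3] aff_defs)
  have cost3: "cost (reg s3) p = c p" for p by (simp add: c_def r_def)
  have cost4: "cost (reg s4) search_prog = c search_prog"
    unfolding c_def r_def by (rule cost_cong)
      (auto simp: same_reg[OF sm4] search_prog_def search_defs)
  note total = cost_bounds(1)[of r, OF r, folded c_def]
  have B: "1 \<le> ?B" using m_pos n by (simp add: Suc_le_eq)
  obtain t1 where t1: "t1 \<le> c width_prog" "exec (compile width_prog) ?s0 t1 s1"
    using compile_exec[OF well_formed_progs(1), of ?s0] unfolding cost0 s1_def by blast
  obtain t2 where t2: "t2 \<le> c tables_prog" "exec (compile tables_prog) s1 t2 s2"
    using compile_exec[OF well_formed_progs(2), of s1] unfolding cost1 s2_def by blast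
  obtain t3 where t3: "t3 \<le> c affine_prog" "exec (compile affine_prog) s2 t3 s3"
    using compile_exec[OF well_formed_progs(3), of s2] unfolding cost2 s3_def by blast
  have q: "bval (Eq (V ''q'') (V ''size'')) s3 \<longleftrightarrow> reg s3 ''q'' = m" using r by (simp add: r_def)
  show ?thesis
  proof (cases "reg s3 ''q'' = m")
    case True
    obtain t4 where t4: "t4 \<le> c xnf_prog" "exec (compile xnf_prog) s3 t4 (run xnf_prog s3)"
      using compile_exec[OF well_formed_progs(4), of s3] unfolding cost3 by blast
    let ?\<phi> = "XNF (map (xnf_clause s3) [0..<n])"
    have "exec recognizer ?s0 (1 + t1 + (1 + t2 + (1 + t3 + (1 + bcost (Eq (V ''q'') (V ''size'')) + t4)))) (run xnf_prog s3)"
      unfolding recognizer_def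
      by (intro exec.Seq[OF t1(2)] exec.Seq[OF t2(2)] exec.Seq[OF t3(2)] exec.IfTrue t4(2)) (use q True in blast)
    moreover have "1 + t1 + (1 + t2 + (1 + t3 + (1 + bcost (Eq (V ''q'') (V ''size'')) + t4))) \<le> 5000 * ?B"
      using t1(1) t2(1) t3(1) t4(1) total B unfolding bcost.simps acost.simps by linarith
    moreover have "out (run xnf_prog s3) = encode_answer (Some ?\<phi>)"
      using xnf_prog[OF aff(1)] out(1) by simp
    moreover have "models n ?\<phi> = D" using xnf_models[OF aff(2)] aff(3)[OF True] by simp
    moreover have "length (clauses ?\<phi>) \<le> m * n" using m_pos by simp
    ultimately show ?thesis
      using xnf_constraint by (intro exI conjI[OF _ conjI[OF _ conjI]]) (assumption | simp)+
  next
    case False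
    then have na: "\<not> xor3_closed D" using aff(4) by blast
    obtain t4 where t4: "t4 \<le> c cnf_prog" "exec (compile cnf_prog) s3 t4 s4"
      using compile_exec[OF well_formed_progs(5), of s3] unfolding cost3 s4_def by blast
    obtain t5 where t5: "t5 \<le> c search_prog" "exec (compile search_prog) s4 t5 s5"
      using compile_exec[OF well_formed_progs(6), of s4] unfolding cost4 s5_def by blast
    have "arr s3 ''A'' = (\<lambda>_. 0)" "reg s3 ''z'' = 0" "reg s3 ''x'' = 0"
      using same_arr[OF sm3, of "''A''"] same_arr[OF sm2, of "''A''"] same_arr[OF sm1, of "''A''"]
        same_reg[OF sm3, of "''z''"] same_reg[OF sm2, of "''z''"] same_reg[OF sm1, of "''z''"]
        same_reg[OF sm3, of "''x''"] same_reg[OF sm2, of "''x''"] same_reg[OF sm1, of "''x''"]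
      by (simp_all add: initial_state_def)
    with cnf_prog[OF aff(1)] obtain cs where I: "cnf_inv ({..<m} \<times> {..<n}) (m * n) cs s4"
      and x4: "reg s4 ''x'' = 0"
      unfolding s4_def using same_reg[OF sm4, of "''x''"] by (auto simp: s4_def)
    have good: "good c" if "c \<in> set cs" for c using I that by (simp add: cnf_inv_def)
    note search = search_prog[OF I x4, folded s5_def]
    let ?t = "\<lambda>u. 1 + t1 + (1 + t2 + (1 + t3 + (1 + bcost (Eq (V ''q'') (V ''size'')) +
      (1 + t4 + (1 + t5 + (1 + bcost (Eq (V ''x'') (N 0)) + u))))))"
    \<comment> \<open>Of the 5000, 3000 cover the programs up to the search and 1000 the final
      answer; the rest absorbs the constant overhead of sequencing and tests.\<close>
    have time: "?t u \<le> 5000 * ?B" if "u \<le> 1000 * ?B" for u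
      using t1(1) t2(1) t3(1) t4(1) t5(1) total B that unfolding bcost.simps acost.simps by linarith
    have exec: "exec recognizer ?s0 (?t u) s"
      if "exec (If (Eq (V ''x'') (N 0)) (compile (Out (N 0))) (compile print_prog)) s5
            (1 + bcost (Eq (V ''x'') (N 0)) + u) s" for u s
      unfolding recognizer_def
      by (intro exec.Seq[OF t1(2)] exec.Seq[OF t2(2)] exec.Seq[OF t3(2)] exec.IfFalse
          exec.Seq[OF t4(2)] exec.Seq[OF t5(2)] that) (use q False in blast)
    show ?thesis
    proof (cases "reg s5 ''x'' = 0")
      case True
      have "exec (compile (Out (N 0))) s5 2 (emit 0 s5)"
        using exec.Write[of "N 0" s5] by (simp add: emit_def numeral_2_eq_2)
      then have "exec recognizer ?s0 (?t 2) (emit 0 s5)"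
        by (intro exec exec.IfTrue) (simp_all add: True)
      moreover have "?t 2 \<le> 5000 * ?B" by (rule time) (use B in linarith)
      moreover have "out (emit 0 s5) = encode_answer None" using search(4) out(2) by simp
      moreover have "\<not> possibility_domain n D"
        by (rule strongly_connected[OF good _ na]) (use search(1) True in \<open>auto split: if_splits\<close>)
      ultimately show ?thesis by (intro exI[of _ "?t 2"] exI[of _ "emit 0 s5"] exI[of _ None]) simp
    next
      case nz: False
      let ?\<phi> = "CNF (map clause_of cs)"
      obtain t6 where t6: "t6 \<le> cost (reg s5) print_prog" "exec (compile print_prog) s5 t6 (run print_prog s5)"
        using compile_exec[OF well_formed_progs(7), of s5] by blast
      have "exec recognizer ?s0 (?t t6) (run print_prog s5)"
        by (intro exec exec.IfFalse t6(2)) (simp add: nz)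
      moreover have "cost (reg s5) print_prog \<le> 1000 * ?B"
      proof (rule cost_bounds(2))
        show "reg s5 ''n'' = n" "reg s5 ''size'' = m" "reg s5 ''w'' = w"
          using r same_reg[OF sm4] same_reg[OF sm5] by (simp_all add: r_def)
        show "reg s5 ''z'' \<le> m * n * (n + 1)" using buffer_bound[OF I] search(3) by simp
      qed
      with t6(1) have "?t t6 \<le> 5000 * ?B" by (intro time) simp
      moreover have "out (run print_prog s5) = encode_answer (Some ?\<phi>)"
        using search(2,4) out(2) I by (simp add: print_prog cnf_inv_def)
      moreover have "possibility_integrity_constraint n ?\<phi>"
      proof -
        from nz search(1) obtain a v where "a \<in> {1, 2}" "0 < v" "v < w"
          "(a, v) \<notin> {(u, v). \<exists>c\<in>set cs. edge c u v}\<^sup>*" by (auto split: if_splits)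
        with good show ?thesis by (rule not_strongly_connected)
      qed
      moreover have "length (clauses ?\<phi>) \<le> m * n" using I by (simp add: cnf_inv_def)
      moreover have "models n ?\<phi> = D" by (rule cnf_models[OF I])
      ultimately show ?thesis
        by (intro exI[of _ "?t t6"] exI[of _ "run print_prog s5"] exI[of _ "Some ?\<phi>"]) simp
    qed
  qed
qed

end

theorem theorem4p11:
  "\<exists>(p :: com) (C :: nat) (K :: nat).
     \<forall>(n :: nat) (D :: bool list set) (xs :: bool list list).
       1 \<le> n \<and> domain n D \<and> distinct xs \<and> set xs = D \<longrightarrow>
       (\<exists>t s answer.
          exec p (initial_state n xs) t s \<and>
          t \<le> C * (card D)\<^sup>2 * n\<^sup>2 \<and>
          out s = encode_answer answer \<and>
          (case answer of
             None \<Rightarrow> \<not> possibility_domain n D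
           | Some \<phi> \<Rightarrow>
               possibility_integrity_constraint n \<phi> \<and>
               length (clauses \<phi>) \<le> K * card D * n \<and>
               models n \<phi> = D))"
proof (rule exI[of _ recognizer], rule exI[of _ 5000], rule exI[of _ 1], intro allI impI)
  fix n :: nat and D :: "bool list set" and xs :: "bool list list"
  assume "1 \<le> n \<and> domain n D \<and> distinct xs \<and> set xs = D"
  then interpret ram_input n D xs by unfold_locales auto
  show "\<exists>t s answer. exec recognizer (initial_state n xs) t s \<and>
      t \<le> 5000 * (card D)\<^sup>2 * n\<^sup>2 \<and> out s = encode_answer answer \<and>
      (case answer of
         None \<Rightarrow> \<not> possibility_domain n D
       | Some \<phi> \<Rightarrow> possibility_integrity_constraint n \<phi> \<and>
           length (clauses \<phi>) \<le> 1 * card D * n \<and> models n \<phi> = D)"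
  proof -
    have "5000 * (card D)\<^sup>2 * n\<^sup>2 = 5000 * (m * m * n * n)"
      by (simp add: card_D power2_eq_square mult.assoc)
    moreover have "1 * card D * n = m * n" by (simp add: card_D)
    ultimately show ?thesis using recognizer_correct by (simp only:)
  qed
qed

end
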